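(* Let $M$ be a compact smooth $n$-manifold and $\pi:E\to M$ a smooth vector bundle of rank $r$. Let $\Lambda$ be an augmented total trivialization atlas for $E$. Let $e_1,e_2\in\mathbb{R}$ and $q_1,q_2\in(1,\infty)$. If any of $e_1$ or $e_2$ is a noninteger less than $-1$, assume further that the total trivialization atlas in $\Lambda$ is GGL. 1. If $e_1$ and $e_2$ are not nonintegers less than $-1$ and if $W^{e_1,q_1}(\mathbb{R}^n)\hookrightarrow W^{e_2,q_2}(\mathbb{R}^n)$, then $W^{e_1,q_1}(M,E;\Lambda)\hookrightarrow W^{e_2,q_2}(M,E;\Lambda)$. 2. If $e_1$ and $e_2$ are not nonintegers less than $-1$ and if $W^{e_1,q_1}(\Omega)\hookrightarrow W^{e_2,q_2}(\Omega)$ for all open balls $\Omega\subseteq\mathbb{R}^n$, then $W^{e_1,q_1}(M,E;\Lambda)\hookrightarrow W^{e_2,q_2}(M,E;\Lambda)$. 3. If any of $e_1$ or $e_2$ is a noninteger less than $-1$ and if $W^{e_1,q_1}(\Omega)\hookrightarrow W^{e_2,q_2}(\Omega)$ for $\Omega=\mathbb{R}^n$ and for any bounded domain $\Omega\subseteq\mathbb{R}^n$ with Lipschitz continuous boundary, then $W^{e_1,q_1}(M,E;\Lambda)\hookrightarrow W^{e_2,q_2}(M,E;\Lambda)$.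
   Context: $X\hookrightarrow Y$ means $X\subseteq Y$ with continuous inclusion. Manifolds are smooth, Hausdorff and second countable; $E_U=\pi^{-1}(U)$. Trivializations. A total trivialization triple $(U,\varphi,\rho)$ for $E$ consists of a smooth chart $(U,\varphi)$ of $M$ and a smooth map $\rho=(\rho^1,\dots,\rho^r):E_U\to\mathbb{R}^r$ that is a linear isomorphism on each fibre and such that $(\pi,\rho):E_U\to U\times\mathbb{R}^r$ is a diffeomorphism. An augmented total trivialization atlas is a finite collection $\Lambda=\{(U_\alpha,\varphi_\alpha,\rho_\alpha,\psi_\alpha)\}_{1\le\alpha\le N}$ of such triples, whose charts form a smooth atlas of $M$, together with a smooth nonnegative partition of unity $\{\psi_\alpha\}$ with $\mathrm{supp}\,\psi_\alpha\subseteq U_\alpha$. The total trivialization atlas is GGL (generalized geometrically Lipschitz) if each $\varphi_\alpha(U_\alpha)$ is either $\mathbb{R}^n$ or a nonempty bounded open set with Lipschitz boundary. Euclidean spaces. Let $\Omega\subseteq\mathbb{R}^n$ be nonempty open, $1<p<\infty$. For $k\in\mathbb{N}_0$, $\|u\|_{W^{k,p}(\Omega)}=\sum_{|\nu|\le k}\|\partial^\nu u\|_{L^p(\Omega)}$; for $s=k+\theta$, $\theta\in(0,1)$, $\|u\|_{W^{s,p}(\Omega)}=\|u\|_{W^{k,p}(\Omega)}+\sum_{|\nu|=k}\big(\iint_{\Omega\times\Omega}\frac{|\partial^\nu u(x)-\partial^\nu u(y)|^p}{|x-y|^{n+\theta p}}dx\,dy\big)^{1/p}$; $W^{s,p}(\Omega)$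 is the set of $u\in L^p(\Omega)$ with finite norm. For $s\ge0$, $W^{s,p}_0(\Omega)$ is the closure of $C_c^\infty(\Omega)$ in $W^{s,p}(\Omega)$. For $s<0$, $W^{s,p}(\Omega)=(W_0^{-s,p'}(\Omega))^*$, $1/p+1/p'=1$, viewed as a subspace of $D'(\Omega)$ by restriction to $C_c^\infty(\Omega)$. Distributions. Let $\mathcal{D}$ be the density bundle of $M$ and $E^\vee=\mathrm{Hom}(E,\mathcal{D})$. $D'(M,E)$ is the topological dual of $D(M,E^\vee)=C^\infty_c(M,E^\vee)$ with its usual test-function topology. For $u\in D'(M,E)$, the local representation $H_\alpha(u)\in D'(\varphi_\alpha(U_\alpha))^r$ has components $[H_\alpha(u)]^l(\xi)=\langle u,g_{l,\xi}\rangle$, where $g_{l,\xi}$ is the section of $E^\vee$ supported in $U_\alpha$ with $g_{l,\xi}(x)(a)=\xi(\varphi_\alpha(x))\,\rho_\alpha^l(a)\,|dx^1\wedge\cdots\wedge dx^n|_x$ for $a\in E_x$, $\varphi_\alpha=(x^i)$. If $u$ is the regular distribution $\eta\mapsto\int_M\eta(f)$ given by a section $f$, then $[H_\alpha(u)]^l=\rho_\alpha^l\circ f\circ\varphi_\alpha^{-1}$. Sobolev spaces. $W^{e,q}(M,E;\Lambda)=\{u\in D'(M,E):\|u\|_{W^{e,q}(M,E;\Lambda)}:=\sum_{\alpha=1}^N\sum_{l=1}^r\|[H_\alpha(\psi_\alpha u)]^l\|_{W^{e,q}(\varphi_\alpha(U_\alpha))}<\infty\}$. *)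

theory Defs
  imports "HOL-Analysis.Analysis" "HOL-Library.Function_Algebras"
begin

section \<open>Functions as vectors, seminorms and duals\<close>

instantiation "fun" :: (type, real_vector) real_vector
begin

definition scaleR_fun :: "real \<Rightarrow> ('a \<Rightarrow> 'b) \<Rightarrow> 'a \<Rightarrow> 'b"
  where "scaleR_fun c f = (\<lambda>x. c *\<^sub>R f x)"

instance
  by standard (simp_all add: scaleR_fun_def fun_eq_iff algebra_simps)

end

definition linear_functional_on :: "'v::real_vector set \<Rightarrow> ('v \<Rightarrow> real) \<Rightarrow> bool"
  where "linear_functional_on X u \<longleftrightarrow>
    (\<forall>x\<in>X. \<forall>y\<in>X. u (x + y) = u x + u y) \<and> (\<forall>c. \<forall>x\<in>X. u (c *\<^sub>R x) = c * u x)"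

definition seminorm_on :: "'v::real_vector set \<Rightarrow> ('v \<Rightarrow> real) \<Rightarrow> bool"
  where "seminorm_on X q \<longleftrightarrow> (\<forall>x\<in>X. 0 \<le> q x) \<and>
    (\<forall>x\<in>X. \<forall>y\<in>X. q (x + y) \<le> q x + q y) \<and> (\<forall>c. \<forall>x\<in>X. q (c *\<^sub>R x) = \<bar>c\<bar> * q x)"

text \<open>The locally convex topology on \<open>X\<close> whose neighbourhood bases are the unit balls of the
  seminorms in \<open>Q\<close>; to be used for \<open>Q\<close> directed and closed under positive multiples.\<close>

definition seminorm_topology :: "'v::real_vector set \<Rightarrow> ('v \<Rightarrow> real) set \<Rightarrow> 'v topology"
  where "seminorm_topology X Q =
    topology (\<lambda>V. V \<subseteq> X \<and> (\<forall>x\<in>V. \<exists>q\<in>Q. {y\<in>X. q (y - x) < 1} \<subseteq> V))"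

lemma openin_seminorm_topology:
  assumes "\<And>p q. p \<in> Q \<Longrightarrow> q \<in> Q \<Longrightarrow> \<exists>r\<in>Q. \<forall>x. p x \<le> r x \<and> q x \<le> r x"
  shows "openin (seminorm_topology X Q) V \<longleftrightarrow>
    V \<subseteq> X \<and> (\<forall>x\<in>V. \<exists>q\<in>Q. {y\<in>X. q (y - x) < 1} \<subseteq> V)"
proof -
  have "istopology (\<lambda>V. V \<subseteq> X \<and> (\<forall>x\<in>V. \<exists>q\<in>Q. {y\<in>X. q (y - x) < 1} \<subseteq> V))"
    unfolding istopology_def
  proof (rule conjI; intro allI impI)
    fix S T
    assume S: "S \<subseteq> X \<and> (\<forall>x\<in>S. \<exists>q\<in>Q. {y\<in>X. q (y - x) < 1} \<subseteq> S)"
      and T: "T \<subseteq> X \<and> (\<forall>x\<in>T. \<exists>q\<in>Q. {y\<in>X. q (y - x) < 1} \<subseteq> T)"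
    have "\<exists>r\<in>Q. {y\<in>X. r (y - x) < 1} \<subseteq> S \<inter> T" if x: "x \<in> S \<inter> T" for x
    proof -
      obtain p where p: "p \<in> Q" "{y\<in>X. p (y - x) < 1} \<subseteq> S" using S x by blast
      obtain q where q: "q \<in> Q" "{y\<in>X. q (y - x) < 1} \<subseteq> T" using T x by blast
      obtain r where r: "r \<in> Q" "\<And>z. p z \<le> r z" "\<And>z. q z \<le> r z"
        using assms[OF p(1) q(1)] by blast
      have "y \<in> S \<inter> T" if "y \<in> X" "r (y - x) < 1" for y
        using p(2) q(2) that r(2)[of "y - x"] r(3)[of "y - x"] by fastforce
      then show ?thesis using r(1) by blast
    qed
    then show "S \<inter> T \<subseteq> X \<and> (\<forall>x\<in>S \<inter> T. \<exists>q\<in>Q. {y\<in>X. q (y - x) < 1} \<subseteq> S \<inter> T)"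
      using S by blast
  next
    fix \<K>
    assume "\<forall>K\<in>\<K>. K \<subseteq> X \<and> (\<forall>x\<in>K. \<exists>q\<in>Q. {y\<in>X. q (y - x) < 1} \<subseteq> K)"
    then show "\<Union>\<K> \<subseteq> X \<and> (\<forall>x\<in>\<Union>\<K>. \<exists>q\<in>Q. {y\<in>X. q (y - x) < 1} \<subseteq> \<Union>\<K>)"
      by (meson Sup_least UnionE Union_upper order_trans)
  qed
  then show ?thesis
    by (simp add: seminorm_topology_def)
qed

text \<open>Functionals on \<open>X\<close> are extended by zero outside \<open>X\<close>, so that they form a
  genuine vector space of functions.\<close>

definition topological_dual :: "'v::real_vector set \<Rightarrow> 'v topology \<Rightarrow> ('v \<Rightarrow> real) set"
  where "topological_dual X T = {u. (\<forall>x. x \<notin> X \<longrightarrow> u x = 0) \<and>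
    linear_functional_on X u \<and> continuous_map T euclideanreal u}"

text \<open>\<open>X\<close> with norm \<open>NX\<close> is contained in \<open>Y\<close> with norm \<open>NY\<close>, and the inclusion is continuous.\<close>

definition continuously_included ::
    "'v::real_vector set \<Rightarrow> ('v \<Rightarrow> ennreal) \<Rightarrow> 'v set \<Rightarrow> ('v \<Rightarrow> ennreal) \<Rightarrow> bool"
  where "continuously_included X NX Y NY \<longleftrightarrow> X \<subseteq> Y \<and>
    (\<forall>u\<in>X. \<forall>\<epsilon>>0. \<exists>\<delta>>0. \<forall>v\<in>X. NX (v - u) < ennreal \<delta> \<longrightarrow> NY (v - u) < ennreal \<epsilon>)"


section \<open>Smooth functions, test functions and distributions on open subsets of \<open>\<real>\<^sup>n\<close>\<close>

text \<open>The next two notions are only meant for open sets \<open>S\<close>.\<close>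

primrec Ck_on :: "nat \<Rightarrow> 'a::euclidean_space set \<Rightarrow> ('a \<Rightarrow> 'b::real_normed_vector) \<Rightarrow> bool"
  where
    "Ck_on 0 S f \<longleftrightarrow> continuous_on S f"
  | "Ck_on (Suc k) S f \<longleftrightarrow> (\<forall>x\<in>S. f differentiable (at x)) \<and>
      (\<forall>b\<in>Basis. Ck_on k S (\<lambda>x. frechet_derivative f (at x) b))"

definition smooth_on :: "'a::euclidean_space set \<Rightarrow> ('a \<Rightarrow> 'b::real_normed_vector) \<Rightarrow> bool"
  where "smooth_on S f \<longleftrightarrow> (\<forall>k. Ck_on k S f)"

definition partial :: "'n::finite \<Rightarrow> (real^'n \<Rightarrow> real) \<Rightarrow> real^'n \<Rightarrow> real"
  where "partial i f x = frechet_derivative f (at x) (axis i 1)"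

definition order_mi :: "('n::finite \<Rightarrow> nat) \<Rightarrow> nat"
  where "order_mi \<nu> = (\<Sum>i\<in>UNIV. \<nu> i)"

text \<open>\<open>\<partial>\<^sup>\<nu> f\<close>: the index type carries no order, so the partial derivatives are taken in some
  order; this is immaterial since the operator is only applied to smooth functions.\<close>

definition multi_partial :: "('n::finite \<Rightarrow> nat) \<Rightarrow> (real^'n \<Rightarrow> real) \<Rightarrow> real^'n \<Rightarrow> real"
  where "multi_partial \<nu> f = foldr partial (SOME is. \<forall>i. count_list is i = \<nu> i) f"

definition test_functions :: "(real^'n::finite) set \<Rightarrow> (real^'n \<Rightarrow> real) set"
  where "test_functions \<Omega> = {\<phi>. smooth_on UNIV \<phi> \<and>
    compact (closure {x. \<phi> x \<noteq> 0}) \<and> closure {x. \<phi> x \<noteq> 0} \<subseteq> \<Omega>}"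

text \<open>The inductive limit topology of the Frechet spaces of smooth functions supported in a compact
  \<open>K \<subseteq> \<Omega>\<close>: the finest locally convex topology inducing coarser topologies on all of them, i.e. the
  one given by all seminorms whose restrictions to these spaces are continuous.\<close>

definition test_seminorms :: "(real^'n::finite) set \<Rightarrow> ((real^'n \<Rightarrow> real) \<Rightarrow> real) set"
  where "test_seminorms \<Omega> = {q. seminorm_on (test_functions \<Omega>) q \<and>
    (\<forall>K. compact K \<and> K \<subseteq> \<Omega> \<longrightarrow>
      (\<exists>C::real. \<exists>m. \<forall>\<phi>\<in>test_functions \<Omega>. closure {x. \<phi> x \<noteq> 0} \<subseteq> K \<longrightarrow>
        ennreal (q \<phi>) \<le> ennreal C *
          (\<Sum>\<nu> | order_mi \<nu> \<le> m. SUP x\<in>K. ennreal \<bar>multi_partial \<nu> \<phi> x\<bar>)))}"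

definition distributions :: "(real^'n::finite) set \<Rightarrow> ((real^'n \<Rightarrow> real) \<Rightarrow> real) set"
  where "distributions \<Omega> = topological_dual (test_functions \<Omega>)
    (seminorm_topology (test_functions \<Omega>) (test_seminorms \<Omega>))"

definition distr_deriv ::
    "(real^'n::finite) set \<Rightarrow> ('n \<Rightarrow> nat) \<Rightarrow> ((real^'n \<Rightarrow> real) \<Rightarrow> real) \<Rightarrow> (real^'n \<Rightarrow> real) \<Rightarrow> real"
  where "distr_deriv \<Omega> \<nu> u \<phi> =
    (if \<phi> \<in> test_functions \<Omega> then (-1) ^ order_mi \<nu> * u (multi_partial \<nu> \<phi>) else 0)"

definition locally_integrable_on :: "(real^'n::finite) set \<Rightarrow> (real^'n \<Rightarrow> real) \<Rightarrow> bool"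
  where "locally_integrable_on \<Omega> f \<longleftrightarrow>
    (\<forall>K. compact K \<and> K \<subseteq> \<Omega> \<longrightarrow> set_integrable lborel K f)"

definition regular_distr ::
    "(real^'n::finite) set \<Rightarrow> (real^'n \<Rightarrow> real) \<Rightarrow> (real^'n \<Rightarrow> real) \<Rightarrow> real"
  where "regular_distr \<Omega> f \<phi> =
    (if \<phi> \<in> test_functions \<Omega> then (LINT x:\<Omega>|lborel. f x * \<phi> x) else 0)"


section \<open>Sobolev-Slobodeckij spaces on open subsets of \<open>\<real>\<^sup>n\<close>\<close>

definition ennroot :: "real \<Rightarrow> ennreal \<Rightarrow> ennreal"
  where "ennroot p I = (if I = \<infinity> then \<infinity> else ennreal (enn2real I powr (1 / p)))"

definition Lp_norm :: "(real^'n::finite) set \<Rightarrow> real \<Rightarrow> (real^'n \<Rightarrow> real) \<Rightarrow> ennreal"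
  where "Lp_norm \<Omega> p f = ennroot p (\<integral>\<^sup>+x\<in>\<Omega>. ennreal (\<bar>f x\<bar> powr p) \<partial>lborel)"

definition slobodeckij_seminorm ::
    "(real^'n::finite) set \<Rightarrow> real \<Rightarrow> real \<Rightarrow> (real^'n \<Rightarrow> real) \<Rightarrow> ennreal"
  where "slobodeckij_seminorm \<Omega> \<theta> p f = ennroot p
    (\<integral>\<^sup>+z\<in>\<Omega> \<times> \<Omega>. ennreal (\<bar>f (fst z) - f (snd z)\<bar> powr p /
        norm (fst z - snd z) powr (real CARD('n) + \<theta> * p)) \<partial>(lborel \<Otimes>\<^sub>M lborel))"

text \<open>The value of a functional \<open>N\<close> of functions modulo null sets at a distribution: the functions
  \<open>f\<close> representing \<open>u\<close> form one almost-everywhere class, on which \<open>N\<close> is constant, or there is none,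
  in which case the value is \<open>\<infinity>\<close>.\<close>

definition on_density ::
    "(real^'n::finite) set \<Rightarrow> ((real^'n \<Rightarrow> real) \<Rightarrow> ennreal) \<Rightarrow> ((real^'n \<Rightarrow> real) \<Rightarrow> real) \<Rightarrow> ennreal"
  where "on_density \<Omega> N u = (INF f\<in>{f. locally_integrable_on \<Omega> f \<and> regular_distr \<Omega> f = u}. N f)"

text \<open>For \<open>s \<ge> 0\<close>; a function in \<open>L\<^sup>p(\<Omega>)\<close> is identified with its regular distribution.\<close>

definition sobolev_norm_nonneg ::
    "(real^'n::finite) set \<Rightarrow> real \<Rightarrow> real \<Rightarrow> ((real^'n \<Rightarrow> real) \<Rightarrow> real) \<Rightarrow> ennreal"
  where "sobolev_norm_nonneg \<Omega> s p u =
    (let k = nat \<lfloor>s\<rfloor>; \<theta> = frac s in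
      (\<Sum>\<nu> | order_mi \<nu> \<le> k. on_density \<Omega> (Lp_norm \<Omega> p) (distr_deriv \<Omega> \<nu> u)) +
      (if \<theta> = 0 then 0 else
        (\<Sum>\<nu> | order_mi \<nu> = k. on_density \<Omega> (slobodeckij_seminorm \<Omega> \<theta> p) (distr_deriv \<Omega> \<nu> u))))"

definition sobolev0 ::
    "(real^'n::finite) set \<Rightarrow> real \<Rightarrow> real \<Rightarrow> ((real^'n \<Rightarrow> real) \<Rightarrow> real) set"
  where "sobolev0 \<Omega> s p = {u \<in> distributions \<Omega>. sobolev_norm_nonneg \<Omega> s p u < \<infinity> \<and>
    (\<forall>\<epsilon>>0. \<exists>\<phi>\<in>test_functions \<Omega>. sobolev_norm_nonneg \<Omega> s p (u - regular_distr \<Omega> \<phi>) < ennreal \<epsilon>)}"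

definition sobolev0_dual_norm ::
    "(real^'n::finite) set \<Rightarrow> real \<Rightarrow> real \<Rightarrow> (((real^'n \<Rightarrow> real) \<Rightarrow> real) \<Rightarrow> real) \<Rightarrow> ennreal"
  where "sobolev0_dual_norm \<Omega> t p L =
    Inf {C. \<forall>w\<in>sobolev0 \<Omega> t p. ennreal \<bar>L w\<bar> \<le> C * sobolev_norm_nonneg \<Omega> t p w}"

text \<open>For \<open>s < 0\<close> the space is the dual of \<open>W\<^sub>0\<close> with exponents \<open>-s\<close> and \<open>p' = p / (p - 1)\<close>, whose
  elements \<open>L\<close> are viewed as distributions by restriction to test functions.  By density \<open>u\<close> is the
  restriction of at most one bounded \<open>L\<close>; the norm is \<open>\<infinity>\<close> if there is none.\<close>

definition sobolev_norm ::
    "(real^'n::finite) set \<Rightarrow> real \<Rightarrow> real \<Rightarrow> ((real^'n \<Rightarrow> real) \<Rightarrow> real) \<Rightarrow> ennreal"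
  where "sobolev_norm \<Omega> s p u =
    (if 0 \<le> s then sobolev_norm_nonneg \<Omega> s p u
     else (INF L\<in>{L. linear_functional_on (sobolev0 \<Omega> (- s) (p / (p - 1))) L \<and>
             (\<forall>\<phi>\<in>test_functions \<Omega>. L (regular_distr \<Omega> \<phi>) = u \<phi>)}.
        sobolev0_dual_norm \<Omega> (- s) (p / (p - 1)) L))"

definition sobolev ::
    "(real^'n::finite) set \<Rightarrow> real \<Rightarrow> real \<Rightarrow> ((real^'n \<Rightarrow> real) \<Rightarrow> real) set"
  where "sobolev \<Omega> s p = {u \<in> distributions \<Omega>. sobolev_norm \<Omega> s p u < \<infinity>}"

definition sobolev_embeds ::
    "(real^'n::finite) set \<Rightarrow> real \<Rightarrow> real \<Rightarrow> real \<Rightarrow> real \<Rightarrow> bool"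
  where "sobolev_embeds \<Omega> e1 q1 e2 q2 \<longleftrightarrow> continuously_included
    (sobolev \<Omega> e1 q1) (sobolev_norm \<Omega> e1 q1) (sobolev \<Omega> e2 q2) (sobolev_norm \<Omega> e2 q2)"

text \<open>Near each boundary point \<open>\<Omega>\<close> is, up to a rigid motion, the set of points above the graph of a
  Lipschitz function of \<open>n - 1\<close> variables: \<open>e\<close> is the vertical direction and \<open>\<gamma>\<close> a function on the
  hyperplane orthogonal to it.\<close>

definition lipschitz_boundary :: "(real^'n::finite) set \<Rightarrow> bool"
  where "lipschitz_boundary \<Omega> \<longleftrightarrow> (\<forall>x\<in>frontier \<Omega>. \<exists>r>0. \<exists>e. \<exists>\<gamma>::real^'n \<Rightarrow> real. \<exists>C.
    norm e = 1 \<and> C-lipschitz_on {z. z \<bullet> e = 0} \<gamma> \<and>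
    \<Omega> \<inter> ball x r = {y \<in> ball x r. y \<bullet> e > \<gamma> (y - (y \<bullet> e) *\<^sub>R e)})"


section \<open>Smooth manifolds\<close>

type_synonym ('a, 'v) chart = "'a set \<times> ('a \<Rightarrow> 'v)"

text \<open>A topological space together with an atlas of charts into the model space \<open>'v\<close>.\<close>

record ('a, 'v) mfd =
  mtop :: "'a topology"
  matlas :: "('a, 'v) chart set"

abbreviation mspace :: "('a, 'v) mfd \<Rightarrow> 'a set"
  where "mspace M \<equiv> topspace (mtop M)"

abbreviation chart_inv :: "('a, 'v) chart \<Rightarrow> 'v \<Rightarrow> 'a"
  where "chart_inv c \<equiv> inv_into (fst c) (snd c)"

definition is_chart :: "'a topology \<Rightarrow> ('a, 'v::euclidean_space) chart \<Rightarrow> bool"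
  where "is_chart X c \<longleftrightarrow> openin X (fst c) \<and> open (snd c ` fst c) \<and>
    homeomorphic_map (subtopology X (fst c)) (top_of_set (snd c ` fst c)) (snd c)"

definition smooth_compatible ::
    "('a, 'v::euclidean_space) chart \<Rightarrow> ('a, 'v) chart \<Rightarrow> bool"
  where "smooth_compatible c d \<longleftrightarrow>
    smooth_on (snd c ` (fst c \<inter> fst d)) (snd d \<circ> chart_inv c) \<and>
    smooth_on (snd d ` (fst c \<inter> fst d)) (snd c \<circ> chart_inv d)"

definition smooth_manifold :: "('a, 'v::euclidean_space) mfd \<Rightarrow> bool"
  where "smooth_manifold M \<longleftrightarrow> Hausdorff_space (mtop M) \<and> second_countable (mtop M) \<and>
    (\<forall>c\<in>matlas M. is_chart (mtop M) c) \<and> (\<Union>c\<in>matlas M. fst c) = mspace M \<and>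
    (\<forall>c\<in>matlas M. \<forall>d\<in>matlas M. smooth_compatible c d)"

definition smooth_chart :: "('a, 'v::euclidean_space) mfd \<Rightarrow> ('a, 'v) chart \<Rightarrow> bool"
  where "smooth_chart M c \<longleftrightarrow> is_chart (mtop M) c \<and> (\<forall>d\<in>matlas M. smooth_compatible c d)"

definition smooth_fun_on ::
    "('a, 'v::euclidean_space) mfd \<Rightarrow> 'a set \<Rightarrow> ('a \<Rightarrow> 'w::real_normed_vector) \<Rightarrow> bool"
  where "smooth_fun_on M S f \<longleftrightarrow>
    (\<forall>c\<in>matlas M. smooth_on (snd c ` (S \<inter> fst c)) (f \<circ> chart_inv c))"

definition smooth_map_on ::
    "('a, 'v::euclidean_space) mfd \<Rightarrow> 'a set \<Rightarrow> ('b, 'w::euclidean_space) mfd \<Rightarrow> 'b set \<Rightarrow>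
      ('a \<Rightarrow> 'b) \<Rightarrow> bool"
  where "smooth_map_on M S N T f \<longleftrightarrow>
    continuous_map (subtopology (mtop M) S) (subtopology (mtop N) T) f \<and>
    (\<forall>c\<in>matlas M. \<forall>d\<in>matlas N.
      smooth_on (snd c ` {x \<in> S \<inter> fst c. f x \<in> fst d}) (snd d \<circ> f \<circ> chart_inv c))"

definition diffeo_on ::
    "('a, 'v::euclidean_space) mfd \<Rightarrow> 'a set \<Rightarrow> ('b, 'w::euclidean_space) mfd \<Rightarrow> 'b set \<Rightarrow>
      ('a \<Rightarrow> 'b) \<Rightarrow> bool"
  where "diffeo_on M S N T f \<longleftrightarrow> bij_betw f S T \<and>
    smooth_map_on M S N T f \<and> smooth_map_on N T M S (inv_into S f)"

text \<open>The product manifold \<open>M \<times> 'w\<close> for a Euclidean space \<open>'w\<close>.\<close>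

definition times_euclidean ::
    "('a, 'v::euclidean_space) mfd \<Rightarrow> ('a \<times> 'w::euclidean_space, 'v \<times> 'w) mfd"
  where "times_euclidean M = \<lparr>mtop = prod_topology (mtop M) euclidean,
    matlas = (\<lambda>c. (fst c \<times> UNIV, \<lambda>(x, w). (snd c x, w))) ` matlas M\<rparr>"


section \<open>Vector bundles\<close>

record ('m, 'e, 'n, 'r) vbundle =
  base :: "('m, real^'n) mfd"
  total :: "('e, (real^'n) \<times> (real^'r)) mfd"
  proj :: "'e \<Rightarrow> 'm"
  fib_add :: "'e \<Rightarrow> 'e \<Rightarrow> 'e"
  fib_scale :: "real \<Rightarrow> 'e \<Rightarrow> 'e"
  fib_zero :: "'m \<Rightarrow> 'e"

definition over :: "('m, 'e, 'n::finite, 'r::finite) vbundle \<Rightarrow> 'm set \<Rightarrow> 'e set"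
  where "over B U = {a \<in> mspace (total B). proj B a \<in> U}"

abbreviation fibre :: "('m, 'e, 'n::finite, 'r::finite) vbundle \<Rightarrow> 'm \<Rightarrow> 'e set"
  where "fibre B x \<equiv> over B {x}"

definition real_vector_space_on ::
    "'e set \<Rightarrow> ('e \<Rightarrow> 'e \<Rightarrow> 'e) \<Rightarrow> (real \<Rightarrow> 'e \<Rightarrow> 'e) \<Rightarrow> 'e \<Rightarrow> bool"
  where "real_vector_space_on V ad sc z \<longleftrightarrow>
    z \<in> V \<and> (\<forall>a\<in>V. \<forall>b\<in>V. ad a b \<in> V) \<and> (\<forall>c. \<forall>a\<in>V. sc c a \<in> V) \<and>
    (\<forall>a\<in>V. \<forall>b\<in>V. \<forall>d\<in>V. ad (ad a b) d = ad a (ad b d)) \<and>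
    (\<forall>a\<in>V. \<forall>b\<in>V. ad a b = ad b a) \<and>
    (\<forall>a\<in>V. ad z a = a) \<and> (\<forall>a\<in>V. \<exists>b\<in>V. ad a b = z) \<and>
    (\<forall>c. \<forall>a\<in>V. \<forall>b\<in>V. sc c (ad a b) = ad (sc c a) (sc c b)) \<and>
    (\<forall>c d. \<forall>a\<in>V. sc (c + d) a = ad (sc c a) (sc d a)) \<and>
    (\<forall>c d. \<forall>a\<in>V. sc c (sc d a) = sc (c * d) a) \<and>
    (\<forall>a\<in>V. sc 1 a = a)"

definition fibre_linear ::
    "('m, 'e, 'n::finite, 'r::finite) vbundle \<Rightarrow> 'm \<Rightarrow> ('e \<Rightarrow> 'w::real_vector) \<Rightarrow> bool"
  where "fibre_linear B x h \<longleftrightarrow>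
    (\<forall>a\<in>fibre B x. \<forall>b\<in>fibre B x. h (fib_add B a b) = h a + h b) \<and>
    (\<forall>c. \<forall>a\<in>fibre B x. h (fib_scale B c a) = c *\<^sub>R h a)"

definition local_trivialization ::
    "('m, 'e, 'n::finite, 'r::finite) vbundle \<Rightarrow> 'm set \<Rightarrow> ('e \<Rightarrow> real^'r) \<Rightarrow> bool"
  where "local_trivialization B U \<rho> \<longleftrightarrow> openin (mtop (base B)) U \<and>
    smooth_fun_on (total B) (over B U) \<rho> \<and>
    (\<forall>x\<in>U. fibre_linear B x \<rho> \<and> bij_betw \<rho> (fibre B x) UNIV) \<and>
    diffeo_on (total B) (over B U) (times_euclidean (base B)) (U \<times> UNIV) (\<lambda>a. (proj B a, \<rho> a))"

text \<open>A smooth vector bundle of rank \<open>CARD('r)\<close> over a smooth manifold of dimension \<open>CARD('n)\<close>.\<close>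

definition smooth_vector_bundle :: "('m, 'e, 'n::finite, 'r::finite) vbundle \<Rightarrow> bool"
  where "smooth_vector_bundle B \<longleftrightarrow> smooth_manifold (base B) \<and> smooth_manifold (total B) \<and>
    smooth_map_on (total B) (mspace (total B)) (base B) (mspace (base B)) (proj B) \<and>
    proj B ` mspace (total B) = mspace (base B) \<and>
    (\<forall>x\<in>mspace (base B).
      real_vector_space_on (fibre B x) (fib_add B) (fib_scale B) (fib_zero B x)) \<and>
    (\<forall>x\<in>mspace (base B). \<exists>U \<rho>. x \<in> U \<and> local_trivialization B U \<rho>)"

type_synonym ('m, 'e, 'n, 'r) triv_triple = "('m, real^'n) chart \<times> ('e \<Rightarrow> real^'r)"

definition total_triv_triple ::
    "('m, 'e, 'n::finite, 'r::finite) vbundle \<Rightarrow> ('m, 'e, 'n, 'r) triv_triple \<Rightarrow> bool"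
  where "total_triv_triple B \<tau> \<longleftrightarrow>
    smooth_chart (base B) (fst \<tau>) \<and> local_trivialization B (fst (fst \<tau>)) (snd \<tau>)"

text \<open>The finite collection is a list of pairs consisting of a trivialization triple and a
  function of the partition of unity.\<close>

type_synonym ('m, 'e, 'n, 'r) aug_atlas = "(('m, 'e, 'n, 'r) triv_triple \<times> ('m \<Rightarrow> real)) list"

definition augmented_triv_atlas ::
    "('m, 'e, 'n::finite, 'r::finite) vbundle \<Rightarrow> ('m, 'e, 'n, 'r) aug_atlas \<Rightarrow> bool"
  where "augmented_triv_atlas B \<Lambda> \<longleftrightarrow>
    (\<forall>(\<tau>, \<psi>)\<in>set \<Lambda>. total_triv_triple B \<tau> \<and>
      smooth_fun_on (base B) (mspace (base B)) \<psi> \<and> (\<forall>x\<in>mspace (base B). 0 \<le> \<psi> x) \<and>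
      mtop (base B) closure_of {x \<in> mspace (base B). \<psi> x \<noteq> 0} \<subseteq> fst (fst \<tau>)) \<and>
    (\<Union>(\<tau>, \<psi>)\<in>set \<Lambda>. fst (fst \<tau>)) = mspace (base B) \<and>
    (\<forall>x\<in>mspace (base B). (\<Sum>(\<tau>, \<psi>)\<leftarrow>\<Lambda>. \<psi> x) = 1)"

definition chart_image :: "('m, 'e, 'n, 'r) triv_triple \<Rightarrow> (real^'n) set"
  where "chart_image \<tau> = snd (fst \<tau>) ` fst (fst \<tau>)"

definition GGL :: "('m, 'e, 'n::finite, 'r::finite) aug_atlas \<Rightarrow> bool"
  where "GGL \<Lambda> \<longleftrightarrow> (\<forall>(\<tau>, \<psi>)\<in>set \<Lambda>. chart_image \<tau> = UNIV \<or>
    (chart_image \<tau> \<noteq> {} \<and> bounded (chart_image \<tau>) \<and> open (chart_image \<tau>) \<and>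
     lipschitz_boundary (chart_image \<tau>)))"


section \<open>Densities\<close>

text \<open>A tangent vector at \<open>x\<close> assigns to each smooth chart around \<open>x\<close> its coordinate vector in that
  chart; charts not around \<open>x\<close> get \<open>0\<close>.\<close>

type_synonym ('m, 'n) tangent_vec = "('m, real^'n) chart \<Rightarrow> real^'n"

definition chart_at :: "('m, real^'n::finite) mfd \<Rightarrow> 'm \<Rightarrow> ('m, real^'n) chart \<Rightarrow> bool"
  where "chart_at M x c \<longleftrightarrow> smooth_chart M c \<and> x \<in> fst c"

definition tangent_space :: "('m, real^'n::finite) mfd \<Rightarrow> 'm \<Rightarrow> ('m, 'n) tangent_vec set"
  where "tangent_space M x = {v. (\<forall>c. \<not> chart_at M x c \<longrightarrow> v c = 0) \<and>
    (\<forall>c d. chart_at M x c \<and> chart_at M x d \<longrightarrow>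
      v d = frechet_derivative (snd d \<circ> chart_inv c) (at (snd c x)) (v c))}"

text \<open>\<open>\<partial>/\<partial>x\<^sup>i\<close> at the point \<open>x\<close> for the chart \<open>c\<close>.\<close>

definition coord_vec ::
    "('m, real^'n::finite) mfd \<Rightarrow> ('m, real^'n) chart \<Rightarrow> 'm \<Rightarrow> 'n \<Rightarrow> ('m, 'n) tangent_vec"
  where "coord_vec M c x i = (\<lambda>d. if chart_at M x d
    then frechet_derivative (snd d \<circ> chart_inv c) (at (snd c x)) (axis i 1) else 0)"

text \<open>A density at \<open>x\<close> is a function \<open>\<mu>\<close> of \<open>n\<close> tangent vectors with
  \<open>\<mu> (T v\<^sub>1, \<dots>, T v\<^sub>n) = |det T| \<mu> (v\<^sub>1, \<dots>, v\<^sub>n)\<close> for every endomorphism \<open>T\<close> of the tangent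
  space; below, \<open>A\<close> is the matrix of \<open>T\<close> in the chart \<open>c\<close>.\<close>

type_synonym ('m, 'n) dens = "('n \<Rightarrow> ('m, 'n) tangent_vec) \<Rightarrow> real"

definition densities :: "('m, real^'n::finite) mfd \<Rightarrow> 'm \<Rightarrow> ('m, 'n) dens set"
  where "densities M x = {\<mu>. (\<forall>v. \<not> range v \<subseteq> tangent_space M x \<longrightarrow> \<mu> v = 0) \<and>
    (\<forall>v w c. \<forall>A::real^'n^'n. range v \<subseteq> tangent_space M x \<and> range w \<subseteq> tangent_space M x \<and>
      chart_at M x c \<and> (\<forall>i. w i c = A *v v i c) \<longrightarrow> \<mu> w = \<bar>det A\<bar> * \<mu> v)}"

text \<open>\<open>|dx\<^sup>1 \<and> \<dots> \<and> dx\<^sup>n|\<close> at \<open>x\<close> for the chart \<open>c = (U, (x\<^sup>1, \<dots>, x\<^sup>n))\<close>.\<close>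

definition coord_density ::
    "('m, real^'n::finite) mfd \<Rightarrow> ('m, real^'n) chart \<Rightarrow> 'm \<Rightarrow> ('m, 'n) dens"
  where "coord_density M c x = (\<lambda>v. if range v \<subseteq> tangent_space M x
    then \<bar>det (\<chi> i j. v j c $ i)\<bar> else 0)"


section \<open>Distributions on sections and Sobolev spaces of sections\<close>

text \<open>A section of \<open>E\<^sup>\<or> = Hom(E, \<D>)\<close>, extended by zero.\<close>

type_synonym ('m, 'e, 'n) dual_section = "'m \<Rightarrow> 'e \<Rightarrow> ('m, 'n) dens"

text \<open>The \<open>l\<close>-th component of a section of \<open>E\<^sup>\<or>\<close> in the local frame induced by a trivialization
  triple, as a function on the image of the chart.\<close>

definition local_coeff ::
    "('m, 'e, 'n::finite, 'r::finite) vbundle \<Rightarrow> ('m, 'e, 'n, 'r) triv_triple \<Rightarrow> 'r \<Rightarrow>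
      ('m, 'e, 'n) dual_section \<Rightarrow> real^'n \<Rightarrow> real"
  where "local_coeff B \<tau> l \<eta> y = (let x = chart_inv (fst \<tau>) y in
    \<eta> x (inv_into (fibre B x) (snd \<tau>) (axis l 1)) (coord_vec (base B) (fst \<tau>) x))"

definition section_supp ::
    "('m, 'e, 'n::finite, 'r::finite) vbundle \<Rightarrow> ('m, 'e, 'n) dual_section \<Rightarrow> 'm set"
  where "section_supp B \<eta> = mtop (base B) closure_of {x \<in> mspace (base B). \<eta> x \<noteq> 0}"

definition test_sections ::
    "('m, 'e, 'n::finite, 'r::finite) vbundle \<Rightarrow> ('m, 'e, 'n) dual_section set"
  where "test_sections B = {\<eta>.
    (\<forall>x a. x \<notin> mspace (base B) \<or> a \<notin> fibre B x \<longrightarrow> \<eta> x a = 0) \<and>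
    (\<forall>x\<in>mspace (base B). fibre_linear B x (\<eta> x) \<and> \<eta> x ` fibre B x \<subseteq> densities (base B) x) \<and>
    (\<forall>\<tau> l. total_triv_triple B \<tau> \<longrightarrow> smooth_on (chart_image \<tau>) (local_coeff B \<tau> l \<eta>)) \<and>
    compactin (mtop (base B)) (section_supp B \<eta>)}"

text \<open>The usual topology on compactly supported smooth sections, in analogy to \<open>test_seminorms\<close>.  The
  topology of the Frechet space of sections supported in a compact set \<open>L\<close> is that of locally uniform
  convergence of all derivatives of all local components.\<close>

definition section_seminorms ::
    "('m, 'e, 'n::finite, 'r::finite) vbundle \<Rightarrow> (('m, 'e, 'n) dual_section \<Rightarrow> real) set"
  where "section_seminorms B = {q. seminorm_on (test_sections B) q \<and>
    (\<forall>L. compactin (mtop (base B)) L \<longrightarrow>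
      (\<exists>C::real. \<exists>m. \<exists>F::(('m, 'e, 'n, 'r) triv_triple \<times> (real^'n) set) set. finite F \<and>
        (\<forall>(\<tau>, K)\<in>F. total_triv_triple B \<tau> \<and> compact K \<and> K \<subseteq> chart_image \<tau>) \<and>
        (\<forall>\<eta>\<in>test_sections B. section_supp B \<eta> \<subseteq> L \<longrightarrow>
          ennreal (q \<eta>) \<le> ennreal C * (\<Sum>(\<tau>, K)\<in>F. \<Sum>l\<in>UNIV. \<Sum>\<nu> | order_mi \<nu> \<le> m.
            SUP y\<in>K. ennreal \<bar>multi_partial \<nu> (local_coeff B \<tau> l \<eta>) y\<bar>))))}"

definition section_distributions ::
    "('m, 'e, 'n::finite, 'r::finite) vbundle \<Rightarrow> (('m, 'e, 'n) dual_section \<Rightarrow> real) set"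
  where "section_distributions B = topological_dual (test_sections B)
    (seminorm_topology (test_sections B) (section_seminorms B))"

definition mult_distr ::
    "('m, 'e, 'n::finite, 'r::finite) vbundle \<Rightarrow> ('m \<Rightarrow> real) \<Rightarrow>
      (('m, 'e, 'n) dual_section \<Rightarrow> real) \<Rightarrow> ('m, 'e, 'n) dual_section \<Rightarrow> real"
  where "mult_distr B \<psi> u \<eta> = (if \<eta> \<in> test_sections B then u (\<lambda>x. \<psi> x *\<^sub>R \<eta> x) else 0)"

definition local_section ::
    "('m, 'e, 'n::finite, 'r::finite) vbundle \<Rightarrow> ('m, 'e, 'n, 'r) triv_triple \<Rightarrow> 'r \<Rightarrow>
      (real^'n \<Rightarrow> real) \<Rightarrow> ('m, 'e, 'n) dual_section"
  where "local_section B \<tau> l \<xi> x a = (if x \<in> fst (fst \<tau>) \<and> a \<in> fibre B x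
    then (\<xi> (snd (fst \<tau>) x) * (snd \<tau> a $ l)) *\<^sub>R coord_density (base B) (fst \<tau>) x else 0)"

definition local_repr ::
    "('m, 'e, 'n::finite, 'r::finite) vbundle \<Rightarrow> ('m, 'e, 'n, 'r) triv_triple \<Rightarrow>
      (('m, 'e, 'n) dual_section \<Rightarrow> real) \<Rightarrow> 'r \<Rightarrow> (real^'n \<Rightarrow> real) \<Rightarrow> real"
  where "local_repr B \<tau> u l \<xi> =
    (if \<xi> \<in> test_functions (chart_image \<tau>) then u (local_section B \<tau> l \<xi>) else 0)"

definition sobolev_section_norm ::
    "('m, 'e, 'n::finite, 'r::finite) vbundle \<Rightarrow> ('m, 'e, 'n, 'r) aug_atlas \<Rightarrow> real \<Rightarrow> real \<Rightarrow>
      (('m, 'e, 'n) dual_section \<Rightarrow> real) \<Rightarrow> ennreal"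
  where "sobolev_section_norm B \<Lambda> e q u = (\<Sum>(\<tau>, \<psi>)\<leftarrow>\<Lambda>. \<Sum>l\<in>UNIV.
    sobolev_norm (chart_image \<tau>) e q (local_repr B \<tau> (mult_distr B \<psi> u) l))"

definition sobolev_sections ::
    "('m, 'e, 'n::finite, 'r::finite) vbundle \<Rightarrow> ('m, 'e, 'n, 'r) aug_atlas \<Rightarrow> real \<Rightarrow> real \<Rightarrow>
      (('m, 'e, 'n) dual_section \<Rightarrow> real) set"
  where "sobolev_sections B \<Lambda> e q =
    {u \<in> section_distributions B. sobolev_section_norm B \<Lambda> e q u < \<infinity>}"

definition sobolev_sections_embeds ::
    "('m, 'e, 'n::finite, 'r::finite) vbundle \<Rightarrow> ('m, 'e, 'n, 'r) aug_atlas \<Rightarrow>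
      real \<Rightarrow> real \<Rightarrow> real \<Rightarrow> real \<Rightarrow> bool"
  where "sobolev_sections_embeds B \<Lambda> e1 q1 e2 q2 \<longleftrightarrow> continuously_included
    (sobolev_sections B \<Lambda> e1 q1) (sobolev_section_norm B \<Lambda> e1 q1)
    (sobolev_sections B \<Lambda> e2 q2) (sobolev_section_norm B \<Lambda> e2 q2)"

definition nonint_below :: "real \<Rightarrow> bool"
  where "nonint_below e \<longleftrightarrow> e \<notin> \<int> \<and> e < -1"

end

theory Submission
  imports Defs
begin

text \<open>The local representatives of a distribution in \<open>W\<^sup>e\<^sup>,\<^sup>q(M, E; \<Lambda>)\<close> are distributions \<open>v\<close> on
  the chart images \<open>V\<close> that are supported in compact sets \<open>K \<subseteq> V\<close>, the images of the supports of
  the partition of unity. For an open set \<open>\<Omega>\<close> containing \<open>K\<close> take a test function \<open>h\<close> of \<open>V \<inter> \<Omega>\<close>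
  with \<open>h = 1\<close> on \<open>K\<close>. Multiplication by \<open>h\<close> and extension by zero turn \<open>v\<close> into a distribution on
  \<open>\<Omega>\<close>, and a second multiplication by \<open>h\<close> turns this one into \<open>v\<close> again. Hence an embedding on \<open>\<Omega>\<close>
  yields the estimate of \<open>v\<close> on \<open>V\<close>, as soon as multiplication by \<open>h\<close> is bounded from
  \<open>W\<^sup>s\<^sup>,\<^sup>p(\<Omega>1)\<close> to \<open>W\<^sup>s\<^sup>,\<^sup>p(\<Omega>2)\<close> for open sets \<open>\<Omega>1\<close>, \<open>\<Omega>2\<close> and a test function \<open>h\<close> of \<open>\<Omega>1 \<inter> \<Omega>2\<close>.
  This is \<open>cutoff_distr_norm\<close>, it is used in \<open>sobolev_embeds_transfer\<close>, and
  \<open>sobolev_sections_embedsI\<close> sums up the components. The three parts of the theorem arise from \<open>\<Omega>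
  = \<real>\<^sup>n\<close> and from a large ball.

  For \<open>s = k + \<theta> \<ge> 0\<close> the bound is the Leibniz rule. A term \<open>g f\<close> with \<open>f\<close> of order \<open>k\<close> is
  estimated in the Slobodeckij seminorm by splitting the difference \<open>g(x) f(x) - g(y) f(y)\<close>; what
  is not controlled by the seminorm of \<open>f\<close> carries a difference of values of \<open>g\<close>, which is at most
  a multiple of \<open>min |x - y| 1\<close> and makes the kernel integrable (\<open>gagliardo_test_mult\<close>). In a term
  \<open>g f\<close> with \<open>f\<close> of order less than \<open>k\<close> nothing is known about differences of \<open>f\<close>, but \<open>g f\<close>,
  extended by zero, lies in \<open>W\<^sup>1\<^sup>,\<^sup>p(\<real>\<^sup>n)\<close>, and this space is contained in \<open>W\<^sup>\<theta>\<^sup>,\<^sup>p(\<real>\<^sup>n)\<close> by the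
  fundamental theorem of calculus along segments (\<open>gagliardo_weak_gradient\<close>). For \<open>s < 0\<close> the
  multiplication by \<open>h\<close> is the transpose of the multiplication in the opposite direction for \<open>-s\<close>
  and the conjugate exponent.

  The norms are infima over the densities of a distribution. By the fundamental lemma of the
  calculus of variations all densities agree almost everywhere, so one and the same density serves
  for the \<open>L\<^sup>p\<close> norm and for the Slobodeckij seminorm. A functional on test functions of finite
  Sobolev norm is automatically continuous (\<open>finite_sobolev_norm_distribution\<close>), so continuity
  never has to be carried from the manifold to the charts. What has to be known there is that the
  sections by which local representatives are defined are test sections
  (\<open>local_section_test_section\<close>): only then does a local representative of \<open>\<psi> u\<close> see a test
  function through its product with \<open>\<psi>\<close>.\<close>

section \<open>Calculus of smooth functions\<close>

lemma Ck_on_continuous: "Ck_on k S f \<Longrightarrow> continuous_on S f"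
  by (cases k) (auto simp: continuous_at_imp_continuous_on differentiable_imp_continuous_within)

lemma Ck_on_SucD: "Ck_on (Suc k) S f \<Longrightarrow> Ck_on k S f"
proof (induction k arbitrary: f)
  case 0
  then show ?case by (auto simp: continuous_at_imp_continuous_on
      differentiable_imp_continuous_within)
next
  case (Suc k)
  then show ?case by auto
qed

lemma Ck_on_subset: "Ck_on k S f \<Longrightarrow> T \<subseteq> S \<Longrightarrow> Ck_on k T f"
  by (induction k arbitrary: f) (auto intro: continuous_on_subset)

lemma Ck_on_cong:
  assumes "open S" "\<And>x. x \<in> S \<Longrightarrow> f x = g x" "Ck_on k S f"
  shows "Ck_on k S g"
  using assms(2,3)
proof (induction k arbitrary: f g)
  case 0
  then show ?case by (metis Ck_on.simps(1) continuous_on_cong)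
next
  case (Suc k)
  have d: "(g has_derivative frechet_derivative f (at x)) (at x)" if "x \<in> S" for x
    using Suc.prems that assms(1)
    by (meson Ck_on.simps(2) frechet_derivative_works has_derivative_transform_within_open)
  have e: "frechet_derivative g (at x) = frechet_derivative f (at x)" if "x \<in> S" for x
    using frechet_derivative_at[OF d[OF that]] by simp
  have "Ck_on k S (\<lambda>x. frechet_derivative g (at x) b)" if "b \<in> Basis" for b
    using Suc.IH[of "\<lambda>x. frechet_derivative f (at x) b"] Suc.prems that e by auto
  then show ?case using d by (auto simp: differentiable_def)
qed

lemma Ck_on_SucI:
  assumes "open S" "\<And>x. x \<in> S \<Longrightarrow> (f has_derivative f' x) (at x)"
    and "\<And>b. b \<in> Basis \<Longrightarrow> Ck_on k S (\<lambda>x. f' x b)"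
  shows "Ck_on (Suc k) S f"
proof -
  have e: "frechet_derivative f (at x) = f' x" if "x \<in> S" for x
    using frechet_derivative_at[OF assms(2)[OF that]] by simp
  have "Ck_on k S (\<lambda>x. frechet_derivative f (at x) b)" if "b \<in> Basis" for b
    by (rule Ck_on_cong[OF assms(1) _ assms(3)[OF that]]) (simp add: e)
  then show ?thesis using assms(2) by (auto simp: differentiable_def)
qed

lemma Ck_on_SucE:
  assumes "Ck_on (Suc k) S f"
  shows "x \<in> S \<Longrightarrow> (f has_derivative frechet_derivative f (at x)) (at x)"
    "b \<in> Basis \<Longrightarrow> Ck_on k S (\<lambda>x. frechet_derivative f (at x) b)"
  using assms frechet_derivative_works by auto

lemma Ck_on_Union:
  assumes "\<And>T. T \<in> \<T> \<Longrightarrow> open T \<and> Ck_on k T f"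
  shows "Ck_on k (\<Union>\<T>) f"
  using assms
  by (induction k arbitrary: f) (auto intro: continuous_on_open_Union)

lemma Ck_on_const: "Ck_on k S (\<lambda>x. c)"
  by (induction k arbitrary: c) auto

lemma Ck_on_bounded_linear:
  assumes "open S" "bounded_linear L" shows "Ck_on k S L"
proof (cases k)
  case 0
  then show ?thesis using assms by (simp add: linear_continuous_on)
next
  case (Suc m)
  then show ?thesis
    using Ck_on_SucI[OF assms(1), of L "\<lambda>x. L" m] assms(2) bounded_linear_imp_has_derivative
    by (auto intro: Ck_on_const)
qed

lemma Ck_on_add:
  assumes "open S" "Ck_on k S f" "Ck_on k S g" shows "Ck_on k S (\<lambda>x. f x + g x)"
  using assms(2,3)
proof (induction k arbitrary: f g)
  case 0
  then show ?case by (auto intro: continuous_intros)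
next
  case (Suc k)
  note f = Ck_on_SucE[OF Suc.prems(1)] and g = Ck_on_SucE[OF Suc.prems(2)]
  show ?case
    by (rule Ck_on_SucI[OF assms(1) has_derivative_add[OF f(1) g(1)]]) (auto intro: Suc.IH f g)
qed

lemma Ck_on_sum:
  assumes "open S" "\<And>i. i \<in> I \<Longrightarrow> Ck_on k S (f i)" shows "Ck_on k S (\<lambda>x. \<Sum>i\<in>I. f i x)"
  using assms(2)
  by (induction I rule: infinite_finite_induct) (auto intro: Ck_on_const Ck_on_add[OF assms(1)])

lemma Ck_on_scaleR:
  assumes "open S" "Ck_on k S f" "Ck_on k S g" shows "Ck_on k S (\<lambda>x. f x *\<^sub>R g x)"
  using assms(2,3)
proof (induction k arbitrary: f g)
  case 0
  then show ?case by (auto intro: continuous_intros)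
next
  case (Suc k)
  note f = Ck_on_SucE[OF Suc.prems(1)] and g = Ck_on_SucE[OF Suc.prems(2)]
  show ?case
    by (rule Ck_on_SucI[OF assms(1) has_derivative_scaleR[OF f(1) g(1)]])
      (auto intro!: Ck_on_add[OF assms(1)] Suc.IH f(2) g(2) Ck_on_SucD[OF Suc.prems(1)]
          Ck_on_SucD[OF Suc.prems(2)])
qed

lemma Ck_on_mult:
  fixes f g :: "'a::euclidean_space \<Rightarrow> real"
  shows "open S \<Longrightarrow> Ck_on k S f \<Longrightarrow> Ck_on k S g \<Longrightarrow> Ck_on k S (\<lambda>x. f x * g x)"
  using Ck_on_scaleR[of S k f g] by simp

lemma Ck_on_linear_compose:
  assumes "open S" "bounded_linear L" "Ck_on k S f" shows "Ck_on k S (\<lambda>x. L (f x))"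
  using assms(3)
proof (induction k arbitrary: f)
  case 0
  then show ?case using bounded_linear.continuous_on[OF assms(2)] by simp
next
  case (Suc k)
  note f = Ck_on_SucE[OF Suc.prems(1)]
  show ?case
    by (rule Ck_on_SucI[OF assms(1) bounded_linear.has_derivative[OF assms(2) f(1)]])
      (auto intro: Suc.IH f)
qed

lemma linear_euclidean_expand:
  fixes L :: "'a::euclidean_space \<Rightarrow> 'b::real_vector"
  assumes "linear L" shows "L v = (\<Sum>b\<in>Basis. (v \<bullet> b) *\<^sub>R L b)"
proof -
  have "L v = L (\<Sum>b\<in>Basis. (v \<bullet> b) *\<^sub>R b)" by (simp add: euclidean_representation)
  also have "\<dots> = (\<Sum>b\<in>Basis. (v \<bullet> b) *\<^sub>R L b)"
    by (simp add: linear_sum[OF assms] linear_scale[OF assms])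
  finally show ?thesis .
qed

text \<open>The derivative of \<open>g\<close> is expanded along the basis, so that the derivative of the composition
  is a finite sum of products of functions covered by the induction hypothesis.\<close>

lemma Ck_on_compose:
  fixes f :: "'a::euclidean_space \<Rightarrow> 'b::euclidean_space" and g :: "'b \<Rightarrow> 'c::real_normed_vector"
  assumes "open S" "open T" "f ` S \<subseteq> T" "Ck_on k S f" "Ck_on k T g"
  shows "Ck_on k S (\<lambda>x. g (f x))"
  using assms(4,5)
proof (induction k arbitrary: g)
  case 0
  then show ?case using continuous_on_compose2[of T g S f] assms(3) by simp
next
  case (Suc k)
  note f = Ck_on_SucE[OF Suc.prems(1)] and g = Ck_on_SucE[OF Suc.prems(2)]
  have lin: "linear (frechet_derivative g (at (f x)))" if "x \<in> S" for x
    using g(1)[of "f x"] assms(3) that has_derivative_linear by blast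
  have ex: "frechet_derivative g (at (f x)) (frechet_derivative f (at x) b)
      = (\<Sum>c\<in>Basis. (frechet_derivative f (at x) b \<bullet> c) *\<^sub>R frechet_derivative g (at (f x)) c)"
    if "x \<in> S" for x b
    by (rule linear_euclidean_expand[OF lin[OF that]])
  have gf: "((\<lambda>x. g (f x)) has_derivative
      (\<lambda>b. frechet_derivative g (at (f x)) (frechet_derivative f (at x) b))) (at x)" if "x \<in> S"
          for x
    using diff_chain_at[OF f(1)[OF that] g(1)[of "f x"]] assms(3) that by (auto simp: o_def)
  show ?case
  proof (rule Ck_on_SucI[OF assms(1) gf])
    fix b :: 'a assume b: "b \<in> Basis"
    have "Ck_on k S (\<lambda>x. \<Sum>c\<in>Basis. (frechet_derivative f (at x) b \<bullet> c) *\<^sub>R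
        frechet_derivative g (at (f x)) c)"
      by (intro Ck_on_sum Ck_on_scaleR assms(1) Suc.IH g(2) Ck_on_SucD[OF Suc.prems(1)]
          Ck_on_linear_compose[OF assms(1) bounded_linear_inner_left] f(2) b)
    then show "Ck_on k S (\<lambda>x. frechet_derivative g (at (f x)) (frechet_derivative f (at x) b))"
      using Ck_on_cong[OF assms(1), of "\<lambda>x. \<Sum>c\<in>Basis. (frechet_derivative f (at x) b \<bullet> c) *\<^sub>R
        frechet_derivative g (at (f x)) c"] ex by simp
  qed
qed

lemma Ck_on_inverse:
  fixes f :: "'a::euclidean_space \<Rightarrow> real"
  assumes "open S" "Ck_on k S f" "\<And>x. x \<in> S \<Longrightarrow> f x \<noteq> 0"
  shows "Ck_on k S (\<lambda>x. inverse (f x))"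
  using assms(2)
proof (induction k)
  case 0
  then show ?case using assms(3) by (auto intro!: continuous_intros)
next
  case (Suc k)
  note f = Ck_on_SucE[OF Suc.prems(1)]
  note IH = Suc.IH[OF Ck_on_SucD[OF Suc.prems]]
  have "Ck_on k S (\<lambda>x. (-1) * (inverse (f x) * frechet_derivative f (at x) b * inverse (f x)))"
    if "b \<in> Basis" for b
    by (intro Ck_on_mult assms(1) IH f(2) that Ck_on_const)
  then show ?case
    by (intro Ck_on_SucI[OF assms(1) Deriv.has_derivative_inverse[OF assms(3) f(1)]]) auto
qed

lemma smooth_on_subset: "smooth_on S f \<Longrightarrow> T \<subseteq> S \<Longrightarrow> smooth_on T f"
  by (auto simp: smooth_on_def intro: Ck_on_subset)

lemma smooth_on_cong:
  "open S \<Longrightarrow> (\<And>x. x \<in> S \<Longrightarrow> f x = g x) \<Longrightarrow> smooth_on S f \<Longrightarrow> smooth_on S g"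
  unfolding smooth_on_def using Ck_on_cong by blast

lemma smooth_on_local:
  assumes "\<And>x. x \<in> S \<Longrightarrow> \<exists>T. open T \<and> x \<in> T \<and> smooth_on T f"
  shows "smooth_on S f"
proof -
  have "smooth_on (\<Union>{T. open T \<and> smooth_on T f}) f"
    unfolding smooth_on_def by (intro allI Ck_on_Union) (auto simp: smooth_on_def)
  moreover have "S \<subseteq> \<Union>{T. open T \<and> smooth_on T f}"
    using assms by blast
  ultimately show ?thesis by (rule smooth_on_subset)
qed

lemma smooth_on_const: "smooth_on S (\<lambda>x. c)"
  and smooth_on_bounded_linear: "open S \<Longrightarrow> bounded_linear L \<Longrightarrow> smooth_on S L"
  and smooth_on_add: "open S \<Longrightarrow> smooth_on S f \<Longrightarrow> smooth_on S g \<Longrightarrow> smooth_on S (\<lambda>x. f x + g x)"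
  and smooth_on_scaleR:
    "open S \<Longrightarrow> smooth_on S r \<Longrightarrow> smooth_on S f \<Longrightarrow> smooth_on S (\<lambda>x. r x *\<^sub>R f x)"
  and smooth_on_linear_compose:
    "open S \<Longrightarrow> bounded_linear L' \<Longrightarrow> smooth_on S h \<Longrightarrow> smooth_on S (\<lambda>x. L' (h x))"
  unfolding smooth_on_def
  by (simp_all add: Ck_on_const Ck_on_bounded_linear Ck_on_add Ck_on_scaleR Ck_on_linear_compose)

lemma smooth_on_mult:
  fixes f g :: "'a::euclidean_space \<Rightarrow> real"
  shows "open S \<Longrightarrow> smooth_on S f \<Longrightarrow> smooth_on S g \<Longrightarrow> smooth_on S (\<lambda>x. f x * g x)"
  by (simp add: smooth_on_def Ck_on_mult)

lemma smooth_on_diff: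
  assumes "open S" "smooth_on S f" "smooth_on S g" shows "smooth_on S (\<lambda>x. f x - g x)"
  using smooth_on_add[OF assms(1,2) smooth_on_linear_compose[OF assms(1) bounded_linear_minus[OF
      bounded_linear_ident] assms(3)]]
  by simp

lemma smooth_on_sum:
  "open S \<Longrightarrow> (\<And>i. i \<in> I \<Longrightarrow> smooth_on S (f i)) \<Longrightarrow> smooth_on S (\<lambda>x. \<Sum>i\<in>I. f i x)"
  by (simp add: smooth_on_def Ck_on_sum)

lemma smooth_on_prod:
  fixes f :: "'i \<Rightarrow> 'a::euclidean_space \<Rightarrow> real"
  assumes "open S" "\<And>i. i \<in> I \<Longrightarrow> smooth_on S (f i)"
  shows "smooth_on S (\<lambda>x. \<Prod>i\<in>I. f i x)"
  using assms(2)
  by (induction I rule: infinite_finite_induct)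
    (auto intro: smooth_on_const smooth_on_mult[OF assms(1)])

lemma smooth_on_inverse:
  fixes f :: "'a::euclidean_space \<Rightarrow> real"
  shows "open S \<Longrightarrow> smooth_on S f \<Longrightarrow> (\<And>x. x \<in> S \<Longrightarrow> f x \<noteq> 0) \<Longrightarrow>
    smooth_on S (\<lambda>x. inverse (f x))"
  by (simp add: smooth_on_def Ck_on_inverse)

lemma smooth_on_compose:
  fixes f :: "'a::euclidean_space \<Rightarrow> 'b::euclidean_space" and g :: "'b \<Rightarrow> 'c::real_normed_vector"
  shows "open S \<Longrightarrow> open T \<Longrightarrow> f ` S \<subseteq> T \<Longrightarrow> smooth_on S f \<Longrightarrow> smooth_on T g \<Longrightarrow>
    smooth_on S (\<lambda>x. g (f x))"
  unfolding smooth_on_def using Ck_on_compose by blast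

lemma smooth_on_continuous: "smooth_on S f \<Longrightarrow> continuous_on S f"
  unfolding smooth_on_def using Ck_on_continuous by blast

lemma smooth_on_has_derivative:
  "smooth_on S f \<Longrightarrow> x \<in> S \<Longrightarrow> (f has_derivative frechet_derivative f (at x)) (at x)"
  unfolding smooth_on_def using Ck_on_SucE(1) by blast

lemma smooth_on_derivative:
  assumes "open S" "smooth_on S f" shows "smooth_on S (\<lambda>x. frechet_derivative f (at x) v)"
proof -
  have lin: "linear (frechet_derivative f (at x))" if "x \<in> S" for x
    using smooth_on_has_derivative[OF assms(2) that] has_derivative_linear by blast
  have B: "smooth_on S (\<lambda>x. frechet_derivative f (at x) b)" if "b \<in> Basis" for b
    using assms(2) Ck_on_SucE(2)[OF _ that] unfolding smooth_on_def by blast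
  have "smooth_on S (\<lambda>x. \<Sum>b\<in>Basis. (v \<bullet> b) *\<^sub>R frechet_derivative f (at x) b)"
    by (intro smooth_on_sum smooth_on_scaleR assms(1) smooth_on_const B)
  moreover have "frechet_derivative f (at x) v
      = (\<Sum>b\<in>Basis. (v \<bullet> b) *\<^sub>R frechet_derivative f (at x) b)" if "x \<in> S" for x
    by (rule linear_euclidean_expand[OF lin[OF that]])
  ultimately show ?thesis
    using smooth_on_cong[OF assms(1), of "\<lambda>x. \<Sum>b\<in>Basis. (v \<bullet> b) *\<^sub>R frechet_derivative f (at x) b"]
    by simp
qed


section \<open>Cutoff functions\<close>

text \<open>The functions \<open>x\<^sup>-\<^sup>m exp (-1/x)\<close>, extended by zero to \<open>x \<le> 0\<close>: the span of this family is
  closed under differentiation, which is why its members are smooth.\<close>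

definition flat_exp :: "nat \<Rightarrow> real \<Rightarrow> real"
  where "flat_exp m x = (if x > 0 then inverse x ^ m * exp (- inverse x) else 0)"

lemma flat_exp_tendsto_0: "(flat_exp m \<longlongrightarrow> 0) (at 0)"
proof -
  have "((\<lambda>x. inverse x ^ m / exp (inverse x)) \<longlongrightarrow> (0::real)) (at_right 0)"
    using filterlim_compose[OF tendsto_power_div_exp_0 filterlim_inverse_at_top_right] .
  moreover have "\<forall>\<^sub>F x in at_right 0. inverse x ^ m / exp (inverse x) = flat_exp m x"
    unfolding eventually_at_filter
    by (rule always_eventually) (simp add: flat_exp_def exp_minus divide_inverse)
  ultimately have R: "(flat_exp m \<longlongrightarrow> 0) (at_right 0)"
    by (rule Lim_transform_eventually)
  have "\<forall>\<^sub>F x in at_left (0::real). 0 = flat_exp m x"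
    by (simp add: flat_exp_def eventually_at_filter)
  then have "(flat_exp m \<longlongrightarrow> 0) (at_left 0)"
    by (rule Lim_transform_eventually[OF tendsto_const])
  with R show ?thesis by (simp add: filterlim_split_at)
qed

text \<open>At \<open>0\<close> the difference quotient of one member of the family is the next member, which tends
  to \<open>0\<close>.\<close>

lemma flat_exp_DERIV:
  "(flat_exp m has_real_derivative (flat_exp (m + 2) x - m * flat_exp (m + 1) x)) (at x)"
proof -
  consider "x > 0" | "x < 0" | "x = 0" by linarith
  then show ?thesis
  proof cases
    case 1
    have "((\<lambda>x. inverse x ^ m * exp (- inverse x)) has_real_derivative
        (flat_exp (m + 2) x - m * flat_exp (m + 1) x)) (at x)"
    proof (cases m)
      case 0
      with 1 show ?thesis
        by (auto intro!: derivative_eq_intros simp: flat_exp_def field_simps power2_eq_square)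
    next
      case (Suc j)
      have "x ^ (j - Suc 0) * x = x ^ j \<or> j = 0" by (cases j) auto
      with 1 Suc show ?thesis
        by (auto intro!: derivative_eq_intros simp: flat_exp_def field_simps power2_eq_square)
    qed
    then show ?thesis
      by (rule has_field_derivative_transform_within_open[of _ _ _ "{0<..}"])
        (use 1 in \<open>auto simp: flat_exp_def\<close>)
  next
    case 2
    have "((\<lambda>x. 0) has_real_derivative (flat_exp (m + 2) x - m * flat_exp (m + 1) x)) (at x)"
      using 2 by (auto simp: flat_exp_def)
    then show ?thesis
      by (rule has_field_derivative_transform_within_open[of _ _ _ "{..<0}"])
        (use 2 in \<open>auto simp: flat_exp_def\<close>)
  next
    case 3
    have "(\<lambda>h. (flat_exp m (0 + h) - flat_exp m 0) / h) = flat_exp (m + 1)"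
      by (auto simp: flat_exp_def fun_eq_iff field_simps)
    then have "(flat_exp m has_real_derivative 0) (at 0)"
      using flat_exp_tendsto_0[of "m + 1"] by (simp add: DERIV_def)
    then show ?thesis using 3 by (simp add: flat_exp_def)
  qed
qed

lemma smooth_flat_exp: "smooth_on UNIV (flat_exp m)"
proof -
  have "Ck_on k UNIV (flat_exp m)" for k
  proof (induction k arbitrary: m)
    case 0
    then show ?case
      by (simp add: continuous_on_eq_continuous_at) (blast intro: DERIV_isCont flat_exp_DERIV)
  next
    case (Suc k)
    have "Ck_on k UNIV (\<lambda>x. flat_exp (m + 2) x + (- real m) * flat_exp (m + 1) x)"
      by (intro Ck_on_add Ck_on_mult Ck_on_const Suc.IH open_UNIV)
    then show ?case
      by (intro Ck_on_SucI[OF open_UNIV flat_exp_DERIV[unfolded has_field_derivative_def]]) auto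
  qed
  then show ?thesis by (simp add: smooth_on_def)
qed

lemma flat_exp_pos: "x > 0 \<Longrightarrow> 0 < flat_exp m x" and flat_exp_0: "x \<le> 0 \<Longrightarrow> flat_exp m x = 0"
  by (auto simp: flat_exp_def)

definition smooth_step :: "real \<Rightarrow> real"
  where "smooth_step x = flat_exp 0 x * inverse (flat_exp 0 x + flat_exp 0 (1 - x))"

lemma smooth_smooth_step: "smooth_on UNIV smooth_step"
proof -
  have l: "smooth_on UNIV (\<lambda>x::real. 1 - x)"
    by (intro smooth_on_diff smooth_on_const open_UNIV smooth_on_bounded_linear
        bounded_linear_ident)
  \<comment> \<open>One of \<open>x\<close> and \<open>1 - x\<close> is positive.\<close>
  have "flat_exp 0 x + flat_exp 0 (1 - x) \<noteq> 0" for x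
    using flat_exp_pos[of x 0] flat_exp_pos[of "1 - x" 0] flat_exp_0[of x 0] flat_exp_0[of
        "1 - x" 0]
    by (smt (verit))
  then show ?thesis
    unfolding smooth_step_def[abs_def]
    by (intro smooth_on_mult smooth_on_inverse smooth_on_add smooth_flat_exp open_UNIV
        smooth_on_compose[OF open_UNIV open_UNIV _ l]) auto
qed

lemma smooth_step_0: "x \<le> 0 \<Longrightarrow> smooth_step x = 0"
  and smooth_step_1: "1 \<le> x \<Longrightarrow> smooth_step x = 1"
  and smooth_step_bounds: "0 \<le> smooth_step x" "smooth_step x \<le> 1"
proof -
  show "x \<le> 0 \<Longrightarrow> smooth_step x = 0" by (simp add: smooth_step_def flat_exp_0)
  show "1 \<le> x \<Longrightarrow> smooth_step x = 1"
    using flat_exp_pos[of x 0] by (simp add: smooth_step_def flat_exp_0)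
  have n: "0 \<le> flat_exp 0 y" for y by (simp add: flat_exp_def)
  show "0 \<le> smooth_step x" using n by (simp add: smooth_step_def)
  show "smooth_step x \<le> 1" using n[of x] n[of "1 - x"]
    by (cases "flat_exp 0 x + flat_exp 0 (1 - x) = 0")
       (auto simp: smooth_step_def divide_inverse[symmetric] divide_le_eq_1)
qed

text \<open>The sum of bumps on finitely many balls covering \<open>K\<close> is bounded below by some \<open>m > 0\<close> on
  \<open>K\<close>, and a smooth step applied to its quotient by \<open>m\<close> flattens it to \<open>1\<close> there.\<close>

lemma compact_subset_open_smooth_cutoff:
  fixes K V :: "'a::euclidean_space set"
  assumes "compact K" "open V" "K \<subseteq> V"
  obtains \<eta> :: "'a \<Rightarrow> real" and L where "smooth_on UNIV \<eta>" "compact L" "L \<subseteq> V"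
    "\<And>x. x \<notin> L \<Longrightarrow> \<eta> x = 0" "\<And>x. x \<in> K \<Longrightarrow> \<eta> x = 1"
proof -
  have "\<forall>x\<in>K. \<exists>r>0. cball x r \<subseteq> V"
    using assms open_contains_cball by (metis subsetD)
  then obtain r where r: "\<And>x. x \<in> K \<Longrightarrow> 0 < r x \<and> cball x (r x) \<subseteq> V"
    by metis
  have "K \<subseteq> (\<Union>x\<in>K. ball x (r x))" using r by force
  then obtain F where F: "F \<subseteq> K" "finite F" "K \<subseteq> (\<Union>x\<in>F. ball x (r x))"
    using compactE_image[OF assms(1), of K "\<lambda>x. ball x (r x)"] by auto
  define b where "b c x = flat_exp 0 ((r c)\<^sup>2 - (x - c) \<bullet> (x - c))" for c x :: 'a
  define S where "S x = (\<Sum>c\<in>F. b c x)" for x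
  have smq: "smooth_on UNIV (\<lambda>x::'a. (r c)\<^sup>2 - (x - c) \<bullet> (x - c))" for c
  proof -
    have d: "smooth_on UNIV (\<lambda>x::'a. x - c)"
      by (intro smooth_on_diff smooth_on_const open_UNIV smooth_on_bounded_linear
          bounded_linear_ident)
    have "smooth_on UNIV (\<lambda>x::'a. (r c)\<^sup>2 - (\<Sum>i\<in>Basis. ((x - c) \<bullet> i) * ((x - c) \<bullet> i)))"
      by (intro smooth_on_diff smooth_on_const open_UNIV smooth_on_sum smooth_on_mult
          smooth_on_linear_compose[OF _ bounded_linear_inner_left d])
    moreover have "(\<Sum>i\<in>Basis. ((x - c) \<bullet> i) * ((x - c) \<bullet> i)) = (x - c) \<bullet> (x - c)" for x
      by (rule euclidean_inner[symmetric])
    ultimately show ?thesis by simp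
  qed
  have b: "smooth_on UNIV (b c)" for c
    unfolding b_def by (rule smooth_on_compose[OF open_UNIV open_UNIV _ smq smooth_flat_exp]) simp
  have S: "smooth_on UNIV S"
    unfolding S_def by (intro smooth_on_sum open_UNIV b)
  have sq: "(x - c) \<bullet> (x - c) = (dist c x)\<^sup>2" for x c :: 'a
    by (simp add: dist_norm power2_norm_eq_inner[symmetric] norm_minus_commute)
  have b0: "0 \<le> b c x" for c x by (simp add: b_def flat_exp_def)
  have pos: "0 < S x" if xK: "x \<in> K" for x
  proof -
    obtain c where c: "c \<in> F" "x \<in> ball c (r c)" using F(3) xK by blast
    then have "(dist c x)\<^sup>2 < (r c)\<^sup>2"
      using r F(1) by (intro power_strict_mono) auto
    then have "0 < b c x" unfolding b_def sq by (intro flat_exp_pos) simp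
    then show ?thesis unfolding S_def using c(1) F(2) b0 by (intro sum_pos2[of F c]) auto
  qed
  obtain m where m: "0 < m" "\<And>x. x \<in> K \<Longrightarrow> m \<le> S x"
  proof (cases "K = {}")
    case False
    have "continuous_on K S" using smooth_on_continuous[OF S] continuous_on_subset by blast
    then obtain x where "x \<in> K" "\<And>y. y \<in> K \<Longrightarrow> S x \<le> S y"
      using continuous_attains_inf[OF assms(1) False] by blast
    then show ?thesis using pos that by blast
  qed (use that[of 1] in auto)
  \<comment> \<open>The bump at \<open>c\<close> vanishes off the closed ball of radius \<open>r c\<close>, which lies in \<open>V\<close>.\<close>
  define L where "L = (\<Union>c\<in>F. cball c (r c))"
  have out: "S x = 0" if "x \<notin> L" for x
    unfolding S_def
  proof (rule sum.neutral, rule ballI)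
    fix c assume "c \<in> F"
    then have "r c < dist c x" "0 < r c" using that r F(1) unfolding L_def by force+
    then have "(r c)\<^sup>2 \<le> (dist c x)\<^sup>2" by (intro power_mono) auto
    then show "b c x = 0" unfolding b_def sq by (intro flat_exp_0) simp
  qed
  have smm: "smooth_on UNIV (\<lambda>x. inverse m * S x)"
    by (intro smooth_on_mult smooth_on_const S open_UNIV)
  show ?thesis
  proof (rule that)
    show "smooth_on UNIV (\<lambda>x. smooth_step (inverse m * S x))"
      by (rule smooth_on_compose[OF open_UNIV open_UNIV _ smm smooth_smooth_step]) simp
    show "compact L" unfolding L_def using F by (intro compact_UN) auto
    show "L \<subseteq> V" unfolding L_def using r F by blast
    show "smooth_step (inverse m * S x) = 0" if "x \<notin> L" for x
      using out[OF that] by (simp add: smooth_step_0)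
    show "smooth_step (inverse m * S x) = 1" if "x \<in> K" for x
      using m(2)[OF that] m(1) by (intro smooth_step_1) (simp add: field_simps)
  qed
qed


section \<open>Test functions and iterated partial derivatives\<close>

lemma test_functionsI:
  assumes "smooth_on UNIV \<phi>" "compact K" "K \<subseteq> \<Omega>" "\<And>x. x \<notin> K \<Longrightarrow> \<phi> x = 0"
  shows "\<phi> \<in> test_functions \<Omega>"
proof -
  have "closure {x. \<phi> x \<noteq> 0} \<subseteq> K"
    using assms(2,4) by (intro closure_minimal) (auto simp: compact_imp_closed)
  moreover from this have "compact (closure {x. \<phi> x \<noteq> 0})"
    using compact_Int_closed[OF assms(2) closed_closure, of "{x. \<phi> x \<noteq> 0}"]
        by (simp add: Int_absorb1)
  ultimately show ?thesis
    using assms(1,3) unfolding test_functions_def by blast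
qed

lemma test_functionsE:
  assumes "\<phi> \<in> test_functions \<Omega>"
  obtains K where "smooth_on UNIV \<phi>" "compact K" "K \<subseteq> \<Omega>" "\<And>x. x \<notin> K \<Longrightarrow> \<phi> x = 0"
    "K = closure {x. \<phi> x \<noteq> 0}"
proof -
  have *: "smooth_on UNIV \<phi>" "compact (closure {x. \<phi> x \<noteq> 0})" "closure {x. \<phi> x \<noteq> 0} \<subseteq> \<Omega>"
    using assms by (simp_all only: test_functions_def mem_Collect_eq)
  have "\<phi> x = 0" if "x \<notin> closure {x. \<phi> x \<noteq> 0}" for x
    using that closure_subset[of "{x. \<phi> x \<noteq> 0}"] by blast
  from that[OF * this refl] show thesis .
qed

lemma test_functions_mono: "\<Omega> \<subseteq> \<Omega>' \<Longrightarrow> test_functions \<Omega> \<subseteq> test_functions \<Omega>'"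
  by (auto simp: test_functions_def)

lemma test_functions_smooth: "\<phi> \<in> test_functions \<Omega> \<Longrightarrow> smooth_on UNIV \<phi>"
  by (simp add: test_functions_def)

lemma test_functions_outside: "\<phi> \<in> test_functions \<Omega> \<Longrightarrow> x \<notin> \<Omega> \<Longrightarrow> \<phi> x = 0"
  using closure_subset[of "{x. \<phi> x \<noteq> 0}"] by (auto simp: test_functions_def)

lemma test_functions_zero: "(\<lambda>x. 0) \<in> test_functions \<Omega>"
  by (rule test_functionsI[of _ "{}"]) (auto intro: smooth_on_const)

lemma test_functions_add:
  assumes "\<phi> \<in> test_functions \<Omega>" "\<psi> \<in> test_functions \<Omega>"
  shows "(\<lambda>x. \<phi> x + \<psi> x) \<in> test_functions \<Omega>"
proof -
  obtain K where K: "smooth_on UNIV \<phi>" "compact K" "K \<subseteq> \<Omega>" "\<And>x. x \<notin> K \<Longrightarrow> \<phi> x = 0"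
    using test_functionsE[OF assms(1)] by metis
  obtain L where L: "smooth_on UNIV \<psi>" "compact L" "L \<subseteq> \<Omega>" "\<And>x. x \<notin> L \<Longrightarrow> \<psi> x = 0"
    using test_functionsE[OF assms(2)] by metis
  show ?thesis
    by (rule test_functionsI[of _ "K \<union> L"]) (use K L in \<open>auto intro: smooth_on_add\<close>)
qed

lemma test_functions_mult:
  assumes "\<phi> \<in> test_functions \<Omega>" "smooth_on UNIV g"
  shows "(\<lambda>x. \<phi> x * g x) \<in> test_functions \<Omega>"
proof -
  obtain K where K: "smooth_on UNIV \<phi>" "compact K" "K \<subseteq> \<Omega>" "\<And>x. x \<notin> K \<Longrightarrow> \<phi> x = 0"
    using test_functionsE[OF assms(1)] by metis
  show ?thesis
    by (rule test_functionsI[of _ K]) (use K assms(2) in \<open>auto intro: smooth_on_mult\<close>)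
qed

lemma test_functions_scale:
  "\<phi> \<in> test_functions \<Omega> \<Longrightarrow> (\<lambda>x. c * \<phi> x) \<in> test_functions \<Omega>"
  using test_functions_mult[OF _ smooth_on_const[of UNIV c]] by (simp add: mult.commute)

lemma test_functions_diff:
  "\<phi> \<in> test_functions \<Omega> \<Longrightarrow> \<psi> \<in> test_functions \<Omega> \<Longrightarrow> (\<lambda>x. \<phi> x - \<psi> x) \<in> test_functions \<Omega>"
  using test_functions_add[of \<phi> \<Omega> "\<lambda>x. -1 * \<psi> x"] test_functions_scale[of \<psi> \<Omega> "-1"] by simp

lemma smooth_partial: "smooth_on UNIV f \<Longrightarrow> smooth_on UNIV (partial i f)"
  using smooth_on_derivative[OF open_UNIV] by (simp add: partial_def[abs_def])

lemma partial_eqI: "(f has_derivative f') (at x) \<Longrightarrow> partial i f x = f' (axis i 1)"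
  by (simp add: partial_def frechet_derivative_at[symmetric])

lemma partial_mult:
  assumes "smooth_on UNIV f" "smooth_on UNIV g"
  shows "partial i (\<lambda>x. f x * g x) = (\<lambda>x. partial i f x * g x + f x * partial i g x)"
proof
  fix x
  show "partial i (\<lambda>x. f x * g x) x = partial i f x * g x + f x * partial i g x"
    using partial_eqI[OF has_derivative_mult[OF smooth_on_has_derivative[OF assms(1), of x]
          smooth_on_has_derivative[OF assms(2), of x]], of i]
    by (simp add: partial_def)
qed

lemma partial_zero_outside:
  assumes "closed K" "\<And>x. x \<notin> K \<Longrightarrow> f x = 0" "x \<notin> K"
  shows "partial i f x = 0"
proof -
  have "((\<lambda>x. 0) has_derivative (\<lambda>h. 0)) (at x)" by simp
  then have "(f has_derivative (\<lambda>h. 0)) (at x)"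
    by (rule has_derivative_transform_within_open[of _ _ _ _ "- K"]) (use assms in auto)
  then show ?thesis by (simp add: partial_eqI)
qed

lemma test_functions_partial:
  assumes "\<phi> \<in> test_functions \<Omega>"
  shows "partial i \<phi> \<in> test_functions \<Omega>"
proof -
  obtain K where K: "smooth_on UNIV \<phi>" "compact K" "K \<subseteq> \<Omega>" "\<And>x. x \<notin> K \<Longrightarrow> \<phi> x = 0"
    using test_functionsE[OF assms(1)] by metis
  show ?thesis
    by (rule test_functionsI[of _ K])
      (use K compact_imp_closed in \<open>auto intro: smooth_partial partial_zero_outside\<close>)
qed

lemma smooth_partials: "smooth_on UNIV f \<Longrightarrow> smooth_on UNIV (foldr partial is f)"
  by (induction "is") (auto intro: smooth_partial)

lemma test_functions_partials:
  "\<phi> \<in> test_functions \<Omega> \<Longrightarrow> foldr partial is \<phi> \<in> test_functions \<Omega>"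
  by (induction "is") (auto intro: test_functions_partial)

lemma partials_zero_outside:
  assumes "closed K" "\<And>x. x \<notin> K \<Longrightarrow> f x = 0" "x \<notin> K"
  shows "foldr partial is f x = 0"
  using assms(3)
  by (induction "is" arbitrary: x) (auto intro: partial_zero_outside[OF assms(1)] assms(2))

lemma test_functions_bounded:
  assumes "\<phi> \<in> test_functions \<Omega>"
  obtains M where "0 < M" "\<And>x. \<bar>\<phi> x\<bar> \<le> M"
proof -
  obtain K where K: "smooth_on UNIV \<phi>" "compact K" "\<And>x. x \<notin> K \<Longrightarrow> \<phi> x = 0"
    using test_functionsE[OF assms(1)] by metis
  have "compact (\<phi> ` K)"
    using K smooth_on_continuous compact_continuous_image continuous_on_subset by blast
  then obtain M where "0 < M" "\<forall>y\<in>\<phi> ` K. norm y \<le> M"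
    using compact_imp_bounded bounded_pos by blast
  then show ?thesis using K(3) that[of M] by (metis abs_zero image_eqI less_imp_le real_norm_def)
qed

lemma DERIV_along_line:
  assumes "smooth_on UNIV f"
  shows "((\<lambda>t. f (x + t *\<^sub>R v)) has_real_derivative frechet_derivative f (at (x + t *\<^sub>R v)) v)
      (at t)"
proof -
  have "((\<lambda>t. x + t *\<^sub>R v) has_derivative (\<lambda>h. h *\<^sub>R v)) (at t)"
    by (auto intro!: derivative_eq_intros)
  note d = diff_chain_at[OF this smooth_on_has_derivative[OF assms]]
  have "linear (frechet_derivative f (at (x + t *\<^sub>R v)))"
    using smooth_on_has_derivative[OF assms] has_derivative_linear by blast
  with d show ?thesis
    by (simp add: has_field_derivative_def o_def linear_scale mult_commute_abs)
qed

lemma partial_MVT: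
  fixes f :: "real^'n::finite \<Rightarrow> real"
  assumes "smooth_on UNIV f" "0 < s"
  obtains t where "0 < t" "t < s"
    "f (x + s *\<^sub>R axis i 1) - f x = s * partial i f (x + t *\<^sub>R axis i 1)"
proof -
  have "\<exists>z>0. z < s \<and> f (x + s *\<^sub>R axis i 1) - f (x + 0 *\<^sub>R axis i 1) =
      (s - 0) * frechet_derivative f (at (x + z *\<^sub>R axis i 1)) (axis i 1)"
    by (rule MVT2[OF assms(2)]) (rule DERIV_along_line[OF assms(1)])
  then show ?thesis using that by (auto simp: partial_def)
qed

text \<open>Both mixed derivatives are limits of the same second difference quotient.\<close>

lemma partial_commute:
  fixes f :: "real^'n::finite \<Rightarrow> real"
  assumes f: "smooth_on UNIV f"
  shows "partial i (partial j f) = partial j (partial i f)"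
proof
  fix x
  have shift: "smooth_on UNIV (\<lambda>y. f (y + v) - f y)"
    "partial i (\<lambda>y. f (y + v) - f y) = (\<lambda>y. partial i f (y + v) - partial i f y)" for v i
  proof -
    have "smooth_on UNIV (\<lambda>y. y + v)"
      by (intro smooth_on_add smooth_on_const open_UNIV smooth_on_bounded_linear
          bounded_linear_ident)
    from smooth_on_compose[OF open_UNIV open_UNIV _ this f] have "smooth_on UNIV (\<lambda>y. f (y + v))"
      by simp
    then show "smooth_on UNIV (\<lambda>y. f (y + v) - f y)" by (rule smooth_on_diff[OF open_UNIV _ f])
    have a: "((\<lambda>y. y + v) has_derivative (\<lambda>h. h)) (at y)" for y
      by (auto intro!: derivative_eq_intros)
    have "partial i (\<lambda>y. f (y + v) - f y) y = partial i f (y + v) - partial i f y" for y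
    proof -
      have "((\<lambda>y. f (y + v)) has_derivative frechet_derivative f (at (y + v))) (at y)"
        using diff_chain_at[OF a[of y] smooth_on_has_derivative[OF f UNIV_I]] by (simp add: o_def)
      from partial_eqI[OF has_derivative_diff[OF this smooth_on_has_derivative[OF f UNIV_I]]]
      show ?thesis by (simp add: partial_def)
    qed
    then show "partial i (\<lambda>y. f (y + v) - f y) = (\<lambda>y. partial i f (y + v) - partial i f y)" ..
  qed
  have quot: "\<exists>y. norm (y - x) \<le> 2 * s \<and> partial j (partial i f) y
      = (f (x + s *\<^sub>R axis j 1 + s *\<^sub>R axis i 1)
      - f (x + s *\<^sub>R axis i 1) - f (x + s *\<^sub>R axis j 1) + f x) / s\<^sup>2" if s: "0 < s" for s i j
  proof -
    define g where "g = (\<lambda>y. f (y + s *\<^sub>R axis j 1) - f y)"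
    have g: "smooth_on UNIV g" unfolding g_def by (rule shift(1))
    obtain t where t: "0 < t" "t < s" "g (x + s *\<^sub>R axis i 1) - g x
        = s * partial i g (x + t *\<^sub>R axis i 1)"
      using partial_MVT[OF g s] by metis
    obtain t' where t': "0 < t'" "t' < s" "partial i f (x + t *\<^sub>R axis i 1 + s *\<^sub>R axis j 1) -
        partial i f (x + t *\<^sub>R axis i 1) = s * partial j (partial i f) (x + t *\<^sub>R axis i 1 + t'
            *\<^sub>R axis j 1)"
      using partial_MVT[OF smooth_partial[OF f] s] by metis
    define y where "y = x + t *\<^sub>R axis i 1 + t' *\<^sub>R axis j 1"
    have "norm (y - x) \<le> norm (t *\<^sub>R axis i (1::real)) + norm (t' *\<^sub>R axis j (1::real))"
      unfolding y_def
      using norm_triangle_ineq[of "t *\<^sub>R axis i (1::real)" "t' *\<^sub>R axis j (1::real)"]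
      by (simp add: add.assoc)
    then have "norm (y - x) \<le> 2 * s" using t t' by simp
    moreover have "g (x + s *\<^sub>R axis i 1) - g x = s * (s * partial j (partial i f) y)"
      using t(3) t'(3) unfolding g_def shift(2) y_def by simp
    then have "partial j (partial i f) y = (g (x + s *\<^sub>R axis i 1) - g x) / s\<^sup>2"
      using s by (simp add: power2_eq_square)
    moreover have "x + s *\<^sub>R axis i 1 + s *\<^sub>R axis j 1 = x + s *\<^sub>R axis j 1 + s *\<^sub>R axis i 1"
      by (simp add: ac_simps)
    ultimately show ?thesis unfolding g_def by (intro exI[of _ y]) (simp add: algebra_simps)
  qed
  define D where "D s = (f (x + s *\<^sub>R axis j 1 + s *\<^sub>R axis i 1)
      - f (x + s *\<^sub>R axis i 1) - f (x + s *\<^sub>R axis j 1) + f x) / s\<^sup>2" for s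
  have lim: "(D \<longlongrightarrow> partial j' (partial i' f) x) (at_right 0)"
    if *: "\<And>s. 0 < s \<Longrightarrow> \<exists>y. norm (y - x) \<le> 2 * s \<and> partial j' (partial i' f) y = D s" for i' j'
  proof (rule tendstoI)
    fix e :: real assume "0 < e"
    have "continuous_on UNIV (partial j' (partial i' f))"
      using f smooth_on_continuous smooth_partial by blast
    then obtain d where d: "0 < d" "\<And>y. dist y x < d \<Longrightarrow>
        dist (partial j' (partial i' f) y) (partial j' (partial i' f) x) < e"
      using \<open>0 < e\<close> unfolding continuous_on_iff by (metis UNIV_I)
    have "dist (D s) (partial j' (partial i' f) x) < e" if s: "0 < s" "s < d / 2" for s
    proof -
      obtain y where "norm (y - x) \<le> 2 * s" "partial j' (partial i' f) y = D s" using *[OF s(1)]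
          by blast
      then show ?thesis using d(2)[of y] s by (simp add: dist_norm)
    qed
    then show "\<forall>\<^sub>F s in at_right 0. dist (D s) (partial j' (partial i' f) x) < e"
      using d(1) by (auto simp: eventually_at_right_field intro!: exI[of _ "d / 2"])
  qed
  have "(D \<longlongrightarrow> partial j (partial i f) x) (at_right 0)"
    by (rule lim) (use quot in \<open>auto simp: D_def\<close>)
  moreover have "(D \<longlongrightarrow> partial i (partial j f) x) (at_right 0)"
  proof (rule lim)
    fix s :: real assume "0 < s"
    from quot[OF this, of i j] show "\<exists>y. norm (y - x) \<le> 2 * s \<and> partial i (partial j f) y = D s"
      by (simp add: D_def algebra_simps)
  qed
  ultimately show "partial i (partial j f) x = partial j (partial i f) x"
    using tendsto_unique trivial_limit_at_right_real by blast
qed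

lemma partial_partials_commute:
  "smooth_on UNIV f \<Longrightarrow> foldr partial is (partial i f) = partial i (foldr partial is f)"
  by (induction "is") (auto simp: partial_commute smooth_partials)

lemma partials_perm:
  assumes "smooth_on UNIV f" "mset is = mset js"
  shows "foldr partial is f = foldr partial js f"
  using assms(2)
proof (induction "is" arbitrary: js)
  case (Cons i "is")
  then obtain as bs where js: "js = as @ i # bs"
    by (metis list.set_intros(1) set_mset_mset split_list)
  then have "mset is = mset (as @ bs)" using Cons.prems by simp
  from Cons.IH[OF this] show ?case
    using partial_partials_commute[OF smooth_partials[OF assms(1), of bs], of as i]
    by (simp add: js)
qed simp

lemma count_list_eq_count: "count_list is i = count (mset is) i"
  by (induction "is") auto

lemma ex_count_list: "\<exists>is. \<forall>i::'n::finite. count_list is i = \<nu> i"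
proof -
  obtain "is" where "mset is = Abs_multiset \<nu>" using ex_mset by blast
  then have "\<forall>i. count_list is i = \<nu> i" by (simp add: count_list_eq_count)
  then show ?thesis ..
qed

lemma order_mi_count_list: "order_mi (count_list is) = length is"
proof (induction "is")
  case (Cons a "is")
  have "count_list (a # is) = (\<lambda>i. count_list is i + (if a = i then 1 else 0))" by auto
  then show ?case using Cons by (simp add: order_mi_def sum.distrib)
qed (simp add: order_mi_def)

text \<open>The multi-index derivative is taken along an unspecified list of directions; here it may be
  computed along any list with the right multiplicities.\<close>

lemma multi_partial_eq_partials:
  assumes "smooth_on UNIV f" "count_list is = \<nu>"
  shows "multi_partial \<nu> f = foldr partial is f"
proof -
  have "\<forall>i. count_list (SOME is. \<forall>i. count_list is i = \<nu> i) i = \<nu> i"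
    by (rule someI_ex[OF ex_count_list])
  then have "mset (SOME is. \<forall>i. count_list is i = \<nu> i) = mset is"
    using assms(2) by (auto simp: multiset_eq_iff count_list_eq_count[symmetric])
  then show ?thesis unfolding multi_partial_def by (rule partials_perm[OF assms(1)])
qed

lemma obtain_partials:
  obtains "is" where "count_list is = \<nu>" "length is = order_mi (\<nu> :: 'n::finite \<Rightarrow> nat)"
  using ex_count_list[of \<nu>] order_mi_count_list by (metis ext)

lemma finite_order_mi: "finite {\<nu> :: 'n::finite \<Rightarrow> nat. order_mi \<nu> \<le> k}"
proof (rule finite_subset)
  show "finite (count_list ` {is :: 'n list. set is \<subseteq> UNIV \<and> length is \<le> k})"
    by (intro finite_imageI finite_lists_length_le) simp
  show "{\<nu> :: 'n \<Rightarrow> nat. order_mi \<nu> \<le> k} \<subseteq> count_list ` {is. set is \<subseteq> UNIV \<and> length is \<le> k}"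
  proof
    fix \<nu> :: "'n \<Rightarrow> nat" assume "\<nu> \<in> {\<nu>. order_mi \<nu> \<le> k}"
    moreover obtain "is" where "count_list is = \<nu>" "length is = order_mi \<nu>"
        by (rule obtain_partials)
    ultimately show "\<nu> \<in> count_list ` {is. set is \<subseteq> UNIV \<and> length is \<le> k}" by force
  qed
qed

lemma finite_order_mi_eq: "finite {\<nu> :: 'n::finite \<Rightarrow> nat. order_mi \<nu> = k}"
  by (rule finite_subset[OF _ finite_order_mi[of k]]) auto

section \<open>Integration against test functions\<close>

lemma integrable_bounded_mult:
  fixes f g :: "'a \<Rightarrow> real"
  assumes "integrable M f" "g \<in> borel_measurable M" "\<And>x. \<bar>g x\<bar> \<le> C"
  shows "integrable M (\<lambda>x. g x * f x)"
proof (rule Bochner_Integration.integrable_bound)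
  show "integrable M (\<lambda>x. C * \<bar>f x\<bar>)" using assms(1) by (intro integrable_mult_right integrable_abs)
  have "norm (g x * f x) \<le> norm (C * \<bar>f x\<bar>)" for x
    using assms(3)[of x] by (simp add: abs_mult mult_right_mono)
  then show "AE x in M. norm (g x * f x) \<le> norm (C * \<bar>f x\<bar>)" by simp
qed (use assms in auto)

lemma smooth_borel: "smooth_on UNIV f \<Longrightarrow> f \<in> borel_measurable borel"
  using smooth_on_continuous borel_measurable_continuous_onI by blast

lemma test_functions_integrable:
  assumes "\<phi> \<in> test_functions \<Omega>" shows "integrable lborel \<phi>"
proof -
  obtain K where K: "smooth_on UNIV \<phi>" "compact K" "\<And>x. x \<notin> K \<Longrightarrow> \<phi> x = 0"
    using test_functionsE[OF assms] by metis
  have "integrable lborel (\<lambda>x. indicator K x *\<^sub>R \<phi> x)"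
    using K(2) continuous_on_subset[OF smooth_on_continuous[OF K(1)]]
    by (intro borel_integrable_compact) auto
  moreover have "(\<lambda>x. indicator K x *\<^sub>R \<phi> x) = \<phi>"
    using K(3) by (auto simp: fun_eq_iff indicator_def)
  ultimately show ?thesis by simp
qed

lemma integrable_mult_test:
  assumes "locally_integrable_on \<Omega> f" "\<phi> \<in> test_functions \<Omega>"
  shows "set_integrable lborel \<Omega> (\<lambda>x. f x * \<phi> x)"
proof -
  obtain K where K: "smooth_on UNIV \<phi>" "compact K" "K \<subseteq> \<Omega>" "\<And>x. x \<notin> K \<Longrightarrow> \<phi> x = 0"
    using test_functionsE[OF assms(2)] by metis
  obtain C where C: "\<And>x. \<bar>\<phi> x\<bar> \<le> C" using test_functions_bounded[OF assms(2)] by metis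
  have "integrable lborel (\<lambda>x. indicator K x *\<^sub>R f x)"
    using assms(1) K unfolding locally_integrable_on_def set_integrable_def by blast
  then have "integrable lborel (\<lambda>x. \<phi> x * (indicator K x *\<^sub>R f x))"
    by (rule integrable_bounded_mult) (use smooth_borel[OF K(1)] C in auto)
  moreover have "(\<lambda>x. \<phi> x * (indicator K x *\<^sub>R f x)) = (\<lambda>x. indicator \<Omega> x *\<^sub>R (f x * \<phi> x))"
    using K(3,4) by (fastforce simp: fun_eq_iff indicator_def)
  ultimately show ?thesis by (simp add: set_integrable_def)
qed

lemma integrable_imp_locally_integrable:
  assumes "integrable lborel f" shows "locally_integrable_on \<Omega> f"
  unfolding locally_integrable_on_def set_integrable_def
  using integrable_mult_indicator[OF _ assms] by (auto simp: compact_imp_closed borel_closed)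

lemma lborel_integral_translate:
  fixes f :: "'a::euclidean_space \<Rightarrow> real"
  shows "f \<in> borel_measurable borel \<Longrightarrow> (\<integral>x. f (x + c) \<partial>lborel) = (\<integral>x. f x \<partial>lborel)"
    and "integrable lborel f \<Longrightarrow> integrable lborel (\<lambda>x. f (x + c))"
proof -
  have d: "distr lborel borel ((+) c) = lborel" by (rule lborel_distr_plus)
  show "(\<integral>x. f (x + c) \<partial>lborel) = (\<integral>x. f x \<partial>lborel)" if "f \<in> borel_measurable borel"
    using integral_distr[of "(+) c" lborel borel f] that by (simp add: d add.commute)
  show "integrable lborel (\<lambda>x. f (x + c))" if "integrable lborel f"
    using integrable_distr_eq[of "(+) c" lborel borel f] that by (simp add: d add.commute)
qed

lemma lborel_nn_integral_translate:
  fixes f :: "'a::euclidean_space \<Rightarrow> ennreal"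
  assumes "f \<in> borel_measurable borel"
  shows "(\<integral>\<^sup>+x. f (x + c) \<partial>lborel) = (\<integral>\<^sup>+x. f x \<partial>lborel)"
  using nn_integral_distr[of "(+) c" lborel borel f] assms
      by (simp add: lborel_distr_plus add.commute)

text \<open>What Fubini's theorem needs in order to exchange the mean over the segment from \<open>x\<close> to
  \<open>x + z\<close> with the integral in \<open>x\<close>.\<close>

lemma integrable_segment:
  fixes G :: "'a::euclidean_space \<Rightarrow> real"
  assumes "integrable lborel G"
  shows "integrable (lborel \<Otimes>\<^sub>M lborel) (\<lambda>(x, t). indicator {0..1} t * G (x + t *\<^sub>R z))"
proof (rule integrableI_bounded)
  have [measurable]: "G \<in> borel_measurable borel" using assms by simp
  show "(\<lambda>(x, t). indicator {0..1} t * G (x + t *\<^sub>R z)) \<in> borel_measurable (lborel \<Otimes>\<^sub>M lborel)"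
    by measurable
  have "(\<integral>\<^sup>+ p. ennreal (norm (case p of (x, t) \<Rightarrow> indicator {0..1} t * G (x + t *\<^sub>R z))) \<partial>(lborel
      \<Otimes>\<^sub>M lborel))
      = (\<integral>\<^sup>+ t. \<integral>\<^sup>+ x. ennreal (norm (indicator {0..1} t * G (x + t *\<^sub>R z))) \<partial>lborel \<partial>lborel)"
    by (subst lborel_pair.nn_integral_snd[symmetric]) (auto simp: case_prod_unfold)
  also have "\<dots> = (\<integral>\<^sup>+ t. indicator {0..1} t * (\<integral>\<^sup>+ x. ennreal \<bar>G (x + t *\<^sub>R z)\<bar> \<partial>lborel) \<partial>lborel)"
    by (subst nn_integral_cmult[symmetric])
      (auto simp: indicator_def abs_mult intro!: nn_integral_cong)
  also have "\<dots> = (\<integral>\<^sup>+ t. indicator {0..1::real} t * (\<integral>\<^sup>+ x. ennreal \<bar>G x\<bar> \<partial>lborel) \<partial>lborel)"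
    by (subst lborel_nn_integral_translate) auto
  also have "\<dots> = (\<integral>\<^sup>+ x. ennreal \<bar>G x\<bar> \<partial>lborel)"
    by (simp add: nn_integral_multc)
  also have "\<dots> < \<infinity>" using assms by (simp add: integrable_iff_bounded)
  finally show "(\<integral>\<^sup>+ p. ennreal (norm (case p of (x, t) \<Rightarrow> indicator {0..1} t * G (x + t *\<^sub>R z)))
    \<partial>(lborel \<Otimes>\<^sub>M lborel)) < \<infinity>" .
qed

definition segment_mean :: "('a::euclidean_space \<Rightarrow> real) \<Rightarrow> 'a \<Rightarrow> 'a \<Rightarrow> real"
  where "segment_mean G z x = (\<integral>t. indicator {0..1} t * G (x + t *\<^sub>R z) \<partial>lborel)"

lemma integrable_segment_mean:
  fixes G :: "'a::euclidean_space \<Rightarrow> real"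
  assumes "integrable lborel G"
  shows "integrable lborel (segment_mean G z)"
  using lborel_pair.integrable_fst'[OF integrable_segment[OF assms, of z]]
  unfolding segment_mean_def by simp

lemma AE_integrable_segment:
  fixes G :: "'a::euclidean_space \<Rightarrow> real"
  assumes "integrable lborel G"
  shows "AE x in lborel. integrable lborel (\<lambda>t. indicator {0..1} t * G (x + t *\<^sub>R z))"
  using lborel_pair.AE_integrable_fst'[OF integrable_segment[OF assms, of z]] by simp

lemma integral_mult_segment_mean:
  fixes G :: "'a::euclidean_space \<Rightarrow> real"
  assumes G: "integrable lborel G" and g: "g \<in> borel_measurable borel" "\<And>x. \<bar>g x\<bar> \<le> C"
  shows "(\<integral>x. G x * segment_mean g z x \<partial>lborel)
    = (\<integral>t. indicator {0..1} t * (\<integral>x. G x * g (x + t *\<^sub>R z) \<partial>lborel) \<partial>lborel)"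
proof -
  have [measurable]: "G \<in> borel_measurable borel" "g \<in> borel_measurable borel" using assms
      by simp_all
  have "integrable (lborel \<Otimes>\<^sub>M lborel) (\<lambda>p. g (fst p + snd p *\<^sub>R z) * (case p of (x, t) \<Rightarrow>
      indicator {0..1} t * G (x + t *\<^sub>R 0)))"
    by (rule integrable_bounded_mult[OF integrable_segment[OF G]]) (use g in auto)
  then have i2: "integrable (lborel \<Otimes>\<^sub>M lborel) (\<lambda>(x, t). indicator {0..1} t * (G x * g (x + t
      *\<^sub>R z)))"
    by (simp add: case_prod_unfold mult_ac)
  have "(\<integral>x. G x * segment_mean g z x \<partial>lborel)
      = (\<integral>x. (\<integral>t. indicator {0..1} t * (G x * g (x + t *\<^sub>R z)) \<partial>lborel) \<partial>lborel)"
    unfolding segment_mean_def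
    by (rule Bochner_Integration.integral_cong[OF refl])
      (simp flip: integral_mult_right_zero add: mult.left_commute)
  also have "\<dots> = (\<integral>t. (\<integral>x. indicator {0..1} t * (G x * g (x + t *\<^sub>R z)) \<partial>lborel) \<partial>lborel)"
    by (rule lborel_pair.Fubini_integral[OF i2, symmetric])
  finally show ?thesis by simp
qed

lemma integral_segment_mean_mult:
  fixes G :: "'a::euclidean_space \<Rightarrow> real"
  assumes G: "integrable lborel G" and g: "g \<in> borel_measurable borel" "\<And>x. \<bar>g x\<bar> \<le> C"
  shows "(\<integral>x. segment_mean G z x * g x \<partial>lborel) = (\<integral>x. G x * segment_mean g (- z) x \<partial>lborel)"
proof -
  have [measurable]: "G \<in> borel_measurable borel" "g \<in> borel_measurable borel" using assms
      by simp_all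
  have "integrable (lborel \<Otimes>\<^sub>M lborel) (\<lambda>p. g (fst p) * (case p of (x, t) \<Rightarrow> indicator {0..1} t *
      G (x + t *\<^sub>R z)))"
    by (rule integrable_bounded_mult[OF integrable_segment[OF G]]) (use g in auto)
  then have i1: "integrable (lborel \<Otimes>\<^sub>M lborel) (\<lambda>(x, t). indicator {0..1} t * (G (x + t *\<^sub>R z) *
      g x))"
    by (simp add: case_prod_unfold mult_ac)
  have "(\<integral>x. segment_mean G z x * g x \<partial>lborel)
      = (\<integral>x. (\<integral>t. indicator {0..1} t * (G (x + t *\<^sub>R z) * g x) \<partial>lborel) \<partial>lborel)"
    unfolding segment_mean_def
    by (rule Bochner_Integration.integral_cong[OF refl])
      (simp flip: integral_mult_left_zero add: mult.assoc)
  also have "\<dots> = (\<integral>t. (\<integral>x. indicator {0..1} t * (G (x + t *\<^sub>R z) * g x) \<partial>lborel) \<partial>lborel)"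
    by (rule lborel_pair.Fubini_integral[OF i1, symmetric])
  also have "\<dots> = (\<integral>t. indicator {0..1} t * (\<integral>x. G x * g (x + t *\<^sub>R (- z)) \<partial>lborel) \<partial>lborel)"
  proof (rule Bochner_Integration.integral_cong[OF refl])
    fix t :: real
    show "(\<integral>x. indicator {0..1} t * (G (x + t *\<^sub>R z) * g x) \<partial>lborel)
        = indicator {0..1} t * (\<integral>x. G x * g (x + t *\<^sub>R (- z)) \<partial>lborel)"
      using lborel_integral_translate(1)[of "\<lambda>x. indicator {0..1} t * (G x * g (x - t *\<^sub>R z))"
          "t *\<^sub>R z"]
      by simp
  qed
  also have "\<dots> = (\<integral>x. G x * segment_mean g (- z) x \<partial>lborel)"
    by (rule integral_mult_segment_mean[OF assms, symmetric])
  finally show ?thesis .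
qed

lemma segment_mean_derivative:
  assumes "smooth_on UNIV f"
  shows "f (x + z) - f x = segment_mean (\<lambda>y. frechet_derivative f (at y) z) z x"
proof -
  have "(\<integral>t. indicator {0..1} t *\<^sub>R frechet_derivative f (at (x + t *\<^sub>R z)) z \<partial>lborel)
      = f (x + 1 *\<^sub>R z) - f (x + 0 *\<^sub>R z)"
  proof (rule integral_FTC_atLeastAtMost)
    show "((\<lambda>t. f (x + t *\<^sub>R z)) has_vector_derivative frechet_derivative f (at (x + t *\<^sub>R z)) z)
        (at t within {0..1})" for t
      using DERIV_along_line[OF assms]
      by (simp add: has_real_derivative_iff_has_vector_derivative has_vector_derivative_at_within)
    have c: "continuous_on UNIV (\<lambda>y. frechet_derivative f (at y) z)"
      by (rule smooth_on_continuous[OF smooth_on_derivative[OF open_UNIV assms]])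
    show "continuous_on {0..1} (\<lambda>t. frechet_derivative f (at (x + t *\<^sub>R z)) z)"
      by (rule continuous_on_compose2[OF c]) (auto intro!: continuous_intros)
  qed simp
  then show ?thesis by (simp add: segment_mean_def)
qed

lemma frechet_derivative_eq_partials:
  assumes "smooth_on UNIV f"
  shows "frechet_derivative f (at x) z = (\<Sum>i\<in>UNIV. z $ i * partial i f x)"
proof -
  have "linear (frechet_derivative f (at x))"
    using smooth_on_has_derivative[OF assms] has_derivative_linear by blast
  note lin = this
  have "z = (\<Sum>i\<in>UNIV. (z $ i) *\<^sub>R axis i 1)"
    by (simp add: vec_eq_iff axis_def if_distrib sum.delta cong: if_cong)
  then have "frechet_derivative f (at x) z = frechet_derivative f (at x) (\<Sum>i\<in>UNIV. (z $ i) *\<^sub>R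
      axis i 1)"
    by simp
  also have "\<dots> = (\<Sum>i\<in>UNIV. z $ i * partial i f x)"
    by (simp add: linear_sum[OF lin] linear_scale[OF lin] partial_def)
  finally show ?thesis .
qed

text \<open>The integral of \<open>g(x + z) - g(x)\<close> vanishes by translation invariance, and this difference is
  the mean of the derivative over a segment, whose integral is that of the derivative.\<close>

lemma integral_partial_test:
  assumes "g \<in> test_functions UNIV" shows "(\<integral>x. partial i g x \<partial>lborel) = 0"
proof -
  let ?z = "axis i (1::real)"
  have g: "smooth_on UNIV g" by (rule test_functions_smooth[OF assms])
  have int: "integrable lborel (partial i g)"
    by (rule test_functions_integrable[OF test_functions_partial[OF assms]])
  have "0 = (\<integral>x. g (x + ?z) - g x \<partial>lborel)"
    using lborel_integral_translate[of g ?z] test_functions_integrable[OF assms] by simp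
  also have "\<dots> = (\<integral>x. segment_mean (partial i g) ?z x * 1 \<partial>lborel)"
    using segment_mean_derivative[OF g, of _ ?z] by (simp add: partial_def[abs_def])
  also have "\<dots> = (\<integral>x. partial i g x * segment_mean (\<lambda>x. 1) (- ?z) x \<partial>lborel)"
    by (rule integral_segment_mean_mult[OF int, of _ 1]) auto
  also have "\<dots> = (\<integral>x. partial i g x \<partial>lborel)"
    by (simp add: segment_mean_def)
  finally show ?thesis by simp
qed

lemma integration_by_parts:
  assumes "g \<in> test_functions UNIV" "smooth_on UNIV f"
  shows "(\<integral>x. f x * partial i g x \<partial>lborel) = - (\<integral>x. partial i f x * g x \<partial>lborel)"
proof -
  have g: "smooth_on UNIV g" by (rule test_functions_smooth[OF assms(1)])
  have t: "(\<lambda>x. g x * f x) \<in> test_functions UNIV" "(\<lambda>x. partial i g x * f x) \<in> test_functions UNIV"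
    "(\<lambda>x. g x * partial i f x) \<in> test_functions UNIV"
    using assms test_functions_mult test_functions_partial smooth_partial by blast+
  have "0 = (\<integral>x. partial i g x * f x + g x * partial i f x \<partial>lborel)"
    using integral_partial_test[OF t(1), of i] by (simp add: partial_mult[OF g assms(2)])
  also have "\<dots> = (\<integral>x. f x * partial i g x \<partial>lborel) + (\<integral>x. partial i f x * g x \<partial>lborel)"
    using test_functions_integrable[OF t(2)] test_functions_integrable[OF t(3)]
        by (simp add: mult.commute)
  finally show ?thesis by simp
qed

lemma integration_by_parts_iterated:
  assumes "g \<in> test_functions UNIV" "smooth_on UNIV f"
  shows "(\<integral>x. f x * foldr partial is g x \<partial>lborel) = (-1) ^ length is * (\<integral>x. foldr partial is f x
      * g x \<partial>lborel)"
  using assms(2)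
proof (induction "is" arbitrary: f)
  case (Cons i "is")
  have "(\<integral>x. f x * foldr partial (i # is) g x \<partial>lborel)
      = - (\<integral>x. partial i f x * foldr partial is g x \<partial>lborel)"
    using integration_by_parts[OF test_functions_partials[OF assms(1)] Cons.prems] by simp
  also have "\<dots> = (-1) ^ length (i # is) * (\<integral>x. foldr partial is (partial i f) x * g x \<partial>lborel)"
    using Cons.IH[OF smooth_partial[OF Cons.prems]] by simp
  finally show ?case by (simp add: partial_partials_commute[OF Cons.prems])
qed simp


section \<open>A locally integrable function is determined by its regular distribution\<close>

text \<open>By Dynkin's theorem the integral over every Borel set vanishes, in particular over the sets
  where \<open>g\<close> is positive and where it is negative.\<close>

lemma integrable_zero_boxes_imp_AE_zero:
  fixes g :: "'a::euclidean_space \<Rightarrow> real"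
  assumes g: "integrable lborel g" and box: "\<And>a b. (\<integral>x. indicator (box a b) x * g x \<partial>lborel) = 0"
    and UN: "(\<integral>x. g x \<partial>lborel) = 0"
  shows "AE x in lborel. g x = 0"
proof -
  have [measurable]: "g \<in> borel_measurable borel" using g by simp
  have int: "integrable lborel (\<lambda>x. indicator A x * g x)" if "A \<in> sets borel" for A
    using integrable_mult_indicator[OF _ g, of A] that by simp
  have Z: "(\<integral>x. indicator A x * g x \<partial>lborel) = 0" if A: "A \<in> sets borel" for A
  proof -
    let ?G = "range (\<lambda>(a, b). box a b :: 'a set)"
    have sets: "sets borel = sigma_sets UNIV ?G" by (simp add: borel_eq_box)
    have "Int_stable ?G" by (force simp: Int_stable_def box_Int_box)
    moreover have "?G \<subseteq> Pow UNIV" by simp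
    moreover have "A \<in> sigma_sets UNIV ?G" using A unfolding sets .
    ultimately show ?thesis
    proof (induction rule: sigma_sets_induct_disjoint)
      case (basic A)
      then show ?case using box by auto
    next
      case (compl A)
      have "(\<lambda>x. indicator (UNIV - A) x * g x) = (\<lambda>x. g x - indicator A x * g x)"
        by (auto simp: indicator_def fun_eq_iff)
      then show ?case using compl int[of A] g UN sets by simp
    next
      case (union A)
      have A: "A i \<in> sets lborel" for i using union(2) sets by auto
      have "(LINT x:(\<Union>i. A i)|lborel. g x) = (\<Sum>i. LINT x:A i|lborel. g x)"
      proof (rule lebesgue_integral_countable_add)
        show "set_integrable lborel (\<Union>i. A i) g"
          using int[of "\<Union>i. A i"] A by (simp add: set_integrable_def)
      qed (use A union(1) in \<open>auto simp: disjoint_family_on_def\<close>)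
      then show ?case using union(3) by (simp add: set_lebesgue_integral_def)
    qed (use box in auto)
  qed
  have "AE x in lborel. indicator {x. 0 < g x} x * g x = 0"
  proof (subst integral_nonneg_eq_0_iff_AE[symmetric])
    have m: "{x. 0 < g x} \<in> sets borel" by measurable
    show "integrable lborel (\<lambda>x. indicator {x. 0 < g x} x * g x)" using int[OF m] by simp
    show "(\<integral>x. indicator {x. 0 < g x} x * g x \<partial>lborel) = 0" using Z[OF m] by simp
  qed (auto simp: indicator_def)
  moreover have "AE x in lborel. indicator {x. g x < 0} x * - g x = 0"
  proof (subst integral_nonneg_eq_0_iff_AE[symmetric])
    have m: "{x. g x < 0} \<in> sets borel" by measurable
    show "integrable lborel (\<lambda>x. indicator {x. g x < 0} x * - g x)" using int[OF m] by simp
    show "(\<integral>x. indicator {x. g x < 0} x * - g x \<partial>lborel) = 0" using Z[OF m] by simp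
  qed (auto simp: indicator_def)
  ultimately show ?thesis
    by eventually_elim (auto simp: indicator_def split: if_splits)
qed

lemma box_bump:
  fixes a b :: "real^'n::finite"
  assumes "cbox a b \<subseteq> \<Omega>"
  obtains \<phi> :: "nat \<Rightarrow> real^'n \<Rightarrow> real" where "\<And>n. \<phi> n \<in> test_functions \<Omega>" "\<And>n x. 0 \<le> \<phi> n x \<and> \<phi> n x
      \<le> indicator (cbox a b) x"
    "\<And>x. (\<lambda>n. \<phi> n x) \<longlonglongrightarrow> indicator (box a b) x"
proof -
  define \<phi> where "\<phi> n x = (\<Prod>i\<in>UNIV. smooth_step (real n * (x $ i - a $ i)) * smooth_step (real n
      * (b $ i - x $ i)))"
    for n and x :: "real^'n"
  have sm: "smooth_on UNIV (\<phi> n)" for n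
  proof -
    have c: "smooth_on UNIV (\<lambda>x::real^'n. x $ i)" for i
      by (intro smooth_on_bounded_linear open_UNIV bounded_linear_vec_nth)
    show ?thesis
      unfolding \<phi>_def
      by (intro smooth_on_prod smooth_on_mult open_UNIV smooth_on_compose[OF open_UNIV open_UNIV
          _ _ smooth_smooth_step]
          smooth_on_const smooth_on_diff c) auto
  qed
  have zero: "\<phi> n x = 0" if "x \<notin> box a b" for n x
  proof -
    obtain i where "x $ i \<le> a $ i \<or> b $ i \<le> x $ i" using \<open>x \<notin> box a b\<close>
        by (auto simp: mem_box_cart not_less)
    then have "smooth_step (real n * (x $ i - a $ i)) * smooth_step (real n * (b $ i - x $ i)) = 0"
      by (auto simp: smooth_step_0 mult_nonneg_nonpos)
    then show ?thesis unfolding \<phi>_def by (meson UNIV_I finite_class.finite_UNIV prod_zero)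
  qed
  have bounds: "0 \<le> \<phi> n x" "\<phi> n x \<le> 1" for n x
    unfolding \<phi>_def
    by (auto intro!: prod_nonneg prod_le_1 mult_nonneg_nonneg mult_le_one smooth_step_bounds)
  show ?thesis
  proof (rule that)
    show "\<phi> n \<in> test_functions \<Omega>" for n
      by (rule test_functionsI[OF sm compact_cbox assms]) (use zero box_subset_cbox in blast)
    show "0 \<le> \<phi> n x \<and> \<phi> n x \<le> indicator (cbox a b) x" for n x
      using bounds[of n x] zero[of x n] box_subset_cbox[of a b] by (auto simp: indicator_def)
    show "(\<lambda>n. \<phi> n x) \<longlonglongrightarrow> indicator (box a b) x" for x
    proof (cases "x \<in> box a b")
      case True
      have ev: "\<forall>\<^sub>F n in sequentially. smooth_step (real n * d) = 1" if "0 < d" for d :: real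
      proof -
        have "\<forall>\<^sub>F n in sequentially. 1 / d \<le> real n"
            using filterlim_real_sequentially by (simp add: filterlim_at_top)
        then show ?thesis
          by eventually_elim (use that in \<open>auto intro!: smooth_step_1 simp: field_simps\<close>)
      qed
      have "\<forall>\<^sub>F n in sequentially. \<forall>i\<in>UNIV. smooth_step (real n * (x $ i - a $ i)) * smooth_step
          (real n * (b $ i - x $ i)) = 1"
      proof (rule eventually_ball_finite, simp, rule ballI)
        fix i :: 'n
        have "0 < x $ i - a $ i" "0 < b $ i - x $ i" using True by (auto simp: mem_box_cart)
        from ev[OF this(1)] ev[OF this(2)]
        show "\<forall>\<^sub>F n in sequentially. smooth_step (real n * (x $ i - a $ i)) * smooth_step (real n
            * (b $ i - x $ i)) = 1"
          by eventually_elim simp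
      qed
      then have "\<forall>\<^sub>F n in sequentially. 1 = \<phi> n x"
        by eventually_elim (simp add: \<phi>_def)
      then have "(\<lambda>n. \<phi> n x) \<longlonglongrightarrow> 1" by (rule Lim_transform_eventually[OF tendsto_const])
      then show ?thesis using True by simp
    qed (simp add: zero)
  qed
qed

text \<open>Indicators of boxes are dominated limits of test functions, and boxes generate the Borel
  sets.\<close>

lemma fundamental_lemma_of_variations:
  fixes h :: "real^'n::finite \<Rightarrow> real"
  assumes \<Omega>: "open \<Omega>" and h: "locally_integrable_on \<Omega> h"
    and zero: "\<And>\<phi>. \<phi> \<in> test_functions \<Omega> \<Longrightarrow> (LINT x:\<Omega>|lborel. h x * \<phi> x) = 0"
  shows "AE x in lborel. x \<in> \<Omega> \<longrightarrow> h x = 0"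
proof -
  have box: "(\<integral>x. indicator (box a b) x * h x \<partial>lborel) = 0" if ab: "cbox a b \<subseteq> \<Omega>" for a b
  proof -
    obtain \<phi> where \<phi>: "\<And>n. \<phi> n \<in> test_functions \<Omega>" "\<And>n x. 0 \<le> \<phi> n x \<and> \<phi> n x
        \<le> indicator (cbox a b) x"
      "\<And>x. (\<lambda>n. \<phi> n x) \<longlonglongrightarrow> indicator (box a b) x"
      using box_bump[OF ab] by metis
    have hc: "integrable lborel (\<lambda>x. indicator (cbox a b) x * h x)"
      using h ab unfolding locally_integrable_on_def set_integrable_def by simp
    then have [measurable]: "(\<lambda>x. indicator (cbox a b) x * h x) \<in> borel_measurable borel" by simp
    have eq: "\<phi> n x * h x = \<phi> n x * (indicator (cbox a b) x * h x)" for n x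
      using \<phi>(2)[of n x] by (cases "x \<in> cbox a b") auto
    have eq': "indicator (box a b) x * h x = indicator (box a b) x * (indicator (cbox a b) x * h
        x)" for x
      using box_subset_cbox[of a b] by (auto simp: indicator_def)
    have [measurable]: "\<phi> n \<in> borel_measurable borel" for n
      using \<phi>(1) smooth_borel test_functions_smooth by blast
    have "(\<lambda>n. \<integral>x. \<phi> n x * h x \<partial>lborel) \<longlonglongrightarrow> (\<integral>x. indicator (box a b) x * h x \<partial>lborel)"
    proof (rule integral_dominated_convergence)
      show "(\<lambda>x. indicator (box a b) x * h x) \<in> borel_measurable lborel"
        unfolding eq' by measurable
      show "(\<lambda>x. \<phi> n x * h x) \<in> borel_measurable lborel" for n
        unfolding eq by measurable
      show "integrable lborel (\<lambda>x. \<bar>indicator (cbox a b) x * h x\<bar>)" using hc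
          by (rule integrable_abs)
      show "AE x in lborel. norm (\<phi> n x * h x) \<le> \<bar>indicator (cbox a b) x * h x\<bar>" for n
      proof (rule AE_I2)
        fix x show "norm (\<phi> n x * h x) \<le> \<bar>indicator (cbox a b) x * h x\<bar>"
          using \<phi>(2)[of n x] mult_right_mono[of "\<phi> n x" "indicator (cbox a b) x" "\<bar>h x\<bar>"]
              by (auto simp: abs_mult)
      qed
      show "AE x in lborel. (\<lambda>n. \<phi> n x * h x) \<longlonglongrightarrow> indicator (box a b) x * h x"
        by (rule AE_I2) (intro tendsto_mult_right \<phi>(3))
    qed
    moreover have "(\<integral>x. \<phi> n x * h x \<partial>lborel) = 0" for n
    proof -
      have "(\<integral>x. \<phi> n x * h x \<partial>lborel) = (LINT x:\<Omega>|lborel. h x * \<phi> n x)"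
        unfolding set_lebesgue_integral_def
        by (intro Bochner_Integration.integral_cong refl)
          (use \<phi>(1) test_functions_outside in \<open>fastforce simp: indicator_def\<close>)
      then show ?thesis using zero[OF \<phi>(1)] by simp
    qed
    ultimately show ?thesis by (simp add: LIMSEQ_const_iff)
  qed
  obtain \<D> where \<D>: "countable \<D>" "\<D> \<subseteq> Pow \<Omega>" "\<And>X. X \<in> \<D> \<Longrightarrow> \<exists>a b. X = cbox a b" "\<Union>\<D> = \<Omega>"
    using open_countable_Union_open_cbox[OF \<Omega>] by metis
  have "AE x in lborel. x \<in> X \<longrightarrow> h x = 0" if X: "X \<in> \<D>" for X
  proof -
    obtain a b where ab: "X = cbox a b" "cbox a b \<subseteq> \<Omega>" using \<D> X by blast
    have hc: "integrable lborel (\<lambda>x. indicator (cbox a b) x * h x)"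
      using h ab unfolding locally_integrable_on_def set_integrable_def by simp
    then have hb: "integrable lborel (\<lambda>x. indicator (box a b) x * (indicator (cbox a b) x * h x))"
      using integrable_mult_indicator[OF _ hc, of "box a b"] by simp
    have eq': "indicator (box a b) x * (indicator (cbox a b) x * h x)
        = indicator (box a b) x * h x" for x
      using box_subset_cbox[of a b] by (auto simp: indicator_def)
    have "AE x in lborel. indicator (box a b) x * h x = 0"
    proof (rule integrable_zero_boxes_imp_AE_zero)
      show "integrable lborel (\<lambda>x. indicator (box a b) x * h x)" using hb unfolding eq' .
      show "(\<integral>x. indicator (box a b) x * h x \<partial>lborel) = 0" by (rule box[OF ab(2)])
      fix c d :: "real^'n"
      obtain a' b' where e: "box c d \<inter> box a b = box a' b'" using box_Int_box by blast
      have "(\<integral>x. indicator (box a' b') x * h x \<partial>lborel) = 0"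
      proof (cases "box a' b' = {}")
        case False
        then have "box a' b' \<subseteq> box a b" using e by blast
        with False have "cbox a' b' \<subseteq> cbox a b" 
          unfolding subset_box box_ne_empty by (simp add: less_imp_le)
        then show ?thesis using box ab by blast
      qed simp
      then show "(\<integral>x. indicator (box c d) x * (indicator (box a b) x * h x) \<partial>lborel) = 0"
        by (simp flip: e add: indicator_inter_arith mult.assoc)
    qed
    moreover have "cbox a b - box a b \<in> null_sets lborel"
      using negligible_frontier_interval[of a b]
      by (simp add: negligible_iff_null_sets null_sets_completion_iff)
    then have "AE x in lborel. x \<notin> cbox a b - box a b" by (rule AE_not_in)
    ultimately show ?thesis unfolding ab(1)
      by eventually_elim (auto simp: indicator_def split: if_splits)
  qed
  then have "AE x in lborel. \<forall>X\<in>\<D>. x \<in> X \<longrightarrow> h x = 0"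
    by (subst AE_ball_countable[OF \<D>(1)]) blast
  then show ?thesis by eventually_elim (use \<D>(4) in blast)
qed

section \<open>Estimates for the Slobodeckij double integral\<close>

text \<open>A substitute for the triangle inequality at the level of \<open>p\<close>-th powers, where all estimates
  are done; the size of the constant is immaterial.\<close>

lemma powr_abs_sum_le:
  fixes a :: "'i \<Rightarrow> real"
  assumes "finite I" "0 < p"
  shows "\<bar>\<Sum>i\<in>I. a i\<bar> powr p \<le> real (card I) powr p * (\<Sum>i\<in>I. \<bar>a i\<bar> powr p)"
proof (cases "I = {}")
  case False
  have "Max ((\<lambda>i. \<bar>a i\<bar>) ` I) \<in> (\<lambda>i. \<bar>a i\<bar>) ` I" using assms(1) False by (intro Max_in) auto
  then obtain k where k: "k \<in> I" "Max ((\<lambda>i. \<bar>a i\<bar>) ` I) = \<bar>a k\<bar>" by auto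
  have "\<bar>a i\<bar> \<le> \<bar>a k\<bar>" if "i \<in> I" for i
    using that assms(1) k(2) by (metis Max_ge finite_imageI imageI)
  then have "\<bar>\<Sum>i\<in>I. a i\<bar> \<le> real (card I) * \<bar>a k\<bar>"
    by (intro order_trans[OF sum_abs] sum_bounded_above) auto
  then have "\<bar>\<Sum>i\<in>I. a i\<bar> powr p \<le> (real (card I) * \<bar>a k\<bar>) powr p"
    using assms(2) by (intro powr_mono2) auto
  also have "\<dots> = real (card I) powr p * \<bar>a k\<bar> powr p" by (simp add: powr_mult)
  also have "\<dots> \<le> real (card I) powr p * (\<Sum>i\<in>I. \<bar>a i\<bar> powr p)"
    using member_le_sum[of k I "\<lambda>i. \<bar>a i\<bar> powr p"] k(1) assms(1) by (intro mult_left_mono) auto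
  finally show ?thesis .
qed (use assms in auto)

lemma powr_abs_add_le:
  fixes a b :: real
  assumes "0 < p" shows "\<bar>a + b\<bar> powr p \<le> 2 powr p * (\<bar>a\<bar> powr p + \<bar>b\<bar> powr p)"
  using powr_abs_sum_le[of "UNIV :: bool set" p "\<lambda>i. if i then a else b"] assms
  by (simp add: UNIV_bool add.commute)

definition power_integral :: "real \<Rightarrow> (real^'n::finite \<Rightarrow> real) \<Rightarrow> ennreal"
  where "power_integral p f = (\<integral>\<^sup>+x. ennreal (\<bar>f x\<bar> powr p) \<partial>lborel)"

text \<open>The \<open>p\<close>-th power of the Slobodeckij seminorm over the whole space.\<close>

definition gagliardo :: "real \<Rightarrow> real \<Rightarrow> (real^'n::finite \<Rightarrow> real) \<Rightarrow> ennreal"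
  where "gagliardo \<theta> p f = (\<integral>\<^sup>+z. ennreal (\<bar>f (fst z) - f (snd z)\<bar> powr p /
        norm (fst z - snd z) powr (real CARD('n) + \<theta> * p)) \<partial>(lborel \<Otimes>\<^sub>M lborel))"

text \<open>The factor \<open>min |z| 1\<close> comes from a Lipschitz bound for small and a trivial bound for large
  increments; it makes the singular kernel integrable.\<close>

definition slob_weight :: "real \<Rightarrow> real \<Rightarrow> real^'n::finite \<Rightarrow> real"
  where "slob_weight \<theta> p z = min (norm z) 1 powr p / norm z powr (real CARD('n) + \<theta> * p)"

lemma nn_integral_le_balls:
  fixes g :: "'a::euclidean_space \<Rightarrow> real"
  assumes "\<And>z. g z \<noteq> 0 \<Longrightarrow> \<exists>j. norm z < R j \<and> g z \<le> c j"
    and "\<And>j::nat. 0 \<le> c j" "\<And>j. 0 \<le> R j"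
    and "summable (\<lambda>j. c j * R j ^ DIM('a))"
  shows "(\<integral>\<^sup>+z. ennreal (g z) \<partial>lborel) < \<infinity>"
proof -
  let ?V = "unit_ball_vol (real DIM('a))"
  have "ennreal (g z) \<le> (\<Sum>j. ennreal (c j) * indicator (ball 0 (R j)) z)" for z
  proof (cases "g z = 0")
    case False
    then obtain j where j: "norm z < R j" "g z \<le> c j" using assms(1) by blast
    have "ennreal (g z) \<le> ennreal (c j) * indicator (ball 0 (R j)) z"
      using j by (simp add: indicator_def ennreal_leI)
    also have "\<dots> \<le> (\<Sum>j. ennreal (c j) * indicator (ball 0 (R j)) z)"
      using sum_le_suminf[of "\<lambda>j. ennreal (c j) * indicator (ball 0 (R j)) z" "{j}"]
      by (simp only: sum.insert finite.emptyI empty_iff not_False_eq_True sum.empty add_0_right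
          summableI finite.insertI zero_le simp_thms)
    finally show ?thesis .
  qed simp
  then have "(\<integral>\<^sup>+z. ennreal (g z) \<partial>lborel) \<le> (\<integral>\<^sup>+z. (\<Sum>j. ennreal (c j) * indicator (ball 0 (R j))
      z) \<partial>(lborel::'a measure))"
    by (intro nn_integral_mono)
  also have "\<dots> = (\<Sum>j. \<integral>\<^sup>+z. ennreal (c j) * indicator (ball 0 (R j)) z \<partial>(lborel::'a measure))"
  proof (rule nn_integral_suminf)
    fix j
    have [measurable]: "ball 0 (R j) \<in> sets (borel :: 'a measure)" by simp
    show "(\<lambda>z. ennreal (c j) * indicator (ball 0 (R j)) z)
        \<in> borel_measurable (lborel :: 'a measure)"
      by measurable
  qed
  also have "\<dots> = (\<Sum>j. ennreal (?V * (c j * R j ^ DIM('a))))"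
  proof (rule suminf_cong)
    fix j
    have "(\<integral>\<^sup>+z. ennreal (c j) * indicator (ball 0 (R j)) z \<partial>(lborel::'a measure))
        = ennreal (c j) * ennreal (?V * R j ^ DIM('a))"
      using assms(3) by (simp add: nn_integral_cmult_indicator emeasure_ball)
    also have "\<dots> = ennreal (?V * (c j * R j ^ DIM('a)))"
      using assms(2)[of j] by (simp add: ennreal_mult'[symmetric] mult_ac)
    finally show "(\<integral>\<^sup>+z. ennreal (c j) * indicator (ball 0 (R j)) z \<partial>(lborel::'a measure))
        = ennreal (?V * (c j * R j ^ DIM('a)))" .
  qed
  also have "\<dots> < \<infinity>"
    using assms(2,3,4) by (subst suminf_ennreal2) (auto intro!: summable_mult mult_nonneg_nonneg)
  finally show ?thesis .
qed

text \<open>On the dyadic shell of radius \<open>2\<^sup>-\<^sup>j\<close> the volume cancels the factor \<open>|z|\<^sup>-\<^sup>n\<close>. What remains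
  is a geometric series of ratio \<open>2\<close> to the power \<open>- p (1 - \<theta>)\<close> at the origin and \<open>- \<theta> p\<close> at
  infinity.\<close>

lemma slob_weight_integrable:
  assumes "0 < \<theta>" "\<theta> < 1" "1 < p"
  obtains A where "(\<integral>\<^sup>+z. ennreal (slob_weight \<theta> p (z :: real^'n::finite)) \<partial>lborel) = ennreal A"
      "0 \<le> A"
proof -
  let ?n = "CARD('n)"
  have small: "(\<integral>\<^sup>+z. ennreal (slob_weight \<theta> p (z :: real^'n) * indicator (ball 0 1) z) \<partial>lborel)
      < \<infinity>"
  proof (rule nn_integral_le_balls[where R = "\<lambda>j. (1/2) ^ j" and c =
      "\<lambda>j. (2 ^ Suc j) ^ ?n * ((1/2) ^ j) powr (p * (1 - \<theta>))"])
    fix z :: "real^'n" assume *: "slob_weight \<theta> p z * indicator (ball 0 1) z \<noteq> 0"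
    then have z: "0 < norm z" "norm z < 1" by (auto simp: slob_weight_def indicator_def split:
        if_splits)
    \<comment> \<open>\<open>j\<close> is the index of the dyadic shell of \<open>z\<close>.\<close>
    obtain k where "(1/2) ^ k < norm z" using real_arch_pow_inv[OF z(1), of "1/2"] by auto
    moreover have "(1/2::real) ^ Suc k \<le> (1/2) ^ k" by simp
    ultimately have ex: "\<exists>k. (1/2) ^ Suc k \<le> norm z"
      by (intro exI[of _ k]) linarith
    define j where "j = (LEAST k. (1/2) ^ Suc k \<le> norm z)"
    have j1: "(1/2) ^ Suc j \<le> norm z" unfolding j_def by (rule LeastI_ex[OF ex])
    have j2: "norm z < (1/2) ^ j"
    proof (cases j)
      case (Suc i)
      then have "\<not> (1/2) ^ Suc i \<le> norm z" using not_less_Least[of i "\<lambda>k. (1/2) ^ Suc k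
          \<le> norm z"] j_def by simp
      then show ?thesis using Suc by simp
    qed (use z in simp)
    have "slob_weight \<theta> p z * indicator (ball 0 1) z = norm z powr (p - (real ?n + \<theta> * p))"
      using z by (simp add: slob_weight_def powr_diff)
    also have "\<dots> = (1 / norm z ^ ?n) * norm z powr (p * (1 - \<theta>))"
      using z by (simp add: powr_realpow[symmetric] powr_minus_divide[symmetric]
          powr_add[symmetric] algebra_simps)
    also have "\<dots> \<le> (2 ^ Suc j) ^ ?n * ((1/2) ^ j) powr (p * (1 - \<theta>))"
    proof (intro mult_mono)
      have "1 / norm z \<le> 2 ^ Suc j" using j1 z by (simp add: field_simps power_one_over)
      then have "(1 / norm z) ^ ?n \<le> (2 ^ Suc j) ^ ?n" by (intro power_mono) auto
      then show "1 / norm z ^ ?n \<le> (2 ^ Suc j) ^ ?n" by (simp add: power_divide)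
      show "norm z powr (p * (1 - \<theta>)) \<le> ((1/2) ^ j) powr (p * (1 - \<theta>))"
        using j2 assms by (intro powr_mono2) auto
    qed auto
    finally show "\<exists>j. norm z < (1/2) ^ j \<and> slob_weight \<theta> p z * indicator (ball 0 1) z
        \<le> (2 ^ Suc j) ^ ?n * ((1/2) ^ j) powr (p * (1 - \<theta>))"
      using j2 by blast
  next
    have eq: "(2 ^ Suc j) ^ ?n * ((1/2) ^ j) powr (p * (1 - \<theta>)) * ((1/2) ^ j) ^ ?n
        = 2 ^ ?n * ((1/2) powr (p * (1 - \<theta>))) ^ j" for j
    proof -
      have "(2::real) ^ Suc j * (1/2) ^ j = 2" by (simp add: power_one_over)
      then have "((2::real) ^ Suc j) ^ ?n * ((1/2) ^ j) ^ ?n = 2 ^ ?n"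
        by (metis power_mult_distrib)
      moreover have "((1/2::real) ^ j) powr (p * (1 - \<theta>)) = ((1/2) powr (p * (1 - \<theta>))) ^ j"
        by (simp add: powr_realpow[symmetric] powr_powr mult.commute)
      ultimately show ?thesis by (simp add: mult_ac)
    qed
    have "(1/2::real) powr (p * (1 - \<theta>)) < 1" using powr_less_mono2[of "p * (1 - \<theta>)"
        "1/2" 1] assms by simp
    then show "summable (\<lambda>j. (2 ^ Suc j) ^ ?n * ((1/2::real) ^ j) powr (p * (1 - \<theta>)) * ((1/2) ^
        j) ^ DIM(real^'n))"
      by (simp only: DIM_cart DIM_real mult_1_right eq) (intro summable_mult summable_geometric,
          simp)
  qed auto
  have large: "(\<integral>\<^sup>+z. ennreal (slob_weight \<theta> p (z :: real^'n) * indicator (- ball 0 1) z)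
      \<partial>lborel) < \<infinity>"
  proof (rule nn_integral_le_balls[where R = "\<lambda>j. 2 ^ Suc j" and c =
      "\<lambda>j. ((1/2) ^ j) ^ ?n * ((1/2) ^ j) powr (\<theta> * p)"])
    fix z :: "real^'n" assume *: "slob_weight \<theta> p z * indicator (- ball 0 1) z \<noteq> 0"
    then have z: "1 \<le> norm z" by (auto simp: indicator_def split: if_splits)
    obtain k where "norm z < 2 ^ k" using real_arch_pow[of 2 "norm z"] by auto
    then have ex: "\<exists>k. norm z < 2 ^ Suc k"
      by (intro exI[of _ k]) (simp add: less_le_trans)
    define j where "j = (LEAST k. norm z < 2 ^ Suc k)"
    have j1: "norm z < 2 ^ Suc j" unfolding j_def by (rule LeastI_ex[OF ex])
    have j2: "2 ^ j \<le> norm z"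
    proof (cases j)
      case (Suc i)
      then have "\<not> norm z < 2 ^ Suc i" using not_less_Least[of i "\<lambda>k. norm z < 2 ^ Suc k"] j_def
          by simp
      then show ?thesis using Suc by simp
    qed (use z in simp)
    have inv: "1 / norm z \<le> (1/2) ^ j"
    proof -
      have "0 < norm z * 2 ^ j" using z by (intro mult_pos_pos) auto
      then have "1 / norm z \<le> 1 / 2 ^ j" using j2 by (intro divide_left_mono) auto
      then show ?thesis by (simp add: power_one_over)
    qed
    have "slob_weight \<theta> p z * indicator (- ball 0 1) z = 1 / norm z powr (real ?n + \<theta> * p)"
      using z by (simp add: slob_weight_def)
    also have "\<dots> = (1 / norm z) ^ ?n * (1 / norm z) powr (\<theta> * p)"
    proof -
      have "0 < norm z" using z by linarith
      then have "norm z powr real ?n = norm z ^ ?n" by (rule powr_realpow)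
      then show ?thesis by (simp add: powr_add powr_divide power_divide)
    qed
    also have "\<dots> \<le> ((1/2) ^ j) ^ ?n * ((1/2) ^ j) powr (\<theta> * p)"
      using inv assms by (intro mult_mono power_mono powr_mono2) auto
    finally show "\<exists>j. norm z < 2 ^ Suc j \<and> slob_weight \<theta> p z * indicator (- ball 0 1) z
        \<le> ((1/2) ^ j) ^ ?n * ((1/2) ^ j) powr (\<theta> * p)"
      using j1 by blast
  next
    have eq: "((1/2) ^ j) ^ ?n * ((1/2) ^ j) powr (\<theta> * p) * (2 ^ Suc j) ^ ?n
        = 2 ^ ?n * ((1/2) powr (\<theta> * p)) ^ j" for j
    proof -
      have "(2::real) ^ Suc j * (1/2) ^ j = 2" by (simp add: power_one_over)
      then have "((2::real) ^ Suc j) ^ ?n * ((1/2) ^ j) ^ ?n = 2 ^ ?n"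
        by (metis power_mult_distrib)
      moreover have "((1/2::real) ^ j) powr (\<theta> * p) = ((1/2) powr (\<theta> * p)) ^ j"
        by (simp add: powr_realpow[symmetric] powr_powr mult.commute)
      ultimately show ?thesis by (simp add: mult_ac)
    qed
    have "(1/2::real) powr (\<theta> * p) < 1" using powr_less_mono2[of "\<theta> * p" "1/2" 1] assms by simp
    then show "summable (\<lambda>j. ((1/2::real) ^ j) ^ ?n * ((1/2) ^ j) powr (\<theta> * p) * (2 ^ Suc j) ^
        DIM(real^'n))"
      by (simp only: DIM_cart DIM_real mult_1_right eq) (intro summable_mult summable_geometric,
          simp)
  qed auto
  have [measurable]: "slob_weight \<theta> p \<in> borel_measurable (borel :: (real^'n) measure)"
    unfolding slob_weight_def by measurable
  have [measurable]: "ball 0 1 \<in> sets (borel :: (real^'n) measure)" by simp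
  have "(\<integral>\<^sup>+z. ennreal (slob_weight \<theta> p (z :: real^'n)) \<partial>lborel)
      = (\<integral>\<^sup>+z. ennreal (slob_weight \<theta> p (z :: real^'n) * indicator (ball 0 1) z) + ennreal
          (slob_weight \<theta> p z * indicator (- ball 0 1) z) \<partial>lborel)"
    by (intro nn_integral_cong) (simp add: indicator_def)
  also have "\<dots> < \<infinity>"
    using small large by (subst nn_integral_add) auto
  finally show ?thesis
    using that[of "enn2real (\<integral>\<^sup>+z. ennreal (slob_weight \<theta> p (z :: real^'n)) \<partial>lborel)"]
        by (simp add: less_top)
qed

lemma slob_weight_nonneg: "0 \<le> slob_weight \<theta> p z"
  and slob_weight_minus: "slob_weight \<theta> p (- z) = slob_weight \<theta> p z"
  by (auto simp: slob_weight_def)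

lemma slob_weight_borel [measurable]: "slob_weight \<theta> p \<in> borel_measurable borel"
  unfolding slob_weight_def by measurable

lemma nn_integral_difference_variables:
  fixes H :: "real^'n::finite \<Rightarrow> real^'n \<Rightarrow> ennreal"
  assumes "case_prod H \<in> borel_measurable (lborel \<Otimes>\<^sub>M lborel)"
  shows "(\<integral>\<^sup>+q. H (fst q) (snd q) \<partial>(lborel \<Otimes>\<^sub>M lborel)) = (\<integral>\<^sup>+z. \<integral>\<^sup>+x. H (x + z) x \<partial>lborel \<partial>lborel)"
proof -
  have [measurable]: "case_prod H \<in> borel_measurable (borel \<Otimes>\<^sub>M borel)" 
  proof -
    have "sets (lborel \<Otimes>\<^sub>M lborel) = sets (borel \<Otimes>\<^sub>M borel :: ((real^'n) \<times> (real^'n)) measure)"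
      by (intro sets_pair_measure_cong) auto
    from assms[unfolded measurable_cong_sets[OF this refl]] show ?thesis .
  qed
  have [measurable]: "(\<lambda>x. H x y) \<in> borel_measurable borel" for y
    using measurable_compose[of "\<lambda>x. (x, y)" borel "borel \<Otimes>\<^sub>M borel" "case_prod H" borel] by simp
  have m: "(\<lambda>q. H (fst q + snd q) (snd q)) \<in> borel_measurable (lborel \<Otimes>\<^sub>M lborel)"
    using measurable_compose[of "\<lambda>q. (fst q + snd q, snd q)" "borel \<Otimes>\<^sub>M borel" "borel \<Otimes>\<^sub>M borel"
        "case_prod H"] by simp
  have "(\<integral>\<^sup>+q. H (fst q) (snd q) \<partial>(lborel \<Otimes>\<^sub>M lborel)) = (\<integral>\<^sup>+y. \<integral>\<^sup>+x. H x y \<partial>lborel \<partial>lborel)"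
    using lborel_pair.nn_integral_snd[OF assms] by (simp add: case_prod_unfold)
  also have "\<dots> = (\<integral>\<^sup>+y. \<integral>\<^sup>+z. H (z + y) y \<partial>lborel \<partial>lborel)"
    by (subst lborel_nn_integral_translate) auto
  also have "\<dots> = (\<integral>\<^sup>+z. \<integral>\<^sup>+y. H (z + y) y \<partial>lborel \<partial>lborel)"
    using lborel_pair.Fubini'[of "\<lambda>z y. H (z + y) y"] m by (simp add: case_prod_unfold)
  finally show ?thesis by (simp add: add.commute)
qed

lemma nn_integral_weight_convolution:
  fixes w a :: "real^'n::finite \<Rightarrow> ennreal"
  assumes [measurable]: "w \<in> borel_measurable borel" "a \<in> borel_measurable borel" and
      "\<And>z. w (- z) = w z"
  shows "(\<integral>\<^sup>+q. w (fst q - snd q) * a (snd q) \<partial>(lborel \<Otimes>\<^sub>M lborel))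
      = (\<integral>\<^sup>+z. w z \<partial>lborel) * (\<integral>\<^sup>+x. a x \<partial>lborel)"
    and "(\<integral>\<^sup>+q. w (fst q - snd q) * a (fst q) \<partial>(lborel \<Otimes>\<^sub>M lborel))
        = (\<integral>\<^sup>+z. w z \<partial>lborel) * (\<integral>\<^sup>+x. a x \<partial>lborel)"
proof -
  have "(\<integral>\<^sup>+q. w (fst q - snd q) * a (snd q) \<partial>(lborel \<Otimes>\<^sub>M lborel))
      = (\<integral>\<^sup>+z. \<integral>\<^sup>+x. w z * a x \<partial>lborel \<partial>lborel)"
    by (subst nn_integral_difference_variables[of "\<lambda>x y. w (x - y) * a y"]) (auto simp:
        case_prod_unfold)
  then show "(\<integral>\<^sup>+q. w (fst q - snd q) * a (snd q) \<partial>(lborel \<Otimes>\<^sub>M lborel))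
      = (\<integral>\<^sup>+z. w z \<partial>lborel) * (\<integral>\<^sup>+x. a x \<partial>lborel)"
    by (simp add: nn_integral_cmult nn_integral_multc)
  have "(\<integral>\<^sup>+q. w (fst q - snd q) * a (fst q) \<partial>(lborel \<Otimes>\<^sub>M lborel))
      = (\<integral>\<^sup>+z. \<integral>\<^sup>+x. w z * a (x + z) \<partial>lborel \<partial>lborel)"
    by (subst nn_integral_difference_variables[of "\<lambda>x y. w (x - y) * a x"]) (auto simp:
        case_prod_unfold)
  also have "\<dots> = (\<integral>\<^sup>+z. w z * (\<integral>\<^sup>+x. a x \<partial>lborel) \<partial>lborel)"
    by (simp add: nn_integral_cmult lborel_nn_integral_translate)
  finally show "(\<integral>\<^sup>+q. w (fst q - snd q) * a (fst q) \<partial>(lborel \<Otimes>\<^sub>M lborel))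
      = (\<integral>\<^sup>+z. w z \<partial>lborel) * (\<integral>\<^sup>+x. a x \<partial>lborel)"
    by (simp add: nn_integral_multc)
qed

text \<open>For small increments by the mean value theorem, for large ones because \<open>h\<close> is bounded.\<close>

lemma test_function_increment_bound:
  assumes "h \<in> test_functions \<Omega>"
  obtains L where "0 < L" "\<And>x y. \<bar>h x - h y\<bar> \<le> L * min (norm (x - y)) 1"
proof -
  have h: "smooth_on UNIV h" by (rule test_functions_smooth[OF assms])
  obtain M where M: "0 < M" "\<And>x. \<bar>h x\<bar> \<le> M" using test_functions_bounded[OF assms] by metis
  have "\<forall>i. \<exists>N>0. \<forall>x. \<bar>partial i h x\<bar> \<le> N"
    using test_functions_bounded[OF test_functions_partial[OF assms]] by metis
  then obtain N where N: "\<And>i. 0 < N i" "\<And>i x. \<bar>partial i h x\<bar> \<le> N i" by metis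
  have lip: "\<bar>h x - h y\<bar> \<le> (\<Sum>i\<in>UNIV. N i) * norm (x - y)" for x y
  proof -
    have "\<exists>t>0. t < 1 \<and> h (y + 1 *\<^sub>R (x - y)) - h (y + 0 *\<^sub>R (x - y)) =
        (1 - 0) * frechet_derivative h (at (y + t *\<^sub>R (x - y))) (x - y)"
      by (rule MVT2) (auto intro: DERIV_along_line[OF h])
    then obtain t where "h x - h y = frechet_derivative h (at (y + t *\<^sub>R (x - y))) (x - y)" by auto
    also have "\<dots> = (\<Sum>i\<in>UNIV. (x - y) $ i * partial i h (y + t *\<^sub>R (x - y)))"
      by (rule frechet_derivative_eq_partials[OF h])
    finally have "\<bar>h x - h y\<bar> \<le> (\<Sum>i\<in>UNIV. \<bar>(x - y) $ i * partial i h (y + t *\<^sub>R (x - y))\<bar>)"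
      by (simp add: sum_abs)
    also have "\<dots> \<le> (\<Sum>i\<in>UNIV. norm (x - y) * N i)"
      unfolding abs_mult using N by (intro sum_mono mult_mono component_le_norm_cart) auto
    also have "\<dots> = (\<Sum>i\<in>UNIV. N i) * norm (x - y)"
      by (simp add: sum_distrib_right mult.commute)
    finally show ?thesis .
  qed
  have S: "0 \<le> (\<Sum>i\<in>UNIV. N i)" using N(1) by (intro sum_nonneg) (simp add: less_imp_le)
  show ?thesis
  proof (rule that[of "(\<Sum>i\<in>UNIV. N i) + 2 * M"])
    fix x y
    have b: "\<bar>h x - h y\<bar> \<le> 2 * M" using M(2)[of x] M(2)[of y] by linarith
    show "\<bar>h x - h y\<bar> \<le> ((\<Sum>i\<in>UNIV. N i) + 2 * M) * min (norm (x - y)) 1"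
    proof (cases "norm (x - y) \<le> 1")
      case True
      then show ?thesis using lip[of x y] M(1) by (simp add: min_def algebra_simps add_increasing2)
    next
      case False
      then show ?thesis using b S by (simp add: min_def)
    qed
  qed (use S M in simp)
qed

text \<open>Multiplication by a test function \<open>h\<close> of \<open>\<Omega>\<close>, followed by extension by zero: by the product
  rule for differences every pair of points, inside or outside \<open>\<Omega>\<close>, is covered by the three terms
  \<open>h(y) (f(x) - f(y))\<close> on \<open>\<Omega> \<times> \<Omega>\<close>, \<open>(h(x) - h(y)) f(x)\<close> and \<open>(h(x) - h(y)) f(y)\<close>, and the last two
  are integrated against \<open>slob_weight\<close>.\<close>

lemma gagliardo_test_mult:
  fixes h :: "real^'n::finite \<Rightarrow> real"
  assumes h: "h \<in> test_functions \<Omega>" and \<theta>: "0 < \<theta>" "\<theta> < 1" "1 < p" and \<Omega>: "open \<Omega>"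
  obtains C where "0 \<le> C" "\<And>f J. (\<lambda>x. indicator \<Omega> x * f x) \<in> borel_measurable borel \<Longrightarrow>
      power_integral p (\<lambda>x. indicator \<Omega> x * f x) \<le> J \<Longrightarrow>
      (\<integral>\<^sup>+z\<in>\<Omega> \<times> \<Omega>. ennreal (\<bar>f (fst z) - f (snd z)\<bar> powr p /
        norm (fst z - snd z) powr (real CARD('n) + \<theta> * p)) \<partial>(lborel \<Otimes>\<^sub>M lborel)) \<le> J \<Longrightarrow>
      gagliardo \<theta> p (\<lambda>x. h x * f x) \<le> ennreal C * J"
proof -
  obtain A where A: "(\<integral>\<^sup>+z. ennreal (slob_weight \<theta> p (z :: real^'n)) \<partial>lborel) = ennreal A" "0 \<le> A"
    by (rule slob_weight_integrable[OF \<theta>])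
  obtain L where L: "0 < L" "\<And>x y. \<bar>h x - h y\<bar> \<le> L * min (norm (x - y)) 1"
    using test_function_increment_bound[OF h] by metis
  obtain M where M: "0 < M" "\<And>x. \<bar>h x\<bar> \<le> M" using test_functions_bounded[OF h] by metis
  define C where "C = 3 powr p * (M powr p + L powr p * A + L powr p * A)"
  have hout: "h x = 0" if "x \<notin> \<Omega>" for x using test_functions_outside[OF h that] .
  show ?thesis
  proof (rule that[of C])
    show "0 \<le> C" unfolding C_def using A(2) by simp
    fix f :: "real^'n \<Rightarrow> real" and J
    let ?g = "\<lambda>x. indicator \<Omega> x * (f x :: real)"
    let ?N = "\<lambda>x y::real^'n. norm (x - y) powr (real CARD('n) + \<theta> * p)"
    let ?D = "\<lambda>x y. \<bar>?g x - ?g y\<bar> powr p / ?N x y * (indicator \<Omega> x * indicator \<Omega> y)"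
    assume [measurable]: "?g \<in> borel_measurable borel"
      and J1: "power_integral p ?g \<le> J" and J2: "(\<integral>\<^sup>+z\<in>\<Omega> \<times> \<Omega>. ennreal (\<bar>f (fst z) - f (snd z)\<bar>
          powr p /
        ?N (fst z) (snd z)) \<partial>(lborel \<Otimes>\<^sub>M lborel)) \<le> J"
    have [measurable]: "\<Omega> \<in> sets borel" using \<Omega> by simp
    have pt: "\<bar>h x * f x - h y * f y\<bar> powr p / ?N x y \<le> 3 powr p * (M powr p * ?D x y
        + L powr p * (slob_weight \<theta> p (x - y) * \<bar>?g x\<bar> powr p) + L powr p * (slob_weight \<theta> p (x -
            y) * \<bar>?g y\<bar> powr p))" for x y
    proof -
      define a where "a = (\<lambda>i::nat. if i = 0 then h y * (?g x - ?g y) * (indicator \<Omega> x *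
          indicator \<Omega> y)
        else if i = 1 then (h x - h y) * ?g x else (h x - h y) * ?g y)"
      have le: "\<bar>h x * f x - h y * f y\<bar> \<le> \<bar>a 0\<bar> + \<bar>a 1\<bar> + \<bar>a 2\<bar>"
      proof -
        consider "x \<in> \<Omega>" "y \<in> \<Omega>" | "x \<in> \<Omega>" "y \<notin> \<Omega>" | "x \<notin> \<Omega>" "y \<in> \<Omega>" | "x \<notin> \<Omega>" "y \<notin> \<Omega>" by blast
        then show ?thesis
        proof cases
          case 1
          have "h x * f x - h y * f y = h y * (f x - f y) + (h x - h y) * f x"
              by (simp add: algebra_simps)
          then have "\<bar>h x * f x - h y * f y\<bar> \<le> \<bar>h y * (f x - f y)\<bar> + \<bar>(h x - h y) * f x\<bar>"
            using abs_triangle_ineq by metis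
          then show ?thesis using 1 by (simp add: a_def)
        qed (simp_all add: a_def hout abs_mult)
      qed
      have "\<bar>h x * f x - h y * f y\<bar> powr p \<le> \<bar>\<Sum>i<3. \<bar>a i\<bar>\<bar> powr p"
        using le \<theta> by (intro powr_mono2) (auto simp: eval_nat_numeral)
      also have "\<dots> \<le> 3 powr p * (\<Sum>i<3. \<bar>a i\<bar> powr p)"
        using powr_abs_sum_le[of "{..<3::nat}" p "\<lambda>i. \<bar>a i\<bar>"] \<theta> by simp
      also have "\<dots> = 3 powr p * (\<bar>a 0\<bar> powr p + \<bar>a 1\<bar> powr p + \<bar>a 2\<bar> powr p)"
        by (simp add: eval_nat_numeral)
      finally have "\<bar>h x * f x - h y * f y\<bar> powr p / ?N x y
          \<le> 3 powr p * (\<bar>a 0\<bar> powr p + \<bar>a 1\<bar> powr p + \<bar>a 2\<bar> powr p) / ?N x y"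
        by (intro divide_right_mono) auto
      also have "\<dots> = 3 powr p * (\<bar>a 0\<bar> powr p / ?N x y + \<bar>a 1\<bar> powr p / ?N x y + \<bar>a 2\<bar> powr p /
          ?N x y)"
        by (simp add: add_divide_distrib distrib_left)
      also have "\<dots> \<le> 3 powr p * (M powr p * ?D x y
        + L powr p * (slob_weight \<theta> p (x - y) * \<bar>?g x\<bar> powr p) + L powr p * (slob_weight \<theta> p (x -
            y) * \<bar>?g y\<bar> powr p))"
      proof (intro mult_left_mono add_mono)
        have "\<bar>a 0\<bar> powr p = \<bar>h y\<bar> powr p * (\<bar>?g x - ?g y\<bar> powr p * (indicator \<Omega> x * indicator \<Omega>
            y))"
          by (simp add: a_def abs_mult powr_mult indicator_def)
        also have "\<dots> \<le> M powr p * (\<bar>?g x - ?g y\<bar> powr p * (indicator \<Omega> x * indicator \<Omega> y))"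
          using M \<theta> by (intro mult_right_mono powr_mono2) auto
        finally show "\<bar>a 0\<bar> powr p / ?N x y \<le> M powr p * ?D x y"
          using divide_right_mono[of _ _ "?N x y"] by fastforce
        have d: "\<bar>h x - h y\<bar> powr p / ?N x y \<le> L powr p * slob_weight \<theta> p (x - y)"
        proof -
          have "\<bar>h x - h y\<bar> powr p \<le> (L * min (norm (x - y)) 1) powr p"
            using L \<theta> by (intro powr_mono2) auto
          then have "\<bar>h x - h y\<bar> powr p / ?N x y \<le> (L * min (norm (x - y)) 1) powr p / ?N x y"
            by (intro divide_right_mono) auto
          then show ?thesis using L by (simp add: slob_weight_def powr_mult)
        qed
        have e: "\<bar>(h x - h y) * c\<bar> powr p / ?N x y
            \<le> L powr p * (slob_weight \<theta> p (x - y) * \<bar>c\<bar> powr p)" for c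
          using mult_right_mono[OF d, of "\<bar>c\<bar> powr p"] by (simp add: abs_mult powr_mult mult_ac)
        show "\<bar>a 1\<bar> powr p / ?N x y \<le> L powr p * (slob_weight \<theta> p (x - y) * \<bar>?g x\<bar> powr p)"
          using e[of "?g x"] by (simp add: a_def)
        show "\<bar>a 2\<bar> powr p / ?N x y \<le> L powr p * (slob_weight \<theta> p (x - y) * \<bar>?g y\<bar> powr p)"
          using e[of "?g y"] by (simp add: a_def)
      qed auto
      finally show ?thesis .
    qed
    \<comment> \<open>In the two terms with differences of \<open>h\<close> the double integral is the product of the
      integrals of \<open>W\<close> and \<open>P\<close>.\<close>
    define W where "W = (\<lambda>z::real^'n. ennreal (slob_weight \<theta> p z))"
    define P where "P = (\<lambda>x. ennreal (\<bar>?g x\<bar> powr p))"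
    have [measurable]: "W \<in> borel_measurable borel" "P \<in> borel_measurable borel"
      unfolding W_def P_def by measurable
    have "gagliardo \<theta> p (\<lambda>x. h x * f x) \<le> (\<integral>\<^sup>+q. ennreal (3 powr p) * (ennreal (M powr p) *
        ennreal (?D (fst q) (snd q))
        + ennreal (L powr p) * (W (fst q - snd q) * P (fst q))
        + ennreal (L powr p) * (W (fst q - snd q) * P (snd q))) \<partial>(lborel \<Otimes>\<^sub>M lborel))"
      unfolding gagliardo_def
    proof (intro nn_integral_mono)
      fix q :: "(real^'n) \<times> (real^'n)"
      show "ennreal (\<bar>h (fst q) * f (fst q) - h (snd q) * f (snd q)\<bar> powr p / ?N (fst q) (snd q))
        \<le> ennreal (3 powr p) * (ennreal (M powr p) * ennreal (?D (fst q) (snd q))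
        + ennreal (L powr p) * (W (fst q - snd q) * P (fst q))
        + ennreal (L powr p) * (W (fst q - snd q) * P (snd q)))"
        using ennreal_leI[OF pt[of "fst q" "snd q"]] slob_weight_nonneg[of \<theta> p "fst q - snd q"]
        unfolding W_def P_def by (simp add: ennreal_mult'[symmetric] ennreal_plus[symmetric] del:
            ennreal_plus)
    qed
    also have "\<dots> = ennreal (3 powr p) * (ennreal (M powr p) * (\<integral>\<^sup>+q. ennreal (?D (fst q) (snd q))
        \<partial>(lborel \<Otimes>\<^sub>M lborel))
        + ennreal (L powr p) * (\<integral>\<^sup>+q. W (fst q - snd q) * P (fst q) \<partial>(lborel \<Otimes>\<^sub>M lborel))
        + ennreal (L powr p) * (\<integral>\<^sup>+q. W (fst q - snd q) * P (snd q) \<partial>(lborel \<Otimes>\<^sub>M lborel)))"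
      by (simp add: nn_integral_cmult nn_integral_add)
    also have "(\<integral>\<^sup>+q. W (fst q - snd q) * P (fst q) \<partial>(lborel \<Otimes>\<^sub>M lborel))
        = ennreal A * power_integral p ?g"
      using nn_integral_weight_convolution(2)[of W P] A(1)
          by (simp add: W_def P_def power_integral_def slob_weight_minus)
    also have "(\<integral>\<^sup>+q. W (fst q - snd q) * P (snd q) \<partial>(lborel \<Otimes>\<^sub>M lborel))
        = ennreal A * power_integral p ?g"
      using nn_integral_weight_convolution(1)[of W P] A(1)
          by (simp add: W_def P_def power_integral_def slob_weight_minus)
    also have "(\<integral>\<^sup>+q. ennreal (?D (fst q) (snd q)) \<partial>(lborel \<Otimes>\<^sub>M lborel))
        = (\<integral>\<^sup>+z\<in>\<Omega> \<times> \<Omega>. ennreal (\<bar>f (fst z) - f (snd z)\<bar> powr p /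
        ?N (fst z) (snd z)) \<partial>(lborel \<Otimes>\<^sub>M lborel))"
      by (intro nn_integral_cong) (auto simp: indicator_def)
    also have "ennreal (3 powr p) * (ennreal (M powr p) * \<dots> + ennreal (L powr p) * (ennreal A *
        power_integral p ?g)
        + ennreal (L powr p) * (ennreal A * power_integral p ?g)) \<le>
        ennreal (3 powr p) * (ennreal (M powr p) * J + ennreal (L powr p) * (ennreal A * J) +
            ennreal (L powr p) * (ennreal A * J))"
      using J1 J2 by (intro mult_left_mono add_mono) auto
    also have "\<dots> = (ennreal (3 powr p) * (ennreal (M powr p) + ennreal (L powr p) * ennreal A +
        ennreal (L powr p) * ennreal A)) * J"
      by (simp only: distrib_right distrib_left mult.assoc)
    also have "ennreal (3 powr p) * (ennreal (M powr p) + ennreal (L powr p) * ennreal A +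
        ennreal (L powr p) * ennreal A) = ennreal C"
      unfolding C_def using A(2)
      by (simp only: ennreal_mult ennreal_plus mult_nonneg_nonneg add_nonneg_nonneg powr_ge_zero)
    finally show "gagliardo \<theta> p (\<lambda>x. h x * f x) \<le> ennreal C * J" .
  qed
qed

section \<open>Fractional regularity of weakly differentiable functions\<close>

text \<open>Jensen's inequality on the unit interval. With \<open>m\<close> the modulus of the mean and \<open>q\<close> the
  conjugate exponent, integrate Young's inequality \<open>|G| m\<^sup>p\<^sup>-\<^sup>1 \<le> |G|\<^sup>p / p + m\<^sup>p / q\<close>.\<close>

lemma unit_interval_power_mean:
  fixes G :: "real \<Rightarrow> real"
  assumes G: "integrable lborel G" "\<And>t. t \<notin> {0..1} \<Longrightarrow> G t = 0" and p: "1 < p"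
  shows "ennreal (\<bar>\<integral>t. G t \<partial>lborel\<bar> powr p) \<le> (\<integral>\<^sup>+t. ennreal (\<bar>G t\<bar> powr p) \<partial>lborel)"
proof (cases "(\<integral>\<^sup>+t. ennreal (\<bar>G t\<bar> powr p) \<partial>lborel) = \<infinity>")
  case False
  define m where "m = \<bar>\<integral>t. G t \<partial>lborel\<bar>"
  define q where "q = p / (p - 1)"
  have q: "1 < q" "1 / p + 1 / q = 1" using p by (simp_all add: q_def field_simps)
  have [measurable]: "G \<in> borel_measurable borel" using G by simp
  have int: "integrable lborel (\<lambda>t. \<bar>G t\<bar> powr p)"
    by (rule integrableI_bounded) (use False in \<open>auto simp: less_top\<close>)
  have int1: "integrable lborel (\<lambda>t. indicator {0..1::real} t * (m powr p / q))"
    by (rule integrable_mult_left) (simp add: integrable_indicator_iff)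
  have "m * m powr (p - 1) \<le> (\<integral>t. \<bar>G t\<bar> \<partial>lborel) * m powr (p - 1)"
    unfolding m_def using integral_abs_bound[of lborel G] by (intro mult_right_mono) auto
  also have "\<dots> = (\<integral>t. \<bar>G t\<bar> * m powr (p - 1) \<partial>lborel)" by simp
  also have "\<dots> \<le> (\<integral>t. \<bar>G t\<bar> powr p / p + indicator {0..1} t * (m powr p / q) \<partial>lborel)"
  proof (rule integral_mono)
    show "integrable lborel (\<lambda>t. \<bar>G t\<bar> powr p / p + indicator {0..1} t * (m powr p / q))"
      using int int1 by (intro Bochner_Integration.integrable_add) auto
    fix t
    have "\<bar>G t\<bar> * m powr (p - 1) \<le> \<bar>G t\<bar> powr p / p + (m powr (p - 1)) powr q / q"
      by (rule Youngs_inequality) (use p q in auto)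
    moreover have "(m powr (p - 1)) powr q = m powr p"
      using p by (simp add: powr_powr q_def)
    ultimately show "\<bar>G t\<bar> * m powr (p - 1) \<le> \<bar>G t\<bar> powr p / p + indicator {0..1} t * (m powr p /
        q)"
      using G(2)[of t] p q by (cases "t \<in> {0..1}") auto
  qed (use G in simp)
  also have "\<dots> = (\<integral>t. \<bar>G t\<bar> powr p \<partial>lborel) / p + m powr p / q"
    using int int1 by simp
  finally have "m * m powr (p - 1) \<le> (\<integral>t. \<bar>G t\<bar> powr p \<partial>lborel) / p + m powr p / q" .
  moreover have "m * m powr (p - 1) = m powr p"
    by (cases "m = 0") (use p in \<open>auto simp: m_def powr_mult_base\<close>)
  moreover have "m powr p / q = m powr p - m powr p / p"
  proof -
    have "1 / q = 1 - 1 / p" using q by simp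
    then have "m powr p * (1 / q) = m powr p * (1 - 1 / p)" by simp
    then show ?thesis by (simp add: right_diff_distrib)
  qed
  ultimately have "m powr p / p \<le> (\<integral>t. \<bar>G t\<bar> powr p \<partial>lborel) / p" by linarith
  then have "m powr p \<le> (\<integral>t. \<bar>G t\<bar> powr p \<partial>lborel)" using p by (simp add: divide_le_cancel)
  then show ?thesis unfolding m_def[symmetric]
    using nn_integral_eq_integral[OF int] by (simp add: ennreal_leI)
qed simp

lemma power_integral_segment_mean:
  fixes G :: "real^'n::finite \<Rightarrow> real"
  assumes G: "integrable lborel G" and p: "1 < p"
  shows "power_integral p (segment_mean G z) \<le> power_integral p G"
proof -
  have [measurable]: "G \<in> borel_measurable borel" using G by simp
  have "power_integral p (segment_mean G z)
      \<le> (\<integral>\<^sup>+x. (\<integral>\<^sup>+t. ennreal (\<bar>indicator {0..1} t * G (x + t *\<^sub>R z)\<bar> powr p) \<partial>lborel) \<partial>lborel)"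
    unfolding power_integral_def
  proof (rule nn_integral_mono_AE)
    show "AE x in lborel. ennreal (\<bar>segment_mean G z x\<bar> powr p)
        \<le> (\<integral>\<^sup>+t. ennreal (\<bar>indicator {0..1} t * G (x + t *\<^sub>R z)\<bar> powr p) \<partial>lborel)"
      using AE_integrable_segment[OF G, of z]
    proof eventually_elim
      case (elim x)
      show ?case unfolding segment_mean_def by (rule unit_interval_power_mean[OF elim _ p]) simp
    qed
  qed
  also have "\<dots> = (\<integral>\<^sup>+t. (\<integral>\<^sup>+x. ennreal (\<bar>indicator {0..1} t * G (x + t *\<^sub>R z)\<bar> powr p) \<partial>lborel)
      \<partial>lborel)"
    by (rule lborel_pair.Fubini'[symmetric]) (simp add: case_prod_unfold)
  also have "\<dots> = (\<integral>\<^sup>+t. indicator {0..1} t * (\<integral>\<^sup>+x. ennreal (\<bar>G (x + t *\<^sub>R z)\<bar> powr p) \<partial>lborel)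
      \<partial>lborel)"
    by (subst nn_integral_cmult[symmetric]) (use p
        in \<open>auto intro!: nn_integral_cong simp: indicator_def\<close>)
  also have "\<dots> = (\<integral>\<^sup>+t. indicator {0..1::real} t * power_integral p G \<partial>lborel)"
    unfolding power_integral_def by (subst lborel_nn_integral_translate) auto
  also have "\<dots> = power_integral p G" by (simp add: nn_integral_multc)
  finally show ?thesis .
qed

definition weak_gradient :: "(real^'n::finite \<Rightarrow> real) \<Rightarrow> ('n \<Rightarrow> real^'n \<Rightarrow> real) \<Rightarrow> bool"
  where "weak_gradient F D \<longleftrightarrow> integrable lborel F \<and> (\<forall>i. integrable lborel (D i)) \<and>
    (\<forall>i. \<forall>\<phi>\<in>test_functions UNIV. (\<integral>x. F x * partial i \<phi> x \<partial>lborel) = - (\<integral>x. D i x * \<phi> x \<partial>lborel))"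

lemma test_functions_translate:
  assumes "\<phi> \<in> test_functions UNIV"
  shows "(\<lambda>x. \<phi> (x + c)) \<in> test_functions UNIV" "partial i (\<lambda>x. \<phi> (x + c))
      = (\<lambda>x. partial i \<phi> (x + c))"
proof -
  obtain K where K: "smooth_on UNIV \<phi>" "compact K" "\<And>x. x \<notin> K \<Longrightarrow> \<phi> x = 0"
    using test_functionsE[OF assms] by metis
  have "smooth_on UNIV (\<lambda>x. x + c)"
    by (intro smooth_on_add smooth_on_const open_UNIV smooth_on_bounded_linear bounded_linear_ident)
  from smooth_on_compose[OF open_UNIV open_UNIV _ this K(1)]
  have sm: "smooth_on UNIV (\<lambda>x. \<phi> (x + c))" by simp
  show "(\<lambda>x. \<phi> (x + c)) \<in> test_functions UNIV"
  proof (rule test_functionsI[OF sm])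
    show "compact ((+) (- c) ` K)" by (rule compact_translation[OF K(2)])
    fix x assume "x \<notin> (+) (- c) ` K"
    then have "x + c \<notin> K" by (metis add.commute add_minus_cancel image_eqI minus_add_cancel)
    then show "\<phi> (x + c) = 0" by (rule K(3))
  qed simp
  show "partial i (\<lambda>x. \<phi> (x + c)) = (\<lambda>x. partial i \<phi> (x + c))"
  proof
    fix x
    have "((\<lambda>x. x + c) has_derivative (\<lambda>h. h)) (at x)" by (auto intro!: derivative_eq_intros)
    from diff_chain_at[OF this smooth_on_has_derivative[OF K(1) UNIV_I]]
    have "((\<lambda>x. \<phi> (x + c)) has_derivative frechet_derivative \<phi> (at (x + c))) (at x)"
        by (simp add: o_def)
    from partial_eqI[OF this] show "partial i (\<lambda>x. \<phi> (x + c)) x = partial i \<phi> (x + c)"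
      by (simp add: partial_def)
  qed
qed

text \<open>The fundamental theorem of calculus along a segment, for weakly differentiable functions: it
  is tested against \<open>\<phi>\<close> and moved to \<open>\<phi>\<close> by translation and Fubini.\<close>

lemma weak_gradient_increment:
  fixes F :: "real^'n::finite \<Rightarrow> real"
  assumes "weak_gradient F D"
  shows "AE x in lborel. F (x + z) - F x = segment_mean (\<lambda>y. \<Sum>i\<in>UNIV. z $ i * D i y) z x"
proof -
  define H where "H = (\<lambda>y. \<Sum>i\<in>UNIV. z $ i * D i y)"
  have F: "integrable lborel F" and D: "\<And>i. integrable lborel (D i)"
    and wd: "\<And>i \<phi>. \<phi> \<in> test_functions UNIV \<Longrightarrow>
      (\<integral>x. F x * partial i \<phi> x \<partial>lborel) = - (\<integral>x. D i x * \<phi> x \<partial>lborel)"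
    using assms by (auto simp: weak_gradient_def)
  have H: "integrable lborel H" unfolding H_def using D
      by (intro Bochner_Integration.integrable_sum) auto
  have S: "integrable lborel (segment_mean H z)" by (rule integrable_segment_mean[OF H])
  have Fz: "integrable lborel (\<lambda>x. F (x + z))" by (rule lborel_integral_translate(2)[OF F])
  have [measurable]: "F \<in> borel_measurable borel" "H \<in> borel_measurable borel" using F H by auto
  have tm: "integrable lborel (\<lambda>x. \<phi> x * f x)" if tf: "\<phi> \<in> test_functions UNIV"
      "integrable lborel f" for \<phi> f
  proof -
    obtain M where "\<And>x. \<bar>\<phi> x\<bar> \<le> M" using test_functions_bounded[OF tf(1)] by metis
    then show ?thesis
      using integrable_bounded_mult[OF tf(2), of \<phi> M] smooth_borel[OF test_functions_smooth[OF
          tf(1)]] by simp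
  qed
  have "AE x in lborel. x \<in> UNIV \<longrightarrow> F (x + z) - F x - segment_mean H z x = 0"
  proof (rule fundamental_lemma_of_variations)
    show "locally_integrable_on UNIV (\<lambda>x. F (x + z) - F x - segment_mean H z x)"
      using F Fz S by (intro integrable_imp_locally_integrable) auto
    fix \<phi> assume \<phi>: "\<phi> \<in> test_functions (UNIV :: (real^'n) set)"
    have sm: "smooth_on UNIV \<phi>" by (rule test_functions_smooth[OF \<phi>])
    have [measurable]: "\<phi> \<in> borel_measurable borel" by (rule smooth_borel[OF sm])
    obtain M where M: "\<And>x. \<bar>\<phi> x\<bar> \<le> M" using test_functions_bounded[OF \<phi>] by metis
    define g where "g = (\<lambda>y. frechet_derivative \<phi> (at y) (- z))"
    have g: "g = (\<lambda>y. \<Sum>i\<in>UNIV. (- z $ i) * partial i \<phi> y)"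
      unfolding g_def by (simp add: frechet_derivative_eq_partials[OF sm])
    have gb: "g \<in> borel_measurable borel"
      unfolding g_def by (intro smooth_borel smooth_on_derivative open_UNIV sm)
    have "\<forall>i. \<exists>N. \<forall>x. \<bar>partial i \<phi> x\<bar> \<le> N"
      using test_functions_bounded[OF test_functions_partial[OF \<phi>]] by metis
    then obtain N where N: "\<And>i x. \<bar>partial i \<phi> x\<bar> \<le> N i" by metis
    have gN: "\<bar>g x\<bar> \<le> (\<Sum>i\<in>UNIV. \<bar>- z $ i\<bar> * N i)" for x
      unfolding g by (rule order_trans[OF sum_abs]) (auto intro!: sum_mono mult_left_mono N simp:
          abs_mult)
    \<comment> \<open>Here the weak derivatives of \<open>F\<close> are used, with a translate of \<open>\<phi>\<close> as test function.\<close>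
    have inner: "(\<integral>x. H x * \<phi> (x + t *\<^sub>R (- z)) \<partial>lborel)
        = (\<integral>x. F x * g (x + t *\<^sub>R (- z)) \<partial>lborel)" for t
    proof -
      let ?\<phi> = "\<lambda>x. \<phi> (x + t *\<^sub>R (- z))"
      note t = test_functions_translate(1)[OF \<phi>, of "t *\<^sub>R (- z)"]
        test_functions_translate(2)[OF \<phi>, where c = "t *\<^sub>R (- z)"]
      have "(\<integral>x. H x * ?\<phi> x \<partial>lborel) = (\<integral>x. (\<Sum>i\<in>UNIV. z $ i * (?\<phi> x * D i x)) \<partial>lborel)"
        unfolding H_def sum_distrib_right
        by (rule Bochner_Integration.integral_cong[OF refl]) (simp add: mult_ac)
      also have "\<dots> = (\<Sum>i\<in>UNIV. z $ i * (\<integral>x. ?\<phi> x * D i x \<partial>lborel))"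
        using tm[OF t(1) D] by (subst Bochner_Integration.integral_sum) auto
      also have "\<dots> = (\<Sum>i\<in>UNIV. - z $ i * (\<integral>x. partial i ?\<phi> x * F x \<partial>lborel))"
        using wd[OF t(1)] by (simp add: mult.commute)
      also have "\<dots> = (\<integral>x. (\<Sum>i\<in>UNIV. - z $ i * (partial i ?\<phi> x * F x)) \<partial>lborel)"
        using tm[OF test_functions_partial[OF t(1)] F]
            by (subst Bochner_Integration.integral_sum) auto
      also have "\<dots> = (\<integral>x. F x * g (x + t *\<^sub>R (- z)) \<partial>lborel)"
        unfolding g t(2) by (intro Bochner_Integration.integral_cong refl)
          (auto simp: sum_distrib_left mult_ac intro!: sum.cong)
      finally show ?thesis .
    qed
    have "(\<integral>x. segment_mean H z x * \<phi> x \<partial>lborel) = (\<integral>x. H x * segment_mean \<phi> (- z) x \<partial>lborel)"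
      by (rule integral_segment_mean_mult[OF H _ M]) simp
    also have "\<dots> = (\<integral>t. indicator {0..1} t * (\<integral>x. H x * \<phi> (x + t *\<^sub>R (- z)) \<partial>lborel) \<partial>lborel)"
      by (rule integral_mult_segment_mean[OF H _ M]) simp
    also have "\<dots> = (\<integral>t. indicator {0..1} t * (\<integral>x. F x * g (x + t *\<^sub>R (- z)) \<partial>lborel) \<partial>lborel)"
      unfolding inner ..
    also have "\<dots> = (\<integral>x. F x * segment_mean g (- z) x \<partial>lborel)"
      by (rule integral_mult_segment_mean[OF F gb gN, symmetric])
    also have "\<dots> = (\<integral>x. F x * (\<phi> (x - z) - \<phi> x) \<partial>lborel)"
      using segment_mean_derivative[OF sm, of _ "- z"] by (simp add: g_def)
    also have "\<dots> = (\<integral>x. \<phi> (x + (- z)) * F x - \<phi> x * F x \<partial>lborel)"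
      by (simp add: algebra_simps)
    also have "\<dots> = (\<integral>x. \<phi> (x + (- z)) * F x \<partial>lborel) - (\<integral>x. \<phi> x * F x \<partial>lborel)"
      by (rule Bochner_Integration.integral_diff[OF tm[OF test_functions_translate(1)[OF \<phi>] F]
          tm[OF \<phi> F]])
    also have "(\<integral>x. \<phi> (x + (- z)) * F x \<partial>lborel) = (\<integral>x. \<phi> x * F (x + z) \<partial>lborel)"
      using lborel_integral_translate(1)[of "\<lambda>x. \<phi> (x + (- z)) * F x" z] by simp
    finally have "(\<integral>x. segment_mean H z x * \<phi> x \<partial>lborel)
        = (\<integral>x. \<phi> x * F (x + z) \<partial>lborel) - (\<integral>x. \<phi> x * F x \<partial>lborel)" .
    moreover have "(F (x + z) - F x - segment_mean H z x) * \<phi> x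
        = \<phi> x * F (x + z) - \<phi> x * F x - \<phi> x * segment_mean H z x" for x
      by (simp add: algebra_simps)
    ultimately show "(LINT x:UNIV|lborel. (F (x + z) - F x - segment_mean H z x) * \<phi> x) = 0"
      using tm[OF \<phi> F] tm[OF \<phi> Fz] tm[OF \<phi> S]
      by (simp add: set_lebesgue_integral_def mult.commute[of "segment_mean H z _"])
  qed simp
  then show ?thesis unfolding H_def by eventually_elim simp
qed

text \<open>The gradient controls small increments, by translation invariance of the integral and the
  mean over the segment; for large ones the integral of the function itself is enough.\<close>

lemma power_integral_increment:
  fixes F :: "real^'n::finite \<Rightarrow> real"
  assumes wg: "weak_gradient F D" and p: "1 < p"
    and J: "power_integral p F \<le> J" "\<And>i. power_integral p (D i) \<le> J"
  shows "power_integral p (\<lambda>x. F (x + z) - F x)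
    \<le> ennreal ((2 powr p * 2 + real CARD('n) powr p * CARD('n)) * min (norm z) 1 powr p) * J"
proof -
  let ?n = "real CARD('n)"
  have F: "integrable lborel F" and D: "\<And>i. integrable lborel (D i)"
    using wg by (auto simp: weak_gradient_def)
  have [measurable]: "F \<in> borel_measurable borel" "\<And>i. D i \<in> borel_measurable borel" using F D
      by auto
  have b1: "power_integral p (\<lambda>x. F (x + z) - F x) \<le> ennreal (2 powr p * 2) * J"
  proof -
    have "power_integral p (\<lambda>x. F (x + z) - F x)
        \<le> (\<integral>\<^sup>+x. ennreal (2 powr p) * (ennreal (\<bar>F (x + z)\<bar> powr p) + ennreal (\<bar>F x\<bar> powr p))
            \<partial>lborel)"
      unfolding power_integral_def
    proof (rule nn_integral_mono)
      fix x
      have "\<bar>F (x + z) - F x\<bar> powr p \<le> 2 powr p * (\<bar>F (x + z)\<bar> powr p + \<bar>F x\<bar> powr p)"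
        using powr_abs_add_le[of p "F (x + z)" "- F x"] p by simp
      then show "ennreal (\<bar>F (x + z) - F x\<bar> powr p)
          \<le> ennreal (2 powr p) * (ennreal (\<bar>F (x + z)\<bar> powr p) + ennreal (\<bar>F x\<bar> powr p))"
        by (simp add: ennreal_mult'[symmetric] ennreal_plus[symmetric] ennreal_leI del:
            ennreal_plus)
    qed
    also have "\<dots> = ennreal (2 powr p) * (power_integral p F + power_integral p F)"
      unfolding power_integral_def
      by (simp add: nn_integral_cmult nn_integral_add lborel_nn_integral_translate[of
          "\<lambda>x. ennreal (\<bar>F x\<bar> powr p)"])
    also have "\<dots> \<le> ennreal (2 powr p) * (J + J)" using J by (intro mult_left_mono add_mono) auto
    also have "\<dots> = ennreal (2 powr p * 2) * J"
      by (simp add: ennreal_mult mult_2[symmetric] mult.assoc)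
    finally show ?thesis .
  qed
  have b2: "power_integral p (\<lambda>x. F (x + z) - F x) \<le> ennreal (?n powr p * ?n * norm z powr p) * J"
  proof -
    let ?H = "\<lambda>y. \<Sum>i\<in>UNIV. z $ i * D i y"
    have H: "integrable lborel ?H" using D by (intro Bochner_Integration.integrable_sum) auto
    have "power_integral p (\<lambda>x. F (x + z) - F x) = power_integral p (segment_mean ?H z)"
      unfolding power_integral_def using weak_gradient_increment[OF wg, of z]
      by (intro nn_integral_cong_AE) auto
    also have "\<dots> \<le> power_integral p ?H" by (rule power_integral_segment_mean[OF H p])
    also have "\<dots> \<le> (\<integral>\<^sup>+x. (\<Sum>i\<in>UNIV. ennreal (?n powr p * norm z powr p) * ennreal (\<bar>D i x\<bar> powr
        p)) \<partial>lborel)"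
      unfolding power_integral_def
    proof (rule nn_integral_mono)
      fix x
      have "\<bar>?H x\<bar> powr p \<le> ?n powr p * (\<Sum>i\<in>UNIV. \<bar>z $ i * D i x\<bar> powr p)"
        using powr_abs_sum_le[of UNIV p "\<lambda>i. z $ i * D i x"] p by simp
      also have "\<dots> \<le> ?n powr p * (\<Sum>i\<in>UNIV. norm z powr p * \<bar>D i x\<bar> powr p)"
        using p component_le_norm_cart[of z]
        by (intro mult_left_mono sum_mono) (auto simp: abs_mult powr_mult intro!: mult_right_mono
            powr_mono2)
      also have "\<dots> = (\<Sum>i\<in>UNIV. ?n powr p * norm z powr p * \<bar>D i x\<bar> powr p)"
        by (simp add: sum_distrib_left mult.assoc)
      finally show "ennreal (\<bar>?H x\<bar> powr p) \<le> (\<Sum>i\<in>UNIV. ennreal (?n powr p * norm z powr p) *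
          ennreal (\<bar>D i x\<bar> powr p))"
        by (simp add: ennreal_mult'[symmetric] sum_ennreal ennreal_leI)
    qed
    also have "\<dots> = (\<Sum>i\<in>UNIV. ennreal (?n powr p * norm z powr p) * power_integral p (D i))"
      unfolding power_integral_def by (simp add: nn_integral_sum nn_integral_cmult)
    also have "\<dots> \<le> (\<Sum>i\<in>(UNIV::'n set). ennreal (?n powr p * norm z powr p) * J)"
      by (intro sum_mono mult_left_mono J) auto
    also have "\<dots> = ennreal (?n powr p * ?n * norm z powr p) * J"
      by (simp add: ennreal_mult' ennreal_of_nat_eq_real_of_nat mult_ac)
    finally show ?thesis .
  qed
  show ?thesis
  proof (cases "norm z \<le> 1")
    case True
    have "power_integral p (\<lambda>x. F (x + z) - F x) \<le> ennreal (?n powr p * ?n * norm z powr p) * J"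
        by (rule b2)
    also have "\<dots> \<le> ennreal ((2 powr p * 2 + ?n powr p * CARD('n)) * min (norm z) 1 powr p) * J"
      using True by (intro mult_right_mono ennreal_leI) (auto simp: min_def intro!: mult_right_mono)
    finally show ?thesis .
  next
    case False
    have "power_integral p (\<lambda>x. F (x + z) - F x) \<le> ennreal (2 powr p * 2) * J" by (rule b1)
    also have "\<dots> \<le> ennreal ((2 powr p * 2 + ?n powr p * CARD('n)) * min (norm z) 1 powr p) * J"
      using False by (intro mult_right_mono ennreal_leI) (auto simp: min_def)
    finally show ?thesis .
  qed
qed

lemma gagliardo_weak_gradient:
  assumes \<theta>: "0 < \<theta>" "\<theta> < 1" "1 < p"
  obtains C where "0 \<le> C" "\<And>(F :: real^'n::finite \<Rightarrow> real) D J. weak_gradient F D \<Longrightarrow>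
    power_integral p F \<le> J \<Longrightarrow> (\<And>i. power_integral p (D i) \<le> J) \<Longrightarrow> gagliardo \<theta> p F \<le> ennreal C * J"
proof -
  obtain A where A: "(\<integral>\<^sup>+z. ennreal (slob_weight \<theta> p (z :: real^'n)) \<partial>lborel) = ennreal A" "0 \<le> A"
    by (rule slob_weight_integrable[OF \<theta>])
  define C1 where "C1 = 2 powr p * 2 + real CARD('n) powr p * CARD('n)"
  have C1: "0 \<le> C1" by (simp add: C1_def)
  show ?thesis
  proof (rule that[of "C1 * A"])
    show "0 \<le> C1 * A" using C1 A by simp
    fix F :: "real^'n \<Rightarrow> real" and D J
    assume wg: "weak_gradient F D" and J: "power_integral p F \<le> J" "\<And>i. power_integral p (D i) \<le> J"
    let ?N = "\<lambda>z::real^'n. norm z powr (real CARD('n) + \<theta> * p)"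
    have [measurable]: "F \<in> borel_measurable borel" using wg by (auto simp: weak_gradient_def)
    have "gagliardo \<theta> p F = (\<integral>\<^sup>+z. \<integral>\<^sup>+x. ennreal (\<bar>F (x + z) - F x\<bar> powr p / ?N z) \<partial>lborel \<partial>lborel)"
      unfolding gagliardo_def
      by (subst nn_integral_difference_variables[of
          "\<lambda>x y. ennreal (\<bar>F x - F y\<bar> powr p / ?N (x - y))"])
        (auto simp: case_prod_unfold)
    also have "\<dots> = (\<integral>\<^sup>+z. ennreal (1 / ?N z) * power_integral p (\<lambda>x. F (x + z) - F x) \<partial>lborel)"
      unfolding power_integral_def
      by (subst nn_integral_cmult[symmetric]) (auto simp: ennreal_mult'[symmetric])
    also have "\<dots> \<le> (\<integral>\<^sup>+z. ennreal (1 / ?N z) * (ennreal (C1 * min (norm z) 1 powr p) * J) \<partial>lborel)"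
      unfolding C1_def by (intro nn_integral_mono mult_left_mono power_integral_increment[OF wg
          \<theta>(3) J]) auto
    also have "\<dots> = (\<integral>\<^sup>+z. ennreal (slob_weight \<theta> p (z :: real^'n)) * (ennreal C1 * J) \<partial>lborel)"
      using C1 by (intro nn_integral_cong)
        (simp add: slob_weight_def ennreal_mult'[symmetric] mult.assoc[symmetric] mult_ac)
    also have "\<dots> = ennreal A * (ennreal C1 * J)"
      using A by (subst nn_integral_multc) auto
    also have "\<dots> = ennreal (C1 * A) * J" using C1 A by (simp add: ennreal_mult mult_ac)
    finally show "gagliardo \<theta> p F \<le> ennreal (C1 * A) * J" .
  qed
qed

section \<open>Distributions with locally integrable weak derivatives\<close>

lemma ennroot_mono:
  assumes "0 < p" "I \<le> J" shows "ennroot p I \<le> ennroot p J"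
proof (cases "J = \<infinity>")
  case False
  then have "I \<noteq> \<infinity>" using assms(2) by (metis infinity_ennreal_def top.extremum_unique)
  moreover have "enn2real I \<le> enn2real J" using assms(2) False
      by (intro enn2real_mono) (auto simp: less_top)
  ultimately show ?thesis using assms False by (simp add: ennroot_def ennreal_leI powr_mono2)
qed (simp add: ennroot_def)

lemma ennroot_powr: "0 < p \<Longrightarrow> 0 \<le> s \<Longrightarrow> ennroot p (ennreal (s powr p)) = ennreal s"
  by (simp add: ennroot_def powr_powr)

lemma ennroot_le_iff:
  assumes "0 < p" "0 \<le> s" shows "ennroot p I \<le> ennreal s \<longleftrightarrow> I \<le> ennreal (s powr p)"
proof
  assume *: "ennroot p I \<le> ennreal s"
  then have fin: "I \<noteq> \<infinity>" by (auto simp: ennroot_def top_unique)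
  then have "enn2real I powr (1 / p) \<le> s" using * assms by (simp add: ennroot_def)
  then have "(enn2real I powr (1 / p)) powr p \<le> s powr p" using assms by (intro powr_mono2) auto
  then have "enn2real I \<le> s powr p" using assms by (simp add: powr_powr)
  then show "I \<le> ennreal (s powr p)" using fin
    by (metis ennreal_enn2real ennreal_leI infinity_ennreal_def less_top)
next
  assume "I \<le> ennreal (s powr p)"
  then show "ennroot p I \<le> ennreal s" using ennroot_mono[OF assms(1)] ennroot_powr[OF assms]
      by metis
qed

lemma Lp_norm_eq_power_integral:
  assumes "0 < p"
  shows "Lp_norm \<Omega> p f = ennroot p (power_integral p (\<lambda>x. indicator \<Omega> x * f x))"
  unfolding Lp_norm_def power_integral_def
  by (intro arg_cong[of _ _ "ennroot p"] nn_integral_cong) (use assms in \<open>simp add: indicator_def\<close>)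

lemma Lp_norm_le_power_integral:
  assumes "0 < p" shows "Lp_norm \<Omega> p f \<le> ennroot p (power_integral p f)"
  unfolding Lp_norm_def power_integral_def
  by (intro ennroot_mono[OF assms] nn_integral_mono) (simp add: indicator_def)

lemma slobodeckij_le_gagliardo:
  assumes "0 < p" shows "slobodeckij_seminorm \<Omega> \<theta> p f \<le> ennroot p (gagliardo \<theta> p f)"
  unfolding slobodeckij_seminorm_def gagliardo_def
  by (intro ennroot_mono[OF assms] nn_integral_mono) (simp add: indicator_def)

lemma locally_integrable_borel:
  fixes f :: "real^'n::finite \<Rightarrow> real"
  assumes "open \<Omega>" "locally_integrable_on \<Omega> f"
  shows "(\<lambda>x. indicator \<Omega> x * f x) \<in> borel_measurable borel"
proof -
  obtain \<D> where \<D>: "countable \<D>" "\<D> \<subseteq> Pow \<Omega>" "\<And>X. X \<in> \<D> \<Longrightarrow> \<exists>a b. X = cbox a b" "\<Union>\<D> = \<Omega>"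
    using open_countable_Union_open_cbox[OF assms(1)] by metis
  show ?thesis
  proof (rule measurable_piecewise_restrict[of "insert (- \<Omega>) \<D>"])
    show "X \<inter> space borel \<in> sets borel" if "X \<in> insert (- \<Omega>) \<D>" for X
      by (cases "X = - \<Omega>") (use that assms(1) \<D>(3)[of X] in auto)
    fix X assume X: "X \<in> insert (- \<Omega>) \<D>"
    show "(\<lambda>x. indicator \<Omega> x * f x) \<in> borel_measurable (restrict_space borel X)"
    proof (cases "X = - \<Omega>")
      case True
      then show ?thesis
        by (subst measurable_cong[where g = "\<lambda>x. 0"]) (auto simp: space_restrict_space)
    next
      case False
      then have XD: "X \<in> \<D>" using X by simp
      then have "compact X" "X \<subseteq> \<Omega>" using \<D>(2) \<D>(3)[OF XD] by auto
      then have "(\<lambda>x. indicator X x * f x) \<in> borel_measurable borel"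
        using assms(2) unfolding locally_integrable_on_def set_integrable_def by auto
      from measurable_restrict_space1[OF this, of X] show ?thesis
        by (subst measurable_cong[where g = "\<lambda>x. indicator X x * f x"])
          (use \<open>X \<subseteq> \<Omega>\<close> in \<open>auto simp: space_restrict_space indicator_def\<close>)
    qed
  qed (use \<D> in auto)
qed

lemma AE_lborel_pair_components:
  fixes P :: "'a::euclidean_space \<Rightarrow> bool"
  assumes "AE x in lborel. P x"
  shows "AE z in lborel \<Otimes>\<^sub>M (lborel :: 'a measure). P (fst z) \<and> P (snd z)"
proof -
  obtain N where N: "{x \<in> space lborel. \<not> P x} \<subseteq> N" "N \<in> null_sets lborel"
    using assms by (auto elim!: AE_E3 simp: eventually_ae_filter)
  have "N \<times> UNIV \<in> null_sets (lborel \<Otimes>\<^sub>M (lborel :: 'a measure))"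
    using N(2) by (auto simp: null_sets_def lborel.emeasure_pair_measure_Times)
  moreover have "UNIV \<times> N \<in> null_sets (lborel \<Otimes>\<^sub>M (lborel :: 'a measure))"
    using N(2) by (auto simp: null_sets_def lborel.emeasure_pair_measure_Times)
  ultimately have "AE z in lborel \<Otimes>\<^sub>M (lborel :: 'a measure). z \<notin> N \<times> UNIV \<and> z \<notin> UNIV \<times> N"
    by (auto intro: AE_conjI AE_not_in)
  then show ?thesis by eventually_elim (use N(1) in auto)
qed

text \<open>This makes the infimum over densities in the definition of the Sobolev norms a value at any
  density.\<close>

lemma regular_distr_determines:
  assumes "open \<Omega>" "locally_integrable_on \<Omega> f" "locally_integrable_on \<Omega> g"
    and "regular_distr \<Omega> f = regular_distr \<Omega> g"
  shows "AE x in lborel. x \<in> \<Omega> \<longrightarrow> f x = g x"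
proof -
  have "AE x in lborel. x \<in> \<Omega> \<longrightarrow> f x - g x = 0"
  proof (rule fundamental_lemma_of_variations[OF assms(1)])
    show "locally_integrable_on \<Omega> (\<lambda>x. f x - g x)"
      using assms(2,3) unfolding locally_integrable_on_def by (auto intro: set_integral_diff)
    fix \<phi> assume \<phi>: "\<phi> \<in> test_functions \<Omega>"
    then have "(LINT x:\<Omega>|lborel. f x * \<phi> x) = (LINT x:\<Omega>|lborel. g x * \<phi> x)"
      using fun_cong[OF assms(4), of \<phi>] by (simp add: regular_distr_def)
    then show "(LINT x:\<Omega>|lborel. (f x - g x) * \<phi> x) = 0"
      using integrable_mult_test[OF assms(2) \<phi>] integrable_mult_test[OF assms(3) \<phi>]
      by (simp add: left_diff_distrib set_integral_diff)
  qed
  then show ?thesis by eventually_elim simp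
qed

lemma on_density_Lp:
  assumes "open \<Omega>" "locally_integrable_on \<Omega> f" "regular_distr \<Omega> f = u"
  shows "on_density \<Omega> (Lp_norm \<Omega> p) u = Lp_norm \<Omega> p f"
proof -
  have "Lp_norm \<Omega> p g = Lp_norm \<Omega> p f" if "locally_integrable_on \<Omega> g" "regular_distr \<Omega> g = u" for g
    using regular_distr_determines[OF assms(1) that(1) assms(2)] that(2) assms(3)
    unfolding Lp_norm_def
    by (intro arg_cong[of _ _ "ennroot p"] nn_integral_cong_AE) (auto simp: indicator_def)
  then have "on_density \<Omega> (Lp_norm \<Omega> p) u = (INF g\<in>{f. locally_integrable_on \<Omega> f
      \<and> regular_distr \<Omega> f = u}. Lp_norm \<Omega> p f)"
    unfolding on_density_def by (intro INF_cong) auto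
  then show ?thesis using assms(2,3) by (subst (asm) INF_const) auto
qed

lemma on_density_slobodeckij:
  assumes "open \<Omega>" "locally_integrable_on \<Omega> f" "regular_distr \<Omega> f = u"
  shows "on_density \<Omega> (slobodeckij_seminorm \<Omega> \<theta> p) u = slobodeckij_seminorm \<Omega> \<theta> p f"
proof -
  have "slobodeckij_seminorm \<Omega> \<theta> p g = slobodeckij_seminorm \<Omega> \<theta> p f"
    if "locally_integrable_on \<Omega> g" "regular_distr \<Omega> g = u" for g
  proof -
    have "AE x in lborel. x \<in> \<Omega> \<longrightarrow> g x = f x"
      using regular_distr_determines[OF assms(1) that(1) assms(2)] that(2) assms(3) by simp
    from AE_lborel_pair_components[OF this] show ?thesis
      unfolding slobodeckij_seminorm_def
      by (intro arg_cong[of _ _ "ennroot p"] nn_integral_cong_AE) (auto simp: indicator_def)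
  qed
  then have "on_density \<Omega> (slobodeckij_seminorm \<Omega> \<theta> p) u = (INF g\<in>{f. locally_integrable_on \<Omega> f
      \<and> regular_distr \<Omega> f = u}. slobodeckij_seminorm \<Omega> \<theta> p f)"
    unfolding on_density_def by (intro INF_cong) auto
  then show ?thesis using assms(2,3) by (subst (asm) INF_const) auto
qed

lemma on_density_le:
  "locally_integrable_on \<Omega> f \<Longrightarrow> regular_distr \<Omega> f = u \<Longrightarrow> on_density \<Omega> N u \<le> N f"
  unfolding on_density_def by (intro INF_lower) simp

lemma on_density_finite_obtain:
  assumes "on_density \<Omega> N u < \<infinity>"
  obtains f where "locally_integrable_on \<Omega> f" "regular_distr \<Omega> f = u"
proof -
  have "{f. locally_integrable_on \<Omega> f \<and> regular_distr \<Omega> f = u} \<noteq> {}"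
    using assms unfolding on_density_def by (metis INF_empty infinity_ennreal_def less_irrefl)
  then show ?thesis using that by blast
qed

text \<open>The weak derivative along a list of coordinate directions; lists instead of multi-indices
  make the product rule an induction over the list.\<close>

definition weak_derivs :: "(real^'n::finite) set \<Rightarrow> nat \<Rightarrow> ('n list \<Rightarrow> real^'n \<Rightarrow> real) \<Rightarrow> bool"
  where "weak_derivs \<Omega> k f \<longleftrightarrow> (\<forall>is. length is \<le> k \<longrightarrow> locally_integrable_on \<Omega> (f is) \<and>
    (\<forall>\<phi>\<in>test_functions \<Omega>. (LINT x:\<Omega>|lborel. f [] x * foldr partial is \<phi> x)
      = (-1) ^ length is * (LINT x:\<Omega>|lborel. f is x * \<phi> x)))"

lemma weak_derivs_locally_integrable:
  "weak_derivs \<Omega> k f \<Longrightarrow> length is \<le> k \<Longrightarrow> locally_integrable_on \<Omega> (f is)"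
  by (simp add: weak_derivs_def)

lemma weak_derivs_snoc:
  assumes "weak_derivs \<Omega> k f" "length is < k" "\<phi> \<in> test_functions \<Omega>"
  shows "(LINT x:\<Omega>|lborel. f is x * partial i \<phi> x) = - (LINT x:\<Omega>|lborel. f (is @ [i]) x * \<phi> x)"
proof -
  have "(-1) ^ length is * (LINT x:\<Omega>|lborel. f is x * partial i \<phi> x)
      = (LINT x:\<Omega>|lborel. f [] x * foldr partial is (partial i \<phi>) x)"
    using assms test_functions_partial[OF assms(3)] unfolding weak_derivs_def by simp
  also have "\<dots> = (LINT x:\<Omega>|lborel. f [] x * foldr partial (is @ [i]) \<phi> x)" by simp
  also have "\<dots> = (-1) ^ length (is @ [i]) * (LINT x:\<Omega>|lborel. f (is @ [i]) x * \<phi> x)"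
  proof -
    have "length (is @ [i]) \<le> k" using assms(2) by simp
    then show ?thesis using assms(1,3) unfolding weak_derivs_def by blast
  qed
  finally have "(-1) ^ length is * (LINT x:\<Omega>|lborel. f is x * partial i \<phi> x)
      = (-1) ^ length is * (- (LINT x:\<Omega>|lborel. f (is @ [i]) x * \<phi> x))" by simp
  then show ?thesis by (simp only: mult_cancel_left) simp
qed

lemma weak_derivs_Cons:
  assumes "weak_derivs \<Omega> (Suc k) f" shows "weak_derivs \<Omega> k (\<lambda>is. f (i # is))"
  unfolding weak_derivs_def
proof (intro allI impI conjI ballI)
  fix "is" :: "'a list" assume len: "length is \<le> k"
  then show "locally_integrable_on \<Omega> (f (i # is))" using assms by (simp add: weak_derivs_def)
  fix \<phi> assume \<phi>: "\<phi> \<in> test_functions \<Omega>"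
  have "(LINT x:\<Omega>|lborel. f [] x * foldr partial (i # is) \<phi> x)
      = - (LINT x:\<Omega>|lborel. f [i] x * foldr partial is \<phi> x)"
    using weak_derivs_snoc[OF assms, of "[]" "foldr partial is \<phi>" i] test_functions_partials[OF
        \<phi>] by simp
  moreover have "(LINT x:\<Omega>|lborel. f [] x * foldr partial (i # is) \<phi> x)
      = (-1) ^ length (i # is) * (LINT x:\<Omega>|lborel. f (i # is) x * \<phi> x)"
    using assms len \<phi> unfolding weak_derivs_def by (simp only: length_Cons Suc_le_mono)
  ultimately show "(LINT x:\<Omega>|lborel. f [i] x * foldr partial is \<phi> x)
      = (-1) ^ length is * (LINT x:\<Omega>|lborel. f (i # is) x * \<phi> x)"
    by simp
qed

text \<open>The terms of the Leibniz rule for the derivative along a list of \<open>h\<close> times a function: the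
  pair \<open>(g, b)\<close> stands for \<open>g\<close> times the derivative along \<open>b\<close>.\<close>

fun leibniz_terms :: "'n::finite list \<Rightarrow> (real^'n \<Rightarrow> real) \<Rightarrow> ((real^'n \<Rightarrow> real) \<times> 'n list) list"
  where
    "leibniz_terms [] h = [(h, [])]"
  | "leibniz_terms (i # is) h =
      leibniz_terms is (partial i h) @ map (\<lambda>(g, b). (g, i # b)) (leibniz_terms is h)"

lemma leibniz_terms_props:
  assumes "h \<in> test_functions \<Omega>" "(g, b) \<in> set (leibniz_terms is h)"
  shows "g \<in> test_functions \<Omega> \<and> length b \<le> length is"
  using assms
proof (induction "is" arbitrary: h b)
  case (Cons i "is")
  from Cons.prems(2) consider "(g, b) \<in> set (leibniz_terms is (partial i h))"
    | b' where "b = i # b'" "(g, b') \<in> set (leibniz_terms is h)" by auto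
  then show ?case
  proof cases
    case 1
    from Cons.IH[OF test_functions_partial[OF Cons.prems(1)] this] show ?thesis by simp
  next
    case 2
    from Cons.IH[OF Cons.prems(1) this(2)] show ?thesis by (simp add: 2(1))
  qed
qed auto

text \<open>One direction at a time: \<open>h \<partial>\<^sub>i \<psi> = \<partial>\<^sub>i (h \<psi>) - (\<partial>\<^sub>i h) \<psi>\<close>. In the first term the derivative
  passes to the function, whose family of derivatives becomes \<open>b \<mapsto> f (i # b)\<close>; in the second one
  \<open>h\<close> is replaced by its derivative.\<close>

lemma leibniz_weak_derivs:
  fixes h \<phi> :: "real^'n::finite \<Rightarrow> real"
  assumes "weak_derivs \<Omega> k f" "length is \<le> k" "h \<in> test_functions \<Omega>" "smooth_on UNIV \<phi>"
  shows "(LINT x:\<Omega>|lborel. f [] x * (h x * foldr partial is \<phi> x)) = (-1) ^ length is *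
    (\<Sum>(g, b)\<leftarrow>leibniz_terms is h. LINT x:\<Omega>|lborel. f b x * (g x * \<phi> x))"
  using assms(1,2,3)
proof (induction "is" arbitrary: f h k)
  case (Cons i "is")
  define \<psi> where "\<psi> = foldr partial is \<phi>"
  have \<psi>: "smooth_on UNIV \<psi>" unfolding \<psi>_def by (rule smooth_partials[OF assms(4)])
  have h: "smooth_on UNIV h" using Cons.prems(3) by (rule test_functions_smooth)
  have t1: "(\<lambda>x. h x * \<psi> x) \<in> test_functions \<Omega>" by (rule test_functions_mult[OF Cons.prems(3) \<psi>])
  have t2: "(\<lambda>x. partial i h x * \<psi> x) \<in> test_functions \<Omega>"
    by (rule test_functions_mult[OF test_functions_partial[OF Cons.prems(3)] \<psi>])
  obtain k' where k: "k = Suc k'" using Cons.prems(2) by (cases k) auto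
  have loc: "locally_integrable_on \<Omega> (f [])" using Cons.prems(1) by (simp add: weak_derivs_def)
  have "(LINT x:\<Omega>|lborel. f [] x * (h x * foldr partial (i # is) \<phi> x))
      = (LINT x:\<Omega>|lborel. f [] x * partial i (\<lambda>x. h x * \<psi> x) x - f [] x * (partial i h x * \<psi> x))"
  proof -
    have "f [] x * (h x * foldr partial (i # is) \<phi> x)
        = f [] x * partial i (\<lambda>x. h x * \<psi> x) x - f [] x * (partial i h x * \<psi> x)" for x
      unfolding partial_mult[OF h \<psi>] by (simp add: \<psi>_def[symmetric] algebra_simps)
    then show ?thesis by simp
  qed
  also have "\<dots> = (LINT x:\<Omega>|lborel. f [] x * partial i (\<lambda>x. h x * \<psi> x) x) - (LINT x:\<Omega>|lborel. f []
      x * (partial i h x * \<psi> x))"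
    by (rule set_integral_diff(2)[OF integrable_mult_test[OF loc test_functions_partial[OF t1]]
        integrable_mult_test[OF loc t2]])
  also have "(LINT x:\<Omega>|lborel. f [] x * partial i (\<lambda>x. h x * \<psi> x) x)
      = - (LINT x:\<Omega>|lborel. f [i] x * (h x * \<psi> x))"
    using weak_derivs_snoc[OF Cons.prems(1) _ t1, of "[]" i] k by simp
  also have "(LINT x:\<Omega>|lborel. f [i] x * (h x * \<psi> x)) = (-1) ^ length is *
      (\<Sum>(g, b)\<leftarrow>leibniz_terms is h. LINT x:\<Omega>|lborel. f (i # b) x * (g x * \<phi> x))"
    using Cons.IH[OF weak_derivs_Cons[OF Cons.prems(1)[unfolded k]] _ Cons.prems(3)]
        Cons.prems(2) k by (simp add: \<psi>_def)
  also have "(LINT x:\<Omega>|lborel. f [] x * (partial i h x * \<psi> x)) = (-1) ^ length is *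
      (\<Sum>(g, b)\<leftarrow>leibniz_terms is (partial i h). LINT x:\<Omega>|lborel. f b x * (g x * \<phi> x))"
    using Cons.IH[OF Cons.prems(1) _ test_functions_partial[OF Cons.prems(3)]] Cons.prems(2)
        by (simp add: \<psi>_def)
  finally show ?case
    by (simp add: o_def case_prod_unfold algebra_simps)
qed simp

text \<open>\<open>f\<close> consists of densities of weak derivatives up to order \<open>k\<close>, whose \<open>p\<close>-th power integrals
  and, at order \<open>k\<close>, Slobodeckij double integrals over \<open>\<Omega>\<close> are at most \<open>J\<close>.\<close>

definition sobolev_bounded ::
    "(real^'n::finite) set \<Rightarrow> nat \<Rightarrow> real \<Rightarrow> real \<Rightarrow> ennreal \<Rightarrow> ('n list \<Rightarrow> real^'n \<Rightarrow> real) \<Rightarrow> bool"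
  where "sobolev_bounded \<Omega> k \<theta> p J f \<longleftrightarrow> weak_derivs \<Omega> k f \<and>
    (\<forall>is. length is \<le> k \<longrightarrow> power_integral p (\<lambda>x. indicator \<Omega> x * f is x) \<le> J) \<and>
    (\<theta> \<noteq> 0 \<longrightarrow> (\<forall>is. length is = k \<longrightarrow>
      (\<integral>\<^sup>+z\<in>\<Omega> \<times> \<Omega>. ennreal (\<bar>f is (fst z) - f is (snd z)\<bar> powr p /
        norm (fst z - snd z) powr (real CARD('n) + \<theta> * p)) \<partial>(lborel \<Otimes>\<^sub>M lborel)) \<le> J))"

lemma power_integral_mult_bounded:
  assumes "\<And>x. \<bar>g x\<bar> \<le> M" "\<And>x. x \<notin> \<Omega> \<Longrightarrow> g x = 0" "0 < p"
    and "(\<lambda>x. indicator \<Omega> x * f x) \<in> borel_measurable borel"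
    and "power_integral p (\<lambda>x. indicator \<Omega> x * f x) \<le> J"
  shows "power_integral p (\<lambda>x. g x * f x) \<le> ennreal (M powr p) * J"
proof -
  have "power_integral p (\<lambda>x. g x * f x) \<le> (\<integral>\<^sup>+x. ennreal (M powr p) * ennreal (\<bar>indicator \<Omega> x *
      f x\<bar> powr p) \<partial>lborel)"
    unfolding power_integral_def
  proof (rule nn_integral_mono)
    fix x
    have "\<bar>g x * f x\<bar> powr p \<le> M powr p * \<bar>indicator \<Omega> x * f x\<bar> powr p"
      using assms(1)[of x] assms(2)[of x] assms(3)
      by (cases "x \<in> \<Omega>") (auto simp: abs_mult powr_mult intro!: mult_right_mono powr_mono2)
    then show "ennreal (\<bar>g x * f x\<bar> powr p) \<le> ennreal (M powr p) * ennreal (\<bar>indicator \<Omega> x * f x\<bar>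
        powr p)"
      by (simp add: ennreal_mult'[symmetric] ennreal_leI)
  qed
  also have "\<dots> = ennreal (M powr p) * power_integral p (\<lambda>x. indicator \<Omega> x * f x)"
    unfolding power_integral_def using assms(4) by (intro nn_integral_cmult) simp
  also have "\<dots> \<le> ennreal (M powr p) * J" by (intro mult_left_mono assms(5)) simp
  finally show ?thesis .
qed

lemma power_integral_add:
  assumes [measurable]: "F \<in> borel_measurable borel" "G \<in> borel_measurable borel" and "0 < p"
  shows "power_integral p (\<lambda>x. F x + G x) \<le> ennreal (2 powr p) * (power_integral p F +
      power_integral p G)"
proof -
  have "power_integral p (\<lambda>x. F x + G x) \<le> (\<integral>\<^sup>+x. ennreal (2 powr p) * (ennreal (\<bar>F x\<bar> powr p) +
      ennreal (\<bar>G x\<bar> powr p)) \<partial>lborel)"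
    unfolding power_integral_def
    using powr_abs_add_le[OF assms(3)]
    by (intro nn_integral_mono) (simp add: ennreal_mult'[symmetric] ennreal_plus[symmetric]
        ennreal_leI del: ennreal_plus)
  also have "\<dots> = ennreal (2 powr p) * (power_integral p F + power_integral p G)"
    unfolding power_integral_def by (simp add: nn_integral_cmult nn_integral_add)
  finally show ?thesis .
qed

lemma gagliardo_add:
  fixes F G :: "real^'n::finite \<Rightarrow> real"
  assumes [measurable]: "F \<in> borel_measurable borel" "G \<in> borel_measurable borel" and "0 < p"
  shows "gagliardo \<theta> p (\<lambda>x. F x + G x) \<le> ennreal (2 powr p) * (gagliardo \<theta> p F + gagliardo \<theta> p G)"
proof -
  let ?N = "\<lambda>z::(real^'n) \<times> (real^'n). norm (fst z - snd z) powr (real CARD('n) + \<theta> * p)"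
  have "gagliardo \<theta> p (\<lambda>x. F x + G x) \<le> (\<integral>\<^sup>+z. ennreal (2 powr p) * (ennreal (\<bar>F (fst z) - F (snd
      z)\<bar> powr p / ?N z)
      + ennreal (\<bar>G (fst z) - G (snd z)\<bar> powr p / ?N z)) \<partial>(lborel \<Otimes>\<^sub>M lborel))"
    unfolding gagliardo_def
  proof (rule nn_integral_mono)
    fix z :: "(real^'n) \<times> (real^'n)"
    have "\<bar>F (fst z) + G (fst z) - (F (snd z) + G (snd z))\<bar> powr p
        \<le> 2 powr p * (\<bar>F (fst z) - F (snd z)\<bar> powr p + \<bar>G (fst z) - G (snd z)\<bar> powr p)"
      using powr_abs_add_le[OF assms(3), of "F (fst z) - F (snd z)" "G (fst z) - G (snd z)"]
      by (simp add: algebra_simps)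
    then have "\<bar>F (fst z) + G (fst z) - (F (snd z) + G (snd z))\<bar> powr p / ?N z
        \<le> 2 powr p * (\<bar>F (fst z) - F (snd z)\<bar> powr p / ?N z + \<bar>G (fst z) - G (snd z)\<bar> powr p / ?N
            z)"
    proof -
      assume "\<bar>F (fst z) + G (fst z) - (F (snd z) + G (snd z))\<bar> powr p
        \<le> 2 powr p * (\<bar>F (fst z) - F (snd z)\<bar> powr p + \<bar>G (fst z) - G (snd z)\<bar> powr p)"
      from divide_right_mono[OF this, of "?N z"] show ?thesis
        by (simp add: add_divide_distrib distrib_left)
    qed
    then show "ennreal (\<bar>F (fst z) + G (fst z) - (F (snd z) + G (snd z))\<bar> powr p / ?N z)
        \<le> ennreal (2 powr p) * (ennreal (\<bar>F (fst z) - F (snd z)\<bar> powr p / ?N z) + ennreal (\<bar>G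
            (fst z) - G (snd z)\<bar> powr p / ?N z))"
      by (simp add: ennreal_mult'[symmetric] ennreal_plus[symmetric] ennreal_leI del: ennreal_plus)
  qed
  also have "\<dots> = ennreal (2 powr p) * (gagliardo \<theta> p F + gagliardo \<theta> p G)"
    unfolding gagliardo_def by (simp add: nn_integral_cmult nn_integral_add)
  finally show ?thesis .
qed

lemma integrable_test_mult:
  assumes "locally_integrable_on \<Omega> f" "g \<in> test_functions \<Omega>"
  shows "integrable lborel (\<lambda>x. g x * f x)"
proof -
  have "(\<lambda>x. indicator \<Omega> x *\<^sub>R (f x * g x)) = (\<lambda>x. g x * f x)"
    using test_functions_outside[OF assms(2)] by (auto simp: fun_eq_iff indicator_def)
  then show ?thesis
    using integrable_mult_test[OF assms] by (simp add: set_integrable_def)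
qed

lemma test_mult_borel:
  assumes "locally_integrable_on \<Omega> f" "g \<in> test_functions \<Omega>"
  shows "(\<lambda>x. g x * f x) \<in> borel_measurable borel"
  using borel_measurable_integrable[OF integrable_test_mult[OF assms]] by simp

lemma integral_test_mult:
  assumes "g \<in> test_functions \<Omega>"
  shows "(\<integral>x. g x * f x * \<phi> x \<partial>lborel) = (LINT x:\<Omega>|lborel. f x * (g x * \<phi> x))"
  unfolding set_lebesgue_integral_def
  by (intro Bochner_Integration.integral_cong refl)
    (use test_functions_outside[OF assms] in \<open>auto simp: indicator_def\<close>)

text \<open>A test function of \<open>\<Omega>\<close> times a weakly differentiable function on \<open>\<Omega>\<close> is weakly
  differentiable on the whole space, for a test function of the whole space times \<open>g\<close> is one of
  \<open>\<Omega>\<close>.\<close>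

lemma weak_gradient_test_mult:
  assumes wd: "weak_derivs \<Omega> k f" and len: "length b < k" and g: "g \<in> test_functions \<Omega>"
  shows "weak_gradient (\<lambda>x. g x * f b x) (\<lambda>i x. partial i g x * f b x + g x * f (b @ [i]) x)"
  unfolding weak_gradient_def
proof (intro conjI allI ballI)
  have loc: "locally_integrable_on \<Omega> (f b)" "\<And>i. locally_integrable_on \<Omega> (f (b @ [i]))"
    using wd len by (auto simp: weak_derivs_def)
  note dg = test_functions_partial[OF g]
  show "integrable lborel (\<lambda>x. g x * f b x)" by (rule integrable_test_mult[OF loc(1) g])
  show "integrable lborel (\<lambda>x. partial i g x * f b x + g x * f (b @ [i]) x)" for i
    by (rule Bochner_Integration.integrable_add[OF integrable_test_mult[OF loc(1) dg]
        integrable_test_mult[OF loc(2) g]])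
  fix i and \<phi> :: "real^'a \<Rightarrow> real" assume \<phi>: "\<phi> \<in> test_functions UNIV"
  have s: "smooth_on UNIV \<phi>" "smooth_on UNIV g" "smooth_on UNIV (partial i \<phi>)"
    using \<phi> g test_functions_smooth smooth_partial by blast+
  note t = test_functions_mult[OF g s(1)] test_functions_mult[OF dg s(1)] test_functions_mult[OF
      g s(3)]
  have e: "partial i (\<lambda>x. g x * \<phi> x) = (\<lambda>x. partial i g x * \<phi> x + g x * partial i \<phi> x)"
    by (rule partial_mult[OF s(2,1)])
  have "(\<integral>x. g x * f b x * partial i \<phi> x \<partial>lborel) = (LINT x:\<Omega>|lborel. f b x * (g x * partial i \<phi>
      x))"
    by (rule integral_test_mult[OF g])
  also have "\<dots> = (LINT x:\<Omega>|lborel. f b x * partial i (\<lambda>x. g x * \<phi> x) x - f b x * (partial i g x *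
      \<phi> x))"
  proof -
    have "f b x * (g x * partial i \<phi> x) = f b x * partial i (\<lambda>x. g x * \<phi> x) x - f b x * (partial
        i g x * \<phi> x)" for x
      unfolding e by (simp add: algebra_simps)
    then show ?thesis by simp
  qed
  also have "\<dots> = (LINT x:\<Omega>|lborel. f b x * partial i (\<lambda>x. g x * \<phi> x) x) - (LINT x:\<Omega>|lborel. f b x
      * (partial i g x * \<phi> x))"
    by (rule set_integral_diff(2)[OF integrable_mult_test[OF loc(1) test_functions_partial[OF
        t(1)]] integrable_mult_test[OF loc(1) t(2)]])
  also have "(LINT x:\<Omega>|lborel. f b x * partial i (\<lambda>x. g x * \<phi> x) x)
      = - (LINT x:\<Omega>|lborel. f (b @ [i]) x * (g x * \<phi> x))"
    by (rule weak_derivs_snoc[OF wd len t(1)])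
  finally have 1: "(\<integral>x. g x * f b x * partial i \<phi> x \<partial>lborel)
      = - (\<integral>x. g x * f (b @ [i]) x * \<phi> x \<partial>lborel) - (\<integral>x. partial i g x * f b x * \<phi> x \<partial>lborel)"
    by (simp only: integral_test_mult[OF g] integral_test_mult[OF dg])
  have i: "integrable lborel (\<lambda>x. g x * f (b @ [i]) x * \<phi> x)"
      "integrable lborel (\<lambda>x. partial i g x * f b x * \<phi> x)"
    using integrable_test_mult[OF loc(2) t(1)] integrable_test_mult[OF loc(1) t(2)]
        by (simp_all add: mult_ac)
  show "(\<integral>x. g x * f b x * partial i \<phi> x \<partial>lborel) = - (\<integral>x. (partial i g x * f b x + g x * f (b @
      [i]) x) * \<phi> x \<partial>lborel)"
    unfolding 1 using i by (simp add: distrib_right)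
qed

text \<open>At order \<open>k\<close> differences of \<open>f b\<close> are controlled on \<open>\<Omega>\<close>; at lower order they are not, but
  there is one more derivative, and \<open>g f\<close> is weakly differentiable on the whole space.\<close>

lemma sobolev_bounded_test_mult:
  fixes g :: "real^'n::finite \<Rightarrow> real"
  assumes g: "g \<in> test_functions \<Omega>" and \<theta>: "0 \<le> \<theta>" "\<theta> < 1" "1 < p" and \<Omega>: "open \<Omega>"
  obtains C where "0 \<le> C" "\<And>f J b. sobolev_bounded \<Omega> k \<theta> p J f \<Longrightarrow> length b \<le> k \<Longrightarrow>
    power_integral p (\<lambda>x. g x * f b x) \<le> ennreal C * J \<and>
    (\<theta> \<noteq> 0 \<longrightarrow> gagliardo \<theta> p (\<lambda>x. g x * f b x) \<le> ennreal C * J)"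
proof -
  have p: "0 < p" using \<theta> by simp
  obtain M where M: "0 < M" "\<And>x. \<bar>g x\<bar> \<le> M" using test_functions_bounded[OF g] by metis
  have "\<forall>i. \<exists>N>0. \<forall>x. \<bar>partial i g x\<bar> \<le> N"
    using test_functions_bounded[OF test_functions_partial[OF g]] by metis
  then obtain N where N: "\<And>i. 0 < N i" "\<And>i x. \<bar>partial i g x\<bar> \<le> N i" by metis
  define N' where "N' = (\<Sum>i\<in>UNIV. N i)"
  have N': "\<bar>partial i g x\<bar> \<le> N'" "0 \<le> N'" for i x
  proof -
    have "N i \<le> N'" unfolding N'_def using N(1) by (intro member_le_sum) (auto simp: less_imp_le)
    then show "\<bar>partial i g x\<bar> \<le> N'" "0 \<le> N'" using N(2)[of i x] N(1)[of i] by auto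
  qed
  define C0 where "C0 = M powr p + 2 powr p * (N' powr p + M powr p)"
  have C0: "0 \<le> C0" "M powr p \<le> C0" "2 powr p * (N' powr p + M powr p) \<le> C0" by (auto simp: C0_def)
  have bnd: "power_integral p (\<lambda>x. h x * f b x) \<le> ennreal (K powr p) * J"
    if "h \<in> test_functions \<Omega>" "\<And>x. \<bar>h x\<bar> \<le> K" "sobolev_bounded \<Omega> k \<theta> p J f" "length b \<le> k"
        for h K f b J
    using that p \<Omega> unfolding sobolev_bounded_def
    by (intro power_integral_mult_bounded[of h K \<Omega>] locally_integrable_borel)
      (auto dest: weak_derivs_locally_integrable test_functions_outside)
  obtain C1 where C1: "\<theta> \<noteq> 0 \<Longrightarrow> 0 \<le> C1" "\<And>f J. \<theta> \<noteq> 0 \<Longrightarrow> (\<lambda>x. indicator \<Omega> x * f x)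
      \<in> borel_measurable borel \<Longrightarrow>
      power_integral p (\<lambda>x. indicator \<Omega> x * f x) \<le> J \<Longrightarrow>
      (\<integral>\<^sup>+z\<in>\<Omega> \<times> \<Omega>. ennreal (\<bar>f (fst z) - f (snd z)\<bar> powr p /
        norm (fst z - snd z) powr (real CARD('n) + \<theta> * p)) \<partial>(lborel \<Otimes>\<^sub>M lborel)) \<le> J \<Longrightarrow>
      gagliardo \<theta> p (\<lambda>x. g x * f x) \<le> ennreal C1 * J"
  proof (cases "\<theta> = 0")
    case False
    then have "0 < \<theta>" using \<theta> by simp
    show ?thesis
    proof (rule gagliardo_test_mult[OF g \<open>0 < \<theta>\<close> \<theta>(2,3) \<Omega>], goal_cases)
      case (1 C)
      show ?case by (rule that[of C]) (use 1 in blast)+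
    qed
  qed (use that in blast)
  obtain C2 where C2: "\<theta> \<noteq> 0 \<Longrightarrow> 0 \<le> C2" "\<And>(F :: real^'n \<Rightarrow> real) D J. \<theta> \<noteq> 0 \<Longrightarrow> weak_gradient F D \<Longrightarrow>
    power_integral p F \<le> J \<Longrightarrow> (\<And>i. power_integral p (D i) \<le> J) \<Longrightarrow> gagliardo \<theta> p F \<le> ennreal C2 * J"
  proof (cases "\<theta> = 0")
    case False
    then have "0 < \<theta>" using \<theta> by simp
    show ?thesis
    proof (rule gagliardo_weak_gradient[where 'n = 'n, OF \<open>0 < \<theta>\<close> \<theta>(2,3)], goal_cases)
      case (1 C)
      show ?case by (rule that[of C]) (use 1 in blast)+
    qed
  qed (use that in blast)
  define C where "C = C0 + max 0 C1 + max 0 C2 * C0"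
  have CC: "C0 \<le> C" "C1 \<le> C" "C2 * C0 \<le> C"
    using C0(1) mult_right_mono[of C2 "max 0 C2" C0]
        by (auto simp: C_def max_def add_increasing2 split: if_splits)
  show ?thesis
  proof (rule that[of C])
    show "0 \<le> C" using C0 CC by linarith
    fix f :: "'n list \<Rightarrow> real^'n \<Rightarrow> real" and J and b :: "'n list"
    assume f: "sobolev_bounded \<Omega> k \<theta> p J f" and len: "length b \<le> k"
    have wd: "weak_derivs \<Omega> k f" using f by (simp add: sobolev_bounded_def)
    have P: "power_integral p (\<lambda>x. g x * f b x) \<le> ennreal C0 * J"
      by (rule order_trans[OF bnd[OF g M(2) f len]]) (intro mult_right_mono ennreal_leI C0, simp)
    have "gagliardo \<theta> p (\<lambda>x. g x * f b x) \<le> ennreal C * J" if \<theta>0: "\<theta> \<noteq> 0"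
    proof (cases "length b = k")
      case True
      have "gagliardo \<theta> p (\<lambda>x. g x * f b x) \<le> ennreal C1 * J"
        using f len True \<theta>0 unfolding sobolev_bounded_def
        by (intro C1(2) locally_integrable_borel[OF \<Omega>]) (auto dest: weak_derivs_locally_integrable)
      also have "\<dots> \<le> ennreal C * J" by (intro mult_right_mono ennreal_leI CC) simp
      finally show ?thesis .
    next
      case False
      then have lt: "length b < k" using len by simp
      have "power_integral p (\<lambda>x. partial i g x * f b x + g x * f (b @ [i]) x) \<le> ennreal C0 * J"
          for i
      proof -
        have "power_integral p (\<lambda>x. partial i g x * f b x + g x * f (b @ [i]) x)
            \<le> ennreal (2 powr p) * (power_integral p (\<lambda>x. partial i g x * f b x) + power_integral
                p (\<lambda>x. g x * f (b @ [i]) x))"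
          using lt weak_derivs_locally_integrable[OF wd]
          by (intro power_integral_add[OF test_mult_borel[of \<Omega>] test_mult_borel[of \<Omega>] p]
              test_functions_partial[OF g] g)
            auto
        also have "\<dots> \<le> ennreal (2 powr p) * (ennreal (N' powr p) * J + ennreal (M powr p) * J)"
          using lt by (intro mult_left_mono add_mono bnd[OF _ _ f] test_functions_partial[OF g] g
              N' M) auto
        also have "\<dots> = ennreal (2 powr p * (N' powr p + M powr p)) * J"
          by (simp add: ennreal_mult distrib_right distrib_left mult.assoc)
        also have "\<dots> \<le> ennreal C0 * J" by (intro mult_right_mono ennreal_leI C0) simp
        finally show ?thesis .
      qed
      then have "gagliardo \<theta> p (\<lambda>x. g x * f b x) \<le> ennreal C2 * (ennreal C0 * J)"
        using weak_gradient_test_mult[OF wd lt g] by (intro C2(2)[OF \<theta>0 _ P]) auto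
      also have "\<dots> = ennreal (C2 * C0) * J" using C2(1)[OF \<theta>0] C0
          by (simp add: ennreal_mult mult.assoc)
      also have "\<dots> \<le> ennreal C * J" by (intro mult_right_mono ennreal_leI CC) simp
      finally show ?thesis .
    qed
    moreover have "power_integral p (\<lambda>x. g x * f b x) \<le> ennreal C * J"
      by (rule order_trans[OF P]) (intro mult_right_mono ennreal_leI CC, simp)
    ultimately show "power_integral p (\<lambda>x. g x * f b x) \<le> ennreal C * J \<and>
      (\<theta> \<noteq> 0 \<longrightarrow> gagliardo \<theta> p (\<lambda>x. g x * f b x) \<le> ennreal C * J)" by blast
  qed
qed

section \<open>Multiplication by a cutoff function, nonnegative smoothness\<close>

text \<open>The product of the distribution \<open>u\<close> with \<open>h\<close>, as a distribution on another open set \<open>\<Omega>\<close>; to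
  be used for \<open>h\<close> supported in the intersection of \<open>\<Omega>\<close> with the open set on which \<open>u\<close> lives.\<close>

definition cutoff_distr ::
    "(real^'n::finite) set \<Rightarrow> (real^'n \<Rightarrow> real) \<Rightarrow> ((real^'n \<Rightarrow> real) \<Rightarrow> real) \<Rightarrow> (real^'n \<Rightarrow> real) \<Rightarrow> real"
  where "cutoff_distr \<Omega> h u \<phi> = (if \<phi> \<in> test_functions \<Omega> then u (\<lambda>x. h x * \<phi> x) else 0)"

lemma distr_deriv_count_list:
  assumes "\<phi> \<in> test_functions \<Omega>"
  shows "distr_deriv \<Omega> (count_list is) u \<phi> = (-1) ^ length is * u (foldr partial is \<phi>)"
  using assms multi_partial_eq_partials[OF test_functions_smooth[OF assms] refl]
  by (simp add: distr_deriv_def order_mi_count_list)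

lemma regular_distr_test: "\<phi> \<in> test_functions \<Omega> \<Longrightarrow> regular_distr \<Omega> f \<phi>
    = (LINT x:\<Omega>|lborel. f x * \<phi> x)"
  by (simp add: regular_distr_def)

text \<open>One density is chosen for each multi-index and used for all lists of directions with these
  multiplicities.\<close>

lemma sobolev_norm_nonneg_le_obtain:
  fixes u :: "(real^'n::finite \<Rightarrow> real) \<Rightarrow> real"
  assumes \<Omega>: "open \<Omega>" and p: "1 < p" and s: "0 \<le> s"
    and u: "sobolev_norm_nonneg \<Omega> t p u \<le> ennreal s"
  obtains f where "sobolev_bounded \<Omega> (nat \<lfloor>t\<rfloor>) (frac t) p (ennreal (s powr p)) f"
    "\<And>\<phi>. \<phi> \<in> test_functions \<Omega> \<Longrightarrow> u \<phi> = (LINT x:\<Omega>|lborel. f [] x * \<phi> x)"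
proof -
  define k where "k = nat \<lfloor>t\<rfloor>"
  define \<theta> where "\<theta> = frac t"
  have p0: "0 < p" using p by simp
  have Lp: "on_density \<Omega> (Lp_norm \<Omega> p) (distr_deriv \<Omega> \<nu> u) \<le> ennreal s" if "order_mi \<nu> \<le> k" for \<nu>
  proof -
    have "on_density \<Omega> (Lp_norm \<Omega> p) (distr_deriv \<Omega> \<nu> u)
        \<le> (\<Sum>\<nu> | order_mi \<nu> \<le> k. on_density \<Omega> (Lp_norm \<Omega> p) (distr_deriv \<Omega> \<nu> u))"
      using that finite_order_mi by (intro member_le_sum) auto
    also have "\<dots> \<le> sobolev_norm_nonneg \<Omega> t p u"
      unfolding sobolev_norm_nonneg_def k_def Let_def by (rule add_increasing2) auto
    finally show ?thesis using u by (rule order_trans)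
  qed
  have Sl: "on_density \<Omega> (slobodeckij_seminorm \<Omega> \<theta> p) (distr_deriv \<Omega> \<nu> u) \<le> ennreal s"
    if "order_mi \<nu> = k" "\<theta> \<noteq> 0" for \<nu>
  proof -
    have "on_density \<Omega> (slobodeckij_seminorm \<Omega> \<theta> p) (distr_deriv \<Omega> \<nu> u)
        \<le> (\<Sum>\<nu> | order_mi \<nu> = k. on_density \<Omega> (slobodeckij_seminorm \<Omega> \<theta> p) (distr_deriv \<Omega> \<nu> u))"
      using that finite_order_mi_eq by (intro member_le_sum) auto
    also have "\<dots> \<le> sobolev_norm_nonneg \<Omega> t p u"
      using that(2) unfolding sobolev_norm_nonneg_def k_def \<theta>_def Let_def
          by (simp add: add_increasing)
    finally show ?thesis using u by (rule order_trans)
  qed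
  have "\<forall>\<nu>. order_mi \<nu> \<le> k \<longrightarrow> (\<exists>f. locally_integrable_on \<Omega> f \<and> regular_distr \<Omega> f
      = distr_deriv \<Omega> \<nu> u)"
    using on_density_finite_obtain order_le_less_trans[OF Lp ennreal_less_top]
        by (metis infinity_ennreal_def)
  then obtain f0 where f0: "\<And>\<nu>. order_mi \<nu> \<le> k \<Longrightarrow> locally_integrable_on \<Omega> (f0 \<nu>)"
    "\<And>\<nu>. order_mi \<nu> \<le> k \<Longrightarrow> regular_distr \<Omega> (f0 \<nu>) = distr_deriv \<Omega> \<nu> u"
    by metis
  define f where "f is = f0 (count_list is)" for "is" :: "'n list"
  have loc: "locally_integrable_on \<Omega> (f is)" if "length is \<le> k" for "is"
    using f0(1) that by (simp add: f_def order_mi_count_list)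
  have reg: "regular_distr \<Omega> (f is) = distr_deriv \<Omega> (count_list is) u" if "length is \<le> k" for "is"
    using f0(2) that by (simp add: f_def order_mi_count_list)
  have rep: "(LINT x:\<Omega>|lborel. f is x * \<phi> x) = (-1) ^ length is * u (foldr partial is \<phi>)"
    if "length is \<le> k" "\<phi> \<in> test_functions \<Omega>" for "is" \<phi>
    using fun_cong[OF reg[OF that(1)], of \<phi>] that(2)
        by (simp add: regular_distr_test distr_deriv_count_list)
  show ?thesis
  proof (rule that)
    show "u \<phi> = (LINT x:\<Omega>|lborel. f [] x * \<phi> x)" if "\<phi> \<in> test_functions \<Omega>" for \<phi>
      using rep[of "[]" \<phi>] that by simp
    have "weak_derivs \<Omega> k f"
      unfolding weak_derivs_def
    proof (intro allI impI conjI ballI)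
      fix "is" :: "'n list" and \<phi> assume len: "length is \<le> k" and \<phi>: "\<phi> \<in> test_functions \<Omega>"
      have "(LINT x:\<Omega>|lborel. f [] x * foldr partial is \<phi> x) = u (foldr partial is \<phi>)"
        using rep[of "[]" "foldr partial is \<phi>"] test_functions_partials[OF \<phi>] by simp
      also have "\<dots> = (-1) ^ length is * (LINT x:\<Omega>|lborel. f is x * \<phi> x)"
        using rep[OF len \<phi>] by (simp flip: mult.assoc power_mult_distrib)
      finally show "(LINT x:\<Omega>|lborel. f [] x * foldr partial is \<phi> x)
          = (-1) ^ length is * (LINT x:\<Omega>|lborel. f is x * \<phi> x)" .
    qed (rule loc)
    moreover have "power_integral p (\<lambda>x. indicator \<Omega> x * f is x) \<le> ennreal (s powr p)" if
        "length is \<le> k" for "is"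
      using Lp[of "count_list is"] on_density_Lp[OF \<Omega> loc[OF that] reg[OF that], of p] that
      by (simp add: order_mi_count_list Lp_norm_eq_power_integral[OF p0] ennroot_le_iff[OF p0 s])
    moreover have "(\<integral>\<^sup>+z\<in>\<Omega> \<times> \<Omega>. ennreal (\<bar>f is (fst z) - f is (snd z)\<bar> powr p /
        norm (fst z - snd z) powr (real CARD('n) + \<theta> * p)) \<partial>(lborel \<Otimes>\<^sub>M lborel))
            \<le> ennreal (s powr p)"
      if "length is = k" "\<theta> \<noteq> 0" for "is"
      using Sl[of "count_list is"] that on_density_slobodeckij[OF \<Omega> loc reg, of "is" \<theta> p]
      by (simp add: order_mi_count_list slobodeckij_seminorm_def ennroot_le_iff[OF p0 s])
    ultimately have "sobolev_bounded \<Omega> k \<theta> p (ennreal (s powr p)) f"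
      unfolding sobolev_bounded_def by blast
    then show "sobolev_bounded \<Omega> (nat \<lfloor>t\<rfloor>) (frac t) p (ennreal (s powr p)) f"
      unfolding k_def \<theta>_def .
  qed
qed

definition leibniz_sum ::
    "((real^'n::finite \<Rightarrow> real) \<times> 'n list) list \<Rightarrow> ('n list \<Rightarrow> real^'n \<Rightarrow> real) \<Rightarrow> real^'n \<Rightarrow> real"
  where "leibniz_sum T f x = (\<Sum>(g, b)\<leftarrow>T. g x * f b x)"

lemma leibniz_sum_simps:
  "leibniz_sum [] f = (\<lambda>x. 0)"
  "leibniz_sum ((g, b) # T) f = (\<lambda>x. g x * f b x + leibniz_sum T f x)"
  by (auto simp: leibniz_sum_def)

lemma leibniz_sum_integral:
  fixes f :: "'n::finite list \<Rightarrow> real^'n \<Rightarrow> real"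
  assumes wd: "weak_derivs \<Omega>1 k f" and \<phi>: "\<phi> \<in> test_functions \<Omega>2"
    and T: "\<And>g b. (g, b) \<in> set T \<Longrightarrow> g \<in> test_functions (\<Omega>1 \<inter> \<Omega>2) \<and> length b \<le> k"
  shows "integrable lborel (leibniz_sum T f)"
    and "(LINT x:\<Omega>2|lborel. leibniz_sum T f x * \<phi> x)
        = (\<Sum>(g, b)\<leftarrow>T. LINT x:\<Omega>1|lborel. f b x * (g x * \<phi> x))"
proof -
  have "integrable lborel (leibniz_sum T f) \<and> integrable lborel (\<lambda>x. leibniz_sum T f x * \<phi> x) \<and>
    (\<integral>x. leibniz_sum T f x * \<phi> x \<partial>lborel) = (\<Sum>(g, b)\<leftarrow>T. LINT x:\<Omega>1|lborel. f b x * (g x * \<phi> x))"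
    using T
  proof (induction T)
    case (Cons a T)
    obtain g b where a: "a = (g, b)" by (cases a)
    have g: "g \<in> test_functions (\<Omega>1 \<inter> \<Omega>2)" "length b \<le> k" using Cons.prems a by auto
    have g1: "g \<in> test_functions \<Omega>1" using g(1) test_functions_mono[of "\<Omega>1 \<inter> \<Omega>2" \<Omega>1] by blast
    have loc: "locally_integrable_on \<Omega>1 (f b)" by (rule weak_derivs_locally_integrable[OF wd g(2)])
    have i1: "integrable lborel (\<lambda>x. g x * f b x)" by (rule integrable_test_mult[OF loc g1])
    have i2: "integrable lborel (\<lambda>x. g x * f b x * \<phi> x)"
      using integrable_test_mult[OF loc test_functions_mult[OF g1 test_functions_smooth[OF \<phi>]]]
          by (simp add: mult_ac)
    have IH: "integrable lborel (leibniz_sum T f)" "integrable lborel (\<lambda>x. leibniz_sum T f x * \<phi> x)"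
      "(\<integral>x. leibniz_sum T f x * \<phi> x \<partial>lborel) = (\<Sum>(g, b)\<leftarrow>T. LINT x:\<Omega>1|lborel. f b x * (g x * \<phi> x))"
      using Cons.IH Cons.prems by auto
    show ?case
      using i1 i2 IH integral_test_mult[OF g1, of "f b" \<phi>]
      by (simp add: a leibniz_sum_simps distrib_right)
  qed (simp add: leibniz_sum_simps)
  note * = this
  then show "integrable lborel (leibniz_sum T f)" by blast
  have "(\<lambda>x. indicator \<Omega>2 x *\<^sub>R (leibniz_sum T f x * \<phi> x)) = (\<lambda>x. leibniz_sum T f x * \<phi> x)"
    using test_functions_outside[OF \<phi>] by (auto simp: fun_eq_iff indicator_def)
  then show "(LINT x:\<Omega>2|lborel. leibniz_sum T f x * \<phi> x)
      = (\<Sum>(g, b)\<leftarrow>T. LINT x:\<Omega>1|lborel. f b x * (g x * \<phi> x))"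
    using * by (simp add: set_lebesgue_integral_def)
qed

lemma leibniz_sum_bounds:
  fixes T :: "((real^'n::finite \<Rightarrow> real) \<times> 'n list) list"
  assumes T: "\<And>g b. (g, b) \<in> set T \<Longrightarrow> g \<in> test_functions \<Omega> \<and> length b \<le> k"
    and \<theta>: "0 \<le> \<theta>" "\<theta> < 1" "1 < p" and \<Omega>: "open \<Omega>"
  shows "\<exists>C\<ge>0. \<forall>f J. sobolev_bounded \<Omega> k \<theta> p J f \<longrightarrow> power_integral p (leibniz_sum T f)
      \<le> ennreal C * J \<and>
    (\<theta> \<noteq> 0 \<longrightarrow> gagliardo \<theta> p (leibniz_sum T f) \<le> ennreal C * J)"
  using T
proof (induction T)
  case Nil
  show ?case
    using \<theta> by (intro exI[of _ 0]) (auto simp: leibniz_sum_simps power_integral_def gagliardo_def)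
next
  case (Cons a T)
  obtain g b where a: "a = (g, b)" by (cases a)
  have g: "g \<in> test_functions \<Omega>" "length b \<le> k" using Cons.prems a by auto
  have T': "\<And>g b. (g, b) \<in> set T \<Longrightarrow> g \<in> test_functions \<Omega> \<and> length b \<le> k" using Cons.prems by auto
  obtain C1 where C1: "0 \<le> C1" "\<And>f J b. sobolev_bounded \<Omega> k \<theta> p J f \<Longrightarrow> length b \<le> k \<Longrightarrow>
    power_integral p (\<lambda>x. g x * f b x) \<le> ennreal C1 * J \<and>
    (\<theta> \<noteq> 0 \<longrightarrow> gagliardo \<theta> p (\<lambda>x. g x * f b x) \<le> ennreal C1 * J)"
    using sobolev_bounded_test_mult[OF g(1) \<theta> \<Omega>, of k] by metis
  obtain C2 where C2: "0 \<le> C2" "\<And>f J. sobolev_bounded \<Omega> k \<theta> p J f \<Longrightarrow>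
    power_integral p (leibniz_sum T f) \<le> ennreal C2 * J \<and>
    (\<theta> \<noteq> 0 \<longrightarrow> gagliardo \<theta> p (leibniz_sum T f) \<le> ennreal C2 * J)"
    using Cons.IH[OF T'] by blast
  have eq: "ennreal (2 powr p) * (ennreal C1 * J + ennreal C2 * J)
      = ennreal (2 powr p * (C1 + C2)) * J" for J
    using C1 C2 by (simp add: ennreal_mult distrib_right distrib_left mult.assoc)
  show ?case
  proof (intro exI[of _ "2 powr p * (C1 + C2)"] conjI allI impI)
    show "0 \<le> 2 powr p * (C1 + C2)" using C1 C2 by simp
    fix f J assume f: "sobolev_bounded \<Omega> k \<theta> p J f"
    have wd: "weak_derivs \<Omega> k f" using f by (simp add: sobolev_bounded_def)
    have m1: "(\<lambda>x. g x * f b x) \<in> borel_measurable borel"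
      by (rule test_mult_borel[OF weak_derivs_locally_integrable[OF wd g(2)] g(1)])
    have "integrable lborel (leibniz_sum T f)"
      by (rule leibniz_sum_integral(1)[OF wd test_functions_zero[of \<Omega>]]) (use T' in simp)
    then have m2: "leibniz_sum T f \<in> borel_measurable borel" by simp
    have p: "0 < p" using \<theta> by simp
    show "power_integral p (leibniz_sum (a # T) f) \<le> ennreal (2 powr p * (C1 + C2)) * J"
      unfolding a leibniz_sum_simps eq[symmetric]
      by (rule order_trans[OF power_integral_add[OF m1 m2 p]])
        (intro mult_left_mono add_mono, use C1(2)[OF f g(2)] C2(2)[OF f] in auto)
    show "gagliardo \<theta> p (leibniz_sum (a # T) f) \<le> ennreal (2 powr p * (C1 + C2)) * J" if "\<theta> \<noteq> 0"
      unfolding a leibniz_sum_simps eq[symmetric]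
      by (rule order_trans[OF gagliardo_add[OF m1 m2 p]])
        (intro mult_left_mono add_mono, use C1(2)[OF f g(2)] C2(2)[OF f] that in auto)
  qed
qed

lemma ennroot_mult_powr:
  assumes "0 < p" "0 \<le> C" "0 \<le> s" "I \<le> ennreal C * ennreal (s powr p)"
  shows "ennroot p I \<le> ennreal (C powr (1 / p)) * ennreal s"
proof -
  have "C * s powr p = (C powr (1 / p) * s) powr p"
    using assms by (simp add: powr_mult powr_powr)
  then have "I \<le> ennreal ((C powr (1 / p) * s) powr p)"
    using assms by (simp add: ennreal_mult[symmetric])
  then have "ennroot p I \<le> ennreal (C powr (1 / p) * s)"
    using assms by (subst ennroot_le_iff) auto
  then show ?thesis by (simp add: ennreal_mult')
qed

lemma sobolev_norm_nonneg_leI: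
  assumes "\<And>\<nu>. order_mi \<nu> \<le> nat \<lfloor>t\<rfloor> \<Longrightarrow> on_density \<Omega> (Lp_norm \<Omega> p) (distr_deriv \<Omega> \<nu> u)
      \<le> ennreal (c \<nu>) * S"
    and "\<And>\<nu>. order_mi \<nu> = nat \<lfloor>t\<rfloor> \<Longrightarrow> frac t \<noteq> 0 \<Longrightarrow>
      on_density \<Omega> (slobodeckij_seminorm \<Omega> (frac t) p) (distr_deriv \<Omega> \<nu> u) \<le> ennreal (c \<nu>) * S"
    and "\<And>\<nu>. 0 \<le> c \<nu>"
  shows "sobolev_norm_nonneg \<Omega> t p u \<le> ennreal (2 * (\<Sum>\<nu> | order_mi \<nu> \<le> nat \<lfloor>t\<rfloor>. c \<nu>)) * S"
proof -
  let ?A = "{\<nu>. order_mi \<nu> \<le> nat \<lfloor>t\<rfloor>}" and ?B = "{\<nu>. order_mi \<nu> = nat \<lfloor>t\<rfloor>}"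
  have sumA: "(\<Sum>\<nu>\<in>?A. ennreal (c \<nu>) * S) = ennreal (\<Sum>\<nu>\<in>?A. c \<nu>) * S"
    using assms(3) by (simp add: sum_distrib_right[symmetric] sum_ennreal)
  have "(\<Sum>\<nu>\<in>?A. on_density \<Omega> (Lp_norm \<Omega> p) (distr_deriv \<Omega> \<nu> u)) \<le> ennreal (\<Sum>\<nu>\<in>?A. c \<nu>) * S"
    unfolding sumA[symmetric] by (intro sum_mono assms(1)) simp
  moreover have "(if frac t = 0 then 0 else \<Sum>\<nu>\<in>?B. on_density \<Omega> (slobodeckij_seminorm \<Omega> (frac t)
      p) (distr_deriv \<Omega> \<nu> u))
      \<le> ennreal (\<Sum>\<nu>\<in>?A. c \<nu>) * S"
  proof (cases "frac t = 0")
    case False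
    have "(\<Sum>\<nu>\<in>?B. on_density \<Omega> (slobodeckij_seminorm \<Omega> (frac t) p) (distr_deriv \<Omega> \<nu> u))
        \<le> (\<Sum>\<nu>\<in>?B. ennreal (c \<nu>) * S)"
      by (intro sum_mono assms(2) False) simp
    also have "\<dots> \<le> (\<Sum>\<nu>\<in>?A. ennreal (c \<nu>) * S)" by (intro sum_mono2 finite_order_mi) auto
    finally show ?thesis using False sumA by simp
  qed simp
  ultimately have "sobolev_norm_nonneg \<Omega> t p u \<le> ennreal (\<Sum>\<nu>\<in>?A. c \<nu>) * S + ennreal (\<Sum>\<nu>\<in>?A. c \<nu>)
      * S"
    unfolding sobolev_norm_nonneg_def Let_def by (rule add_mono)
  also have "\<dots> = ennreal (2 * (\<Sum>\<nu>\<in>?A. c \<nu>)) * S"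
  proof -
    have "0 \<le> (\<Sum>\<nu>\<in>?A. c \<nu>)" using assms(3) by (intro sum_nonneg) auto
    then have "ennreal (2 * (\<Sum>\<nu>\<in>?A. c \<nu>)) = ennreal (\<Sum>\<nu>\<in>?A. c \<nu>) + ennreal (\<Sum>\<nu>\<in>?A. c \<nu>)"
      by (simp only: mult_2 ennreal_plus)
    then show ?thesis by (simp only: distrib_right)
  qed
  finally show ?thesis .
qed

text \<open>Both the \<open>L\<^sup>p\<close> norm and the Slobodeckij seminorm of the Leibniz sum are bounded over the
  whole space, hence over \<open>\<Omega>2\<close>.\<close>

lemma cutoff_distr_norm_nonneg:
  fixes \<Omega>1 \<Omega>2 :: "(real^'n::finite) set"
  assumes \<Omega>: "open \<Omega>1" "open \<Omega>2" and h: "h \<in> test_functions (\<Omega>1 \<inter> \<Omega>2)" and p: "1 < p"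
  obtains C where "0 < C" "\<And>u. sobolev_norm_nonneg \<Omega>2 t p (cutoff_distr \<Omega>2 h u)
      \<le> ennreal C * sobolev_norm_nonneg \<Omega>1 t p u"
proof -
  define k where "k = nat \<lfloor>t\<rfloor>"
  define \<theta> where "\<theta> = frac t"
  have \<theta>: "0 \<le> \<theta>" "\<theta> < 1" by (auto simp: \<theta>_def frac_ge_0 frac_lt_1)
  have p0: "0 < p" using p by simp
  have h1: "h \<in> test_functions \<Omega>1" using h test_functions_mono[of "\<Omega>1 \<inter> \<Omega>2" \<Omega>1] by blast
  define L where "L \<nu> = (SOME is. count_list is = \<nu>)" for \<nu> :: "'n \<Rightarrow> nat"
  have L: "count_list (L \<nu>) = \<nu>" for \<nu>
    unfolding L_def by (rule someI_ex) (metis obtain_partials)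
  have len: "length (L \<nu>) = order_mi \<nu>" for \<nu> using order_mi_count_list[of "L \<nu>"] L[of \<nu>] by simp
  define T where "T \<nu> = leibniz_terms (L \<nu>) h" for \<nu>
  have T: "g \<in> test_functions (\<Omega>1 \<inter> \<Omega>2) \<and> length b \<le> k" if "(g, b) \<in> set (T \<nu>)" "order_mi \<nu> \<le> k"
      for g b \<nu>
    using leibniz_terms_props[OF h] that len[of \<nu>] unfolding T_def by fastforce
  have T1: "g \<in> test_functions \<Omega>1 \<and> length b \<le> k" if "(g, b) \<in> set (T \<nu>)" "order_mi \<nu> \<le> k" for g b \<nu>
    using T[OF that] test_functions_mono[of "\<Omega>1 \<inter> \<Omega>2" \<Omega>1] by blast
  have "\<forall>\<nu>. \<exists>C\<ge>0. order_mi \<nu> \<le> k \<longrightarrow> (\<forall>f J. sobolev_bounded \<Omega>1 k \<theta> p J f \<longrightarrow>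
      power_integral p (leibniz_sum (T \<nu>) f) \<le> ennreal C * J \<and>
      (\<theta> \<noteq> 0 \<longrightarrow> gagliardo \<theta> p (leibniz_sum (T \<nu>) f) \<le> ennreal C * J))"
  proof
    fix \<nu>
    show "\<exists>C\<ge>0. order_mi \<nu> \<le> k \<longrightarrow> (\<forall>f J. sobolev_bounded \<Omega>1 k \<theta> p J f \<longrightarrow>
      power_integral p (leibniz_sum (T \<nu>) f) \<le> ennreal C * J \<and>
      (\<theta> \<noteq> 0 \<longrightarrow> gagliardo \<theta> p (leibniz_sum (T \<nu>) f) \<le> ennreal C * J))"
    proof (cases "order_mi \<nu> \<le> k")
      case True
      from leibniz_sum_bounds[OF T1[OF _ True] \<theta> p \<Omega>(1), of "T \<nu>"] show ?thesis by blast
    qed auto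
  qed
  then obtain C where C: "\<And>\<nu>. 0 \<le> C \<nu>" "\<And>\<nu> f J. order_mi \<nu> \<le> k \<Longrightarrow> sobolev_bounded \<Omega>1 k \<theta> p J f \<Longrightarrow>
      power_integral p (leibniz_sum (T \<nu>) f) \<le> ennreal (C \<nu>) * J \<and>
      (\<theta> \<noteq> 0 \<longrightarrow> gagliardo \<theta> p (leibniz_sum (T \<nu>) f) \<le> ennreal (C \<nu>) * J)"
    by metis
  define c where "c \<nu> = C \<nu> powr (1 / p)" for \<nu>
  define C' where "C' = 2 * (\<Sum>\<nu> | order_mi \<nu> \<le> k. c \<nu>)"
  have C': "0 \<le> C'" by (simp add: C'_def c_def sum_nonneg)
  show ?thesis
  proof (rule that[of "C' + 1"])
    show "0 < C' + 1" using C' by simp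
    fix u
    show "sobolev_norm_nonneg \<Omega>2 t p (cutoff_distr \<Omega>2 h u)
        \<le> ennreal (C' + 1) * sobolev_norm_nonneg \<Omega>1 t p u"
    proof (cases "sobolev_norm_nonneg \<Omega>1 t p u = \<infinity>")
      case True
      then show ?thesis using C' by (simp add: ennreal_mult_top)
    next
      case False
      define s where "s = enn2real (sobolev_norm_nonneg \<Omega>1 t p u)"
      have s: "0 \<le> s" "sobolev_norm_nonneg \<Omega>1 t p u = ennreal s"
        using False by (auto simp: s_def less_top)
      obtain f where f: "sobolev_bounded \<Omega>1 k \<theta> p (ennreal (s powr p)) f"
        "\<And>\<phi>. \<phi> \<in> test_functions \<Omega>1 \<Longrightarrow> u \<phi> = (LINT x:\<Omega>1|lborel. f [] x * \<phi> x)"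
        using sobolev_norm_nonneg_le_obtain[OF \<Omega>(1) p s(1), of t u] s(2) unfolding k_def \<theta>_def
            by auto
      have wd: "weak_derivs \<Omega>1 k f" using f(1) by (simp add: sobolev_bounded_def)
      have rep: "regular_distr \<Omega>2 (leibniz_sum (T \<nu>) f) = distr_deriv \<Omega>2 \<nu> (cutoff_distr \<Omega>2 h u)"
        "locally_integrable_on \<Omega>2 (leibniz_sum (T \<nu>) f)" if \<nu>: "order_mi \<nu> \<le> k" for \<nu>
      proof -
        show "locally_integrable_on \<Omega>2 (leibniz_sum (T \<nu>) f)"
          by (rule integrable_imp_locally_integrable[OF leibniz_sum_integral(1)[OF wd
              test_functions_zero[of \<Omega>2] T]])
            (use \<nu> in auto)
        show "regular_distr \<Omega>2 (leibniz_sum (T \<nu>) f) = distr_deriv \<Omega>2 \<nu> (cutoff_distr \<Omega>2 h u)"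
        proof
          fix \<phi>
          show "regular_distr \<Omega>2 (leibniz_sum (T \<nu>) f) \<phi> = distr_deriv \<Omega>2 \<nu> (cutoff_distr \<Omega>2 h u) \<phi>"
          proof (cases "\<phi> \<in> test_functions \<Omega>2")
            case True
            have sm: "smooth_on UNIV \<phi>" by (rule test_functions_smooth[OF True])
            have "distr_deriv \<Omega>2 \<nu> (cutoff_distr \<Omega>2 h u) \<phi>
                = (-1) ^ length (L \<nu>) * u (\<lambda>x. h x * foldr partial (L \<nu>) \<phi> x)"
              using distr_deriv_count_list[OF True, of "L \<nu>"] test_functions_partials[OF True]
              by (simp add: L cutoff_distr_def)
            also have "u (\<lambda>x. h x * foldr partial (L \<nu>) \<phi> x)
                = (LINT x:\<Omega>1|lborel. f [] x * (h x * foldr partial (L \<nu>) \<phi> x))"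
              by (rule f(2)[OF test_functions_mult[OF h1 smooth_partials[OF sm]]])
            also have "\<dots> = (-1) ^ length (L \<nu>) * (\<Sum>(g, b)\<leftarrow>T \<nu>. LINT x:\<Omega>1|lborel. f b x * (g x * \<phi>
                x))"
              unfolding T_def by (rule leibniz_weak_derivs[OF wd _ h1 sm]) (use \<nu> len in simp)
            also have "(\<Sum>(g, b)\<leftarrow>T \<nu>. LINT x:\<Omega>1|lborel. f b x * (g x * \<phi> x))
                = (LINT x:\<Omega>2|lborel. leibniz_sum (T \<nu>) f x * \<phi> x)"
              by (rule leibniz_sum_integral(2)[OF wd True T, symmetric]) (use \<nu> in auto)
            finally show ?thesis using True by (simp add: regular_distr_test flip: mult.assoc
                power_mult_distrib)
          qed (simp add: regular_distr_def distr_deriv_def)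
        qed
      qed
      have "sobolev_norm_nonneg \<Omega>2 t p (cutoff_distr \<Omega>2 h u) \<le> ennreal C' * ennreal s"
        unfolding C'_def k_def
      proof (rule sobolev_norm_nonneg_leI)
        fix \<nu> :: "'n \<Rightarrow> nat" assume "order_mi \<nu> \<le> nat \<lfloor>t\<rfloor>"
        then have \<nu>: "order_mi \<nu> \<le> k" by (simp add: k_def)
        have "on_density \<Omega>2 (Lp_norm \<Omega>2 p) (distr_deriv \<Omega>2 \<nu> (cutoff_distr \<Omega>2 h u))
            \<le> ennroot p (power_integral p (leibniz_sum (T \<nu>) f))"
          by (rule order_trans[OF on_density_le[OF rep(2,1)[OF \<nu>]] Lp_norm_le_power_integral[OF
              p0]])
        also have "\<dots> \<le> ennreal (c \<nu>) * ennreal s"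
          unfolding c_def using C(1) C(2)[OF \<nu> f(1)] by (intro ennroot_mult_powr p0 s) auto
        finally show "on_density \<Omega>2 (Lp_norm \<Omega>2 p) (distr_deriv \<Omega>2 \<nu> (cutoff_distr \<Omega>2 h u))
            \<le> ennreal (c \<nu>) * ennreal s" .
      next
        fix \<nu> :: "'n \<Rightarrow> nat" assume "order_mi \<nu> = nat \<lfloor>t\<rfloor>" and t0: "frac t \<noteq> 0"
        then have \<nu>: "order_mi \<nu> \<le> k" by (simp add: k_def)
        have "on_density \<Omega>2 (slobodeckij_seminorm \<Omega>2 \<theta> p) (distr_deriv \<Omega>2 \<nu> (cutoff_distr \<Omega>2 h
            u)) \<le> ennroot p (gagliardo \<theta> p (leibniz_sum (T \<nu>) f))"
          by (rule order_trans[OF on_density_le[OF rep(2,1)[OF \<nu>]] slobodeckij_le_gagliardo[OF p0]])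
        also have "\<dots> \<le> ennreal (c \<nu>) * ennreal s"
          unfolding c_def using C(1) C(2)[OF \<nu> f(1)] t0
              by (intro ennroot_mult_powr p0 s) (auto simp: \<theta>_def)
        finally show "on_density \<Omega>2 (slobodeckij_seminorm \<Omega>2 (frac t) p) (distr_deriv \<Omega>2 \<nu>
            (cutoff_distr \<Omega>2 h u)) \<le> ennreal (c \<nu>) * ennreal s"
          unfolding \<theta>_def .
      qed (simp add: c_def)
      also have "\<dots> \<le> ennreal (C' + 1) * ennreal s" by (intro mult_right_mono ennreal_leI) auto
      finally show ?thesis unfolding s(2) .
    qed
  qed
qed

section \<open>Test functions and distributions in Sobolev spaces\<close>

definition test_norm :: "(real^'n::finite) set \<Rightarrow> nat \<Rightarrow> (real^'n \<Rightarrow> real) \<Rightarrow> ennreal"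
  where "test_norm K m \<phi> = (\<Sum>\<nu> | order_mi \<nu> \<le> m. SUP x\<in>K. ennreal \<bar>multi_partial \<nu> \<phi> x\<bar>)"

lemma test_norm_mono: "m \<le> m' \<Longrightarrow> test_norm K m \<phi> \<le> test_norm K m' \<phi>"
  unfolding test_norm_def by (intro sum_mono2 finite_order_mi) auto

lemma test_norm_finite:
  assumes "\<phi> \<in> test_functions \<Omega>"
  obtains \<beta> where "0 \<le> \<beta>" "test_norm K m \<phi> = ennreal \<beta>"
    "\<And>is x. length is \<le> m \<Longrightarrow> x \<in> K \<Longrightarrow> \<bar>foldr partial is \<phi> x\<bar> \<le> \<beta>"
proof -
  have mp: "multi_partial (count_list is) \<phi> = foldr partial is \<phi>" for "is"
    by (rule multi_partial_eq_partials[OF test_functions_smooth[OF assms] refl])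
  have fin: "(SUP x\<in>K. ennreal \<bar>multi_partial \<nu> \<phi> x\<bar>) < \<infinity>" for \<nu>
  proof -
    obtain "is" where "is": "count_list is = \<nu>" by (rule obtain_partials)
    obtain M where M: "\<And>x. \<bar>foldr partial is \<phi> x\<bar> \<le> M"
      using test_functions_bounded[OF test_functions_partials[OF assms]] by metis
    have "(SUP x\<in>K. ennreal \<bar>multi_partial \<nu> \<phi> x\<bar>) \<le> ennreal M"
      using M mp[of "is"] "is" by (intro SUP_least ennreal_leI) simp
    then show ?thesis by (rule order_le_less_trans) simp
  qed
  define \<beta> where "\<beta> = enn2real (test_norm K m \<phi>)"
  have "test_norm K m \<phi> < \<infinity>" 
    unfolding test_norm_def using fin by (simp add: finite_order_mi)
  then have \<beta>: "test_norm K m \<phi> = ennreal \<beta>" by (simp add: \<beta>_def less_top)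
  show ?thesis
  proof (rule that[OF _ \<beta>])
    show "0 \<le> \<beta>" by (simp add: \<beta>_def)
    fix "is" :: "'a list" and x assume "length is \<le> m" "x \<in> K"
    have "ennreal \<bar>foldr partial is \<phi> x\<bar> \<le> (SUP x\<in>K. ennreal \<bar>multi_partial (count_list is) \<phi> x\<bar>)"
      unfolding mp by (rule SUP_upper[OF \<open>x \<in> K\<close>])
    also have "\<dots> \<le> test_norm K m \<phi>"
      unfolding test_norm_def using \<open>length is \<le> m\<close>
      by (intro member_le_sum finite_order_mi) (auto simp: order_mi_count_list)
    finally show "\<bar>foldr partial is \<phi> x\<bar> \<le> \<beta>" unfolding \<beta> by (simp add: \<beta>_def)
  qed
qed

lemma partials_zero_off_support:
  assumes "\<phi> \<in> test_functions \<Omega>" "closure {x. \<phi> x \<noteq> 0} \<subseteq> K" "x \<notin> K"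
  shows "foldr partial is \<phi> x = 0"
proof (rule partials_zero_outside)
  show "\<phi> y = 0" if "y \<notin> closure {x. \<phi> x \<noteq> 0}" for y
    using that closure_subset[of "{x. \<phi> x \<noteq> 0}"] by blast
  show "x \<notin> closure {x. \<phi> x \<noteq> 0}" using assms(2,3) by blast
qed simp

lemma distr_deriv_regular_test:
  assumes \<phi>: "\<phi> \<in> test_functions \<Omega>"
  shows "distr_deriv \<Omega> (count_list is) (regular_distr \<Omega> \<phi>) = regular_distr \<Omega> (foldr partial is \<phi>)"
proof
  fix \<psi>
  show "distr_deriv \<Omega> (count_list is) (regular_distr \<Omega> \<phi>) \<psi>
      = regular_distr \<Omega> (foldr partial is \<phi>) \<psi>"
  proof (cases "\<psi> \<in> test_functions \<Omega>")
    case True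
    have U: "\<psi> \<in> test_functions UNIV" using True test_functions_mono[of \<Omega> UNIV] by blast
    have *: "(LINT x:\<Omega>|lborel. f x * g x) = (\<integral>x. f x * g x \<partial>lborel)" if "f \<in> test_functions \<Omega>"
        for f g :: "real^'a \<Rightarrow> real"
      unfolding set_lebesgue_integral_def
      by (intro Bochner_Integration.integral_cong refl) (use test_functions_outside[OF that]
          in \<open>auto simp: indicator_def\<close>)
    show ?thesis
      using integration_by_parts_iterated[OF U test_functions_smooth[OF \<phi>], of "is"] True
      by (simp add: distr_deriv_count_list regular_distr_test test_functions_partials *[OF \<phi>]
          *[OF test_functions_partials[OF \<phi>]]
          flip: mult.assoc power_mult_distrib)
  qed (simp add: distr_deriv_def regular_distr_def)
qed

text \<open>Test functions are continuously included in the Sobolev spaces, so that bounded functionals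
  on the latter restrict to distributions.\<close>

lemma sobolev_norm_nonneg_test_le:
  fixes \<Omega> :: "(real^'n::finite) set"
  assumes \<Omega>: "open \<Omega>" and p: "1 < p" and K: "compact K"
  obtains C where "0 \<le> C" "\<And>\<phi>. \<phi> \<in> test_functions \<Omega> \<Longrightarrow> closure {x. \<phi> x \<noteq> 0} \<subseteq> K \<Longrightarrow>
    sobolev_norm_nonneg \<Omega> t p (regular_distr \<Omega> \<phi>) \<le> ennreal C * test_norm K (Suc (nat \<lfloor>t\<rfloor>)) \<phi>"
proof -
  define \<theta> where "\<theta> = frac t"
  have \<theta>: "0 \<le> \<theta>" "\<theta> < 1" by (auto simp: \<theta>_def frac_ge_0 frac_lt_1)
  have p0: "0 < p" using p by simp
  define v where "v = measure lborel K"
  have v: "emeasure lborel K = ennreal v" "0 \<le> v"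
    unfolding v_def using emeasure_compact_finite[OF K]
        by (simp_all add: emeasure_eq_ennreal_measure less_top)
  obtain C0 where C0: "\<theta> \<noteq> 0 \<Longrightarrow> 0 \<le> C0" "\<And>(F :: real^'n \<Rightarrow> real) D J. \<theta> \<noteq> 0 \<Longrightarrow> weak_gradient F D \<Longrightarrow>
    power_integral p F \<le> J \<Longrightarrow> (\<And>i. power_integral p (D i) \<le> J) \<Longrightarrow> gagliardo \<theta> p F \<le> ennreal C0 * J"
  proof (cases "\<theta> = 0")
    case False
    then have "0 < \<theta>" using \<theta> by simp
    show ?thesis
    proof (rule gagliardo_weak_gradient[where 'n = 'n, OF \<open>0 < \<theta>\<close> \<theta>(2) p], goal_cases)
      case (1 C)
      show ?case by (rule that[of C]) (use 1 in blast)+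
    qed
  qed (use that in blast)
  define c where "c = v powr (1 / p) + (max 0 C0 * v) powr (1 / p)"
  have c: "0 \<le> c" by (simp add: c_def)
  show ?thesis
  proof (rule that[of "2 * (\<Sum>\<nu> :: 'n \<Rightarrow> nat | order_mi \<nu> \<le> nat \<lfloor>t\<rfloor>. c)"])
    show "0 \<le> 2 * (\<Sum>\<nu> :: 'n \<Rightarrow> nat | order_mi \<nu> \<le> nat \<lfloor>t\<rfloor>. c)" using c by (simp add: sum_nonneg)
    fix \<phi> assume \<phi>: "\<phi> \<in> test_functions \<Omega>" and supp: "closure {x. \<phi> x \<noteq> 0} \<subseteq> K"
    obtain \<beta> where \<beta>: "0 \<le> \<beta>" "test_norm K (Suc (nat \<lfloor>t\<rfloor>)) \<phi> = ennreal \<beta>"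
      "\<And>is x. length is \<le> Suc (nat \<lfloor>t\<rfloor>) \<Longrightarrow> x \<in> K \<Longrightarrow> \<bar>foldr partial is \<phi> x\<bar> \<le> \<beta>"
      using test_norm_finite[OF \<phi>, of K "Suc (nat \<lfloor>t\<rfloor>)"] by metis
    have PI: "power_integral p (foldr partial is \<phi>) \<le> ennreal v * ennreal (\<beta> powr p)" if
        "length is \<le> Suc (nat \<lfloor>t\<rfloor>)" for "is"
    proof -
      have "power_integral p (foldr partial is \<phi>) \<le> (\<integral>\<^sup>+x. ennreal (\<beta> powr p) * indicator K x
          \<partial>lborel)"
        unfolding power_integral_def
      proof (rule nn_integral_mono)
        fix x
        show "ennreal (\<bar>foldr partial is \<phi> x\<bar> powr p) \<le> ennreal (\<beta> powr p) * indicator K x"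
          using \<beta>(3)[OF that, of x] partials_zero_off_support[OF \<phi> supp, of x "is"] p0
          by (cases "x \<in> K") (auto intro!: ennreal_leI powr_mono2)
      qed
      also have "\<dots> = ennreal v * ennreal (\<beta> powr p)"
        by (subst nn_integral_cmult_indicator)
          (use K in \<open>auto simp: compact_imp_closed borel_closed v mult.commute\<close>)
      finally show ?thesis .
    qed
    have GA: "gagliardo \<theta> p (foldr partial is \<phi>) \<le> ennreal (max 0 C0 * v) * ennreal (\<beta> powr p)"
      if t0: "\<theta> \<noteq> 0" and len: "length is \<le> nat \<lfloor>t\<rfloor>" for "is"
    proof -
      have U: "foldr partial is \<phi> \<in> test_functions UNIV"
        using test_functions_partials[OF \<phi>] test_functions_mono[of \<Omega> UNIV] by blast
      have "weak_gradient (foldr partial is \<phi>) (\<lambda>i. foldr partial (i # is) \<phi>)"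
        unfolding weak_gradient_def
        using test_functions_integrable[OF U] test_functions_integrable[OF
            test_functions_partial[OF U]]
          integration_by_parts[OF _ test_functions_smooth[OF U]] by simp
      then have "gagliardo \<theta> p (foldr partial is \<phi>) \<le> ennreal C0 * (ennreal v * ennreal (\<beta> powr p))"
      proof (rule C0(2)[OF t0])
        show "power_integral p (foldr partial is \<phi>) \<le> ennreal v * ennreal (\<beta> powr p)"
          using len by (intro PI) simp
        show "power_integral p (foldr partial (i # is) \<phi>) \<le> ennreal v * ennreal (\<beta> powr p)" for i
          using len by (intro PI) simp
      qed
      also have "\<dots> = ennreal (max 0 C0 * v) * ennreal (\<beta> powr p)"
        using C0(1)[OF t0] by (simp add: ennreal_mult' mult.assoc)
      finally show ?thesis .
    qed
    have loc: "locally_integrable_on \<Omega> (foldr partial is \<phi>)" for "is"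
      using test_functions_integrable[OF test_functions_partials[OF \<phi>]]
          by (rule integrable_imp_locally_integrable)
    show "sobolev_norm_nonneg \<Omega> t p (regular_distr \<Omega> \<phi>)
      \<le> ennreal (2 * (\<Sum>\<nu> :: 'n \<Rightarrow> nat | order_mi \<nu> \<le> nat \<lfloor>t\<rfloor>. c)) * test_norm K (Suc (nat \<lfloor>t\<rfloor>)) \<phi>"
      unfolding \<beta>(2)
    proof (rule sobolev_norm_nonneg_leI)
      fix \<nu> :: "'n \<Rightarrow> nat" assume \<nu>: "order_mi \<nu> \<le> nat \<lfloor>t\<rfloor>"
      obtain "is" where "is": "count_list is = \<nu>" "length is = order_mi \<nu>" by (rule obtain_partials)
      have "on_density \<Omega> (Lp_norm \<Omega> p) (distr_deriv \<Omega> \<nu> (regular_distr \<Omega> \<phi>))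
          \<le> ennroot p (power_integral p (foldr partial is \<phi>))"
        using order_trans[OF on_density_le[OF loc distr_deriv_regular_test[OF \<phi>, symmetric],
            where N = "Lp_norm \<Omega> p"]
            Lp_norm_le_power_integral[OF p0]] "is"(1) by auto
      also have "\<dots> \<le> ennreal (v powr (1 / p)) * ennreal \<beta>"
        using \<nu> "is" by (intro ennroot_mult_powr PI p0 v \<beta>) auto
      also have "\<dots> \<le> ennreal c * ennreal \<beta>" unfolding c_def
          by (intro mult_right_mono ennreal_leI) auto
      finally show "on_density \<Omega> (Lp_norm \<Omega> p) (distr_deriv \<Omega> \<nu> (regular_distr \<Omega> \<phi>))
          \<le> ennreal c * ennreal \<beta>" .
    next
      fix \<nu> :: "'n \<Rightarrow> nat" assume \<nu>: "order_mi \<nu> = nat \<lfloor>t\<rfloor>" and t0: "frac t \<noteq> 0"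
      obtain "is" where "is": "count_list is = \<nu>" "length is = order_mi \<nu>" by (rule obtain_partials)
      have "on_density \<Omega> (slobodeckij_seminorm \<Omega> \<theta> p) (distr_deriv \<Omega> \<nu> (regular_distr \<Omega> \<phi>))
          \<le> ennroot p (gagliardo \<theta> p (foldr partial is \<phi>))"
        using order_trans[OF on_density_le[OF loc distr_deriv_regular_test[OF \<phi>, symmetric],
            where N = "slobodeckij_seminorm \<Omega> \<theta> p"]
            slobodeckij_le_gagliardo[OF p0]] "is"(1) by auto
      also have "\<dots> \<le> ennreal ((max 0 C0 * v) powr (1 / p)) * ennreal \<beta>"
        using \<nu> "is" v t0 by (intro ennroot_mult_powr GA p0 \<beta>) (auto simp: \<theta>_def)
      also have "\<dots> \<le> ennreal c * ennreal \<beta>" unfolding c_def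
          by (intro mult_right_mono ennreal_leI) auto
      finally show "on_density \<Omega> (slobodeckij_seminorm \<Omega> (frac t) p) (distr_deriv \<Omega> \<nu>
          (regular_distr \<Omega> \<phi>)) \<le> ennreal c * ennreal \<beta>"
        unfolding \<theta>_def .
    qed (rule c)
  qed
qed

lemma test_seminorms_iff:
  "q \<in> test_seminorms \<Omega> \<longleftrightarrow> seminorm_on (test_functions \<Omega>) q \<and> (\<forall>K. compact K \<and> K \<subseteq> \<Omega> \<longrightarrow>
    (\<exists>C m. \<forall>\<phi>\<in>test_functions \<Omega>. closure {x. \<phi> x \<noteq> 0} \<subseteq> K \<longrightarrow> ennreal (q \<phi>)
        \<le> ennreal C * test_norm K m \<phi>))"
  by (simp only: test_seminorms_def test_norm_def mem_Collect_eq)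

text \<open>The condition under which the neighbourhoods of \<open>seminorm_topology\<close> form a topology. It
  refers to all functions, and only on test functions are seminorms known to be nonnegative; hence
  the absolute values.\<close>

lemma test_seminorms_directed:
  assumes "p \<in> test_seminorms \<Omega>" "q \<in> test_seminorms \<Omega>"
  shows "\<exists>r\<in>test_seminorms \<Omega>. \<forall>x. p x \<le> r x \<and> q x \<le> r x"
proof (intro bexI[of _ "\<lambda>x. \<bar>p x\<bar> + \<bar>q x\<bar>"])
  have p: "seminorm_on (test_functions \<Omega>) p" and q: "seminorm_on (test_functions \<Omega>) q"
    using assms by (auto simp: test_seminorms_def)
  have abs: "\<bar>p x\<bar> + \<bar>q x\<bar> = p x + q x" if "x \<in> test_functions \<Omega>" for x
    using p q that by (simp add: seminorm_on_def)
  have cl: "x + y \<in> test_functions \<Omega>" "c *\<^sub>R x \<in> test_functions \<Omega>"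
    if "x \<in> test_functions \<Omega>" "y \<in> test_functions \<Omega>" for x y c
    using test_functions_add[OF that] test_functions_scale[OF that(1), of c]
    by (simp_all add: plus_fun_def scaleR_fun_def)
  have "seminorm_on (test_functions \<Omega>) (\<lambda>x. \<bar>p x\<bar> + \<bar>q x\<bar>)"
    unfolding seminorm_on_def
  proof (intro conjI ballI allI)
    fix x y assume x: "x \<in> test_functions \<Omega>" and y: "y \<in> test_functions \<Omega>"
    have "p (x + y) \<le> p x + p y" "q (x + y) \<le> q x + q y"
      using p q x y unfolding seminorm_on_def by blast+
    then show "\<bar>p (x + y)\<bar> + \<bar>q (x + y)\<bar> \<le> \<bar>p x\<bar> + \<bar>q x\<bar> + (\<bar>p y\<bar> + \<bar>q y\<bar>)"
      unfolding abs[OF x] abs[OF y] abs[OF cl(1)[OF x y]] by simp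
  next
    fix c x assume x: "x \<in> test_functions \<Omega>"
    then have "p (c *\<^sub>R x) = \<bar>c\<bar> * p x" "q (c *\<^sub>R x) = \<bar>c\<bar> * q x"
      using p q unfolding seminorm_on_def by blast+
    then show "\<bar>p (c *\<^sub>R x)\<bar> + \<bar>q (c *\<^sub>R x)\<bar> = \<bar>c\<bar> * (\<bar>p x\<bar> + \<bar>q x\<bar>)"
      by (simp add: abs_mult distrib_left)
  qed simp
  moreover have "\<exists>C m. \<forall>\<phi>\<in>test_functions \<Omega>. closure {x. \<phi> x \<noteq> 0} \<subseteq> K \<longrightarrow> ennreal (\<bar>p \<phi>\<bar> + \<bar>q \<phi>\<bar>)
      \<le> ennreal C * test_norm K m \<phi>"
    if K: "compact K" "K \<subseteq> \<Omega>" for K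
  proof -
    from assms(1) K have "\<exists>C m. \<forall>\<phi>\<in>test_functions \<Omega>. closure {x. \<phi> x \<noteq> 0} \<subseteq> K \<longrightarrow> ennreal (p \<phi>)
        \<le> ennreal C * test_norm K m \<phi>"
      by (simp only: test_seminorms_iff simp_thms)
    then obtain C1 m1 where 1: "\<forall>\<phi>\<in>test_functions \<Omega>. closure {x. \<phi> x \<noteq> 0} \<subseteq> K \<longrightarrow> ennreal (p \<phi>)
        \<le> ennreal C1 * test_norm K m1 \<phi>"
      by (elim exE)
    from assms(2) K have "\<exists>C m. \<forall>\<phi>\<in>test_functions \<Omega>. closure {x. \<phi> x \<noteq> 0} \<subseteq> K \<longrightarrow> ennreal (q \<phi>)
        \<le> ennreal C * test_norm K m \<phi>"
      by (simp only: test_seminorms_iff simp_thms)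
    then obtain C2 m2 where 2: "\<forall>\<phi>\<in>test_functions \<Omega>. closure {x. \<phi> x \<noteq> 0} \<subseteq> K \<longrightarrow> ennreal (q \<phi>)
        \<le> ennreal C2 * test_norm K m2 \<phi>"
      by (elim exE)
    show ?thesis
    proof (intro exI ballI impI)
      fix \<phi> assume \<phi>: "\<phi> \<in> test_functions \<Omega>" "closure {x. \<phi> x \<noteq> 0} \<subseteq> K"
      have "ennreal (\<bar>p \<phi>\<bar> + \<bar>q \<phi>\<bar>) = ennreal (p \<phi>) + ennreal (q \<phi>)"
        using p q \<phi> by (simp add: seminorm_on_def)
      also have "\<dots> \<le> ennreal C1 * test_norm K m1 \<phi> + ennreal C2 * test_norm K m2 \<phi>"
        using 1 2 \<phi> by (intro add_mono) simp_all
      also have "\<dots> \<le> ennreal (max 0 C1) * test_norm K (max m1 m2) \<phi> + ennreal (max 0 C2) *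
          test_norm K (max m1 m2) \<phi>"
        by (intro add_mono mult_mono ennreal_leI test_norm_mono) auto
      also have "\<dots> = ennreal (max 0 C1 + max 0 C2) * test_norm K (max m1 m2) \<phi>"
        by (simp add: distrib_right ennreal_plus)
      finally show "ennreal (\<bar>p \<phi>\<bar> + \<bar>q \<phi>\<bar>) \<le> ennreal (max 0 C1 + max 0 C2) * test_norm K (max m1
          m2) \<phi>" .
    qed
  qed
  ultimately show "(\<lambda>x. \<bar>p x\<bar> + \<bar>q x\<bar>) \<in> test_seminorms \<Omega>"
    unfolding test_seminorms_iff by blast
qed auto

text \<open>The multiples of \<open>|u|\<close> are continuous seminorms, and their unit balls give the continuity of
  \<open>u\<close>.\<close>

lemma distributionsI:
  fixes \<Omega> :: "(real^'n::finite) set"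
  assumes off: "\<And>\<phi>. \<phi> \<notin> test_functions \<Omega> \<Longrightarrow> u \<phi> = 0"
    and lin: "linear_functional_on (test_functions \<Omega>) u"
    and bound: "\<And>K. compact K \<Longrightarrow> K \<subseteq> \<Omega> \<Longrightarrow> \<exists>C m. \<forall>\<phi>\<in>test_functions \<Omega>. closure {x. \<phi> x \<noteq> 0} \<subseteq> K \<longrightarrow>
        ennreal \<bar>u \<phi>\<bar> \<le> ennreal C * test_norm K m \<phi>"
  shows "u \<in> distributions \<Omega>"
proof -
  let ?X = "test_functions \<Omega>" and ?Q = "test_seminorms \<Omega>"
  let ?T = "seminorm_topology ?X ?Q"
  have add: "u (x + y) = u x + u y" and scale: "u (c *\<^sub>R x) = c * u x" if "x \<in> ?X" "y \<in> ?X"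
      for x y c
    using lin that by (auto simp: linear_functional_on_def)
  have diff: "y - x \<in> ?X" "u (y - x) = u y - u x" if "x \<in> ?X" "y \<in> ?X" for x y
  proof -
    have m: "- x \<in> ?X" using test_functions_scale[OF that(1), of "-1"]
      by (simp add: fun_Compl_def)
    show "y - x \<in> ?X" using test_functions_diff[OF that(2,1)] by (simp add: fun_diff_def)
    have "u (- x) = - u x" using scale[OF that(1) that(1), of "-1"] by simp
    then show "u (y - x) = u y - u x" using add[OF that(2) m] by simp
  qed
  have semi: "(\<lambda>\<phi>. c * \<bar>u \<phi>\<bar>) \<in> ?Q" if c: "0 \<le> c" for c
  proof -
    have "seminorm_on ?X (\<lambda>\<phi>. c * \<bar>u \<phi>\<bar>)"
      unfolding seminorm_on_def
      using c add scale
      by (auto simp: abs_mult distrib_left[symmetric] intro!: mult_left_mono abs_triangle_ineq)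
    moreover have "\<exists>C m. \<forall>\<phi>\<in>?X. closure {x. \<phi> x \<noteq> 0} \<subseteq> K \<longrightarrow> ennreal (c * \<bar>u \<phi>\<bar>)
        \<le> ennreal C * test_norm K m \<phi>"
      if K: "compact K" "K \<subseteq> \<Omega>" for K
    proof -
      obtain C m where "\<forall>\<phi>\<in>?X. closure {x. \<phi> x \<noteq> 0} \<subseteq> K \<longrightarrow> ennreal \<bar>u \<phi>\<bar>
          \<le> ennreal C * test_norm K m \<phi>"
        using bound[OF K] by blast
      then show ?thesis
        using c by (intro exI[of _ "c * C"] exI[of _ m]) (auto simp: ennreal_mult' mult.assoc
            intro!: mult_left_mono)
    qed
    ultimately show ?thesis unfolding test_seminorms_iff by blast
  qed
  have op: "openin ?T V \<longleftrightarrow> V \<subseteq> ?X \<and> (\<forall>x\<in>V. \<exists>q\<in>?Q. {y\<in>?X. q (y - x) < 1} \<subseteq> V)" for V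
    by (rule openin_seminorm_topology) (rule test_seminorms_directed)
  have "openin ?T ?X" unfolding op using semi[of 0] by blast
  then have top: "topspace ?T = ?X"
    using op by (metis openin_subset openin_topspace subset_antisym)
  have "openin ?T {x \<in> ?X. u x \<in> W}" if W: "open W" for W
    unfolding op
  proof (intro conjI ballI)
    fix x assume "x \<in> {x \<in> ?X. u x \<in> W}"
    then have x: "x \<in> ?X" "u x \<in> W" by auto
    obtain \<epsilon> where \<epsilon>: "0 < \<epsilon>" "ball (u x) \<epsilon> \<subseteq> W" using W x(2) open_contains_ball by blast
    have "{y \<in> ?X. 1 / \<epsilon> * \<bar>u (y - x)\<bar> < 1} \<subseteq> {x \<in> ?X. u x \<in> W}"
    proof
      fix y assume "y \<in> {y \<in> ?X. 1 / \<epsilon> * \<bar>u (y - x)\<bar> < 1}"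
      then have y: "y \<in> ?X" "\<bar>u y - u x\<bar> < \<epsilon>" using diff(2)[OF x(1)] \<epsilon>(1) by auto
      then show "y \<in> {x \<in> ?X. u x \<in> W}" using \<epsilon>(2) by (auto simp: dist_real_def abs_minus_commute)
    qed
    moreover have "(\<lambda>\<phi>. 1 / \<epsilon> * \<bar>u \<phi>\<bar>) \<in> ?Q" using \<epsilon>(1) by (intro semi) simp
    ultimately show "\<exists>q\<in>?Q. {y\<in>?X. q (y - x) < 1} \<subseteq> {x \<in> ?X. u x \<in> W}" by (rule bexI[rotated, of
        "\<lambda>\<phi>. 1 / \<epsilon> * \<bar>u \<phi>\<bar>", rotated])
  qed auto
  then have "continuous_map ?T euclideanreal u"
    unfolding continuous_map_def top by simp
  then show ?thesis
    unfolding distributions_def topological_dual_def using off lin by simp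
qed

lemma regular_distr_linear:
  assumes "locally_integrable_on \<Omega> f"
  shows "linear_functional_on (test_functions \<Omega>) (regular_distr \<Omega> f)"
  unfolding linear_functional_on_def
proof (intro conjI ballI allI)
  fix \<phi> \<psi> assume *: "\<phi> \<in> test_functions \<Omega>" "\<psi> \<in> test_functions \<Omega>"
  then have "\<phi> + \<psi> \<in> test_functions \<Omega>" using test_functions_add by (simp add: plus_fun_def)
  then show "regular_distr \<Omega> f (\<phi> + \<psi>) = regular_distr \<Omega> f \<phi> + regular_distr \<Omega> f \<psi>"
    using * set_integral_add(2)[OF integrable_mult_test[OF assms *(1)] integrable_mult_test[OF
        assms *(2)]]
    by (simp add: regular_distr_test distrib_left)
next
  fix c \<phi> assume \<phi>: "\<phi> \<in> test_functions \<Omega>"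
  then have "c *\<^sub>R \<phi> \<in> test_functions \<Omega>" using test_functions_scale by (simp add: scaleR_fun_def)
  then show "regular_distr \<Omega> f (c *\<^sub>R \<phi>) = c * regular_distr \<Omega> f \<phi>"
    using \<phi> by (simp add: regular_distr_test scaleR_fun_def mult.left_commute)
qed

lemma regular_distr_distribution:
  fixes f :: "real^'n::finite \<Rightarrow> real"
  assumes loc: "locally_integrable_on \<Omega> f"
  shows "regular_distr \<Omega> f \<in> distributions \<Omega>"
proof (rule distributionsI[OF _ regular_distr_linear[OF loc]])
  fix K assume K: "compact K" "K \<subseteq> \<Omega>"
  have int: "integrable lborel (\<lambda>x. indicator K x * f x)"
    using loc K unfolding locally_integrable_on_def set_integrable_def by simp
  define C where "C = (\<integral>x. \<bar>indicator K x * f x\<bar> \<partial>lborel)"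
  show "\<exists>C m. \<forall>\<phi>\<in>test_functions \<Omega>. closure {x. \<phi> x \<noteq> 0} \<subseteq> K \<longrightarrow> ennreal \<bar>regular_distr \<Omega> f \<phi>\<bar>
      \<le> ennreal C * test_norm K m \<phi>"
  proof (intro exI[of _ C] exI[of _ 0] ballI impI)
    fix \<phi> assume \<phi>: "\<phi> \<in> test_functions \<Omega>" and supp: "closure {x. \<phi> x \<noteq> 0} \<subseteq> K"
    obtain \<beta> where \<beta>: "0 \<le> \<beta>" "test_norm K 0 \<phi> = ennreal \<beta>"
      "\<And>is x. length is \<le> 0 \<Longrightarrow> x \<in> K \<Longrightarrow> \<bar>foldr partial is \<phi> x\<bar> \<le> \<beta>"
      using test_norm_finite[OF \<phi>, of K 0] by metis
    have b: "\<bar>\<phi> x\<bar> \<le> \<beta>" if "x \<in> K" for x using \<beta>(3)[of "[]" x] that by simp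
    have z: "\<phi> x = 0" if "x \<notin> K" for x using partials_zero_off_support[OF \<phi> supp that, of "[]"]
        by simp
    have "\<bar>regular_distr \<Omega> f \<phi>\<bar> = \<bar>\<integral>x. indicator \<Omega> x *\<^sub>R (f x * \<phi> x) \<partial>lborel\<bar>"
      using \<phi> by (simp add: regular_distr_test set_lebesgue_integral_def)
    also have "\<dots> \<le> (\<integral>x. \<bar>indicator \<Omega> x *\<^sub>R (f x * \<phi> x)\<bar> \<partial>lborel)" by (rule integral_abs_bound)
    also have "\<dots> \<le> (\<integral>x. \<bar>indicator K x * f x\<bar> * \<beta> \<partial>lborel)"
    proof (rule integral_mono)
      show "integrable lborel (\<lambda>x. \<bar>indicator \<Omega> x *\<^sub>R (f x * \<phi> x)\<bar>)"
        using integrable_mult_test[OF loc \<phi>] unfolding set_integrable_def by (rule integrable_abs)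
      show "integrable lborel (\<lambda>x. \<bar>indicator K x * f x\<bar> * \<beta>)" using int
          by (intro integrable_mult_left integrable_abs)
      show "\<bar>indicator \<Omega> x *\<^sub>R (f x * \<phi> x)\<bar> \<le> \<bar>indicator K x * f x\<bar> * \<beta>" for x
        using b[of x] z[of x] K(2) by (cases "x \<in> K") (auto simp: abs_mult indicator_def intro!:
            mult_left_mono)
    qed
    also have "\<dots> = C * \<beta>" by (simp add: C_def)
    finally have "\<bar>regular_distr \<Omega> f \<phi>\<bar> \<le> C * \<beta>" .
    then show "ennreal \<bar>regular_distr \<Omega> f \<phi>\<bar> \<le> ennreal C * test_norm K 0 \<phi>"
      unfolding \<beta>(2) using \<beta>(1) by (simp add: ennreal_leI flip: ennreal_mult'')
  qed
qed (simp add: regular_distr_def)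

lemma finite_sobolev_norm_nonneg_distribution:
  assumes "open \<Omega>" "1 < p" "sobolev_norm_nonneg \<Omega> t p u < \<infinity>" "\<And>\<phi>. \<phi> \<notin> test_functions \<Omega> \<Longrightarrow> u \<phi> = 0"
  shows "u \<in> distributions \<Omega>"
proof -
  define s where "s = enn2real (sobolev_norm_nonneg \<Omega> t p u)"
  have s: "0 \<le> s" "sobolev_norm_nonneg \<Omega> t p u \<le> ennreal s"
    using assms(3) by (auto simp: s_def less_top)
  obtain f where f: "sobolev_bounded \<Omega> (nat \<lfloor>t\<rfloor>) (frac t) p (ennreal (s powr p)) f"
    "\<And>\<phi>. \<phi> \<in> test_functions \<Omega> \<Longrightarrow> u \<phi> = (LINT x:\<Omega>|lborel. f [] x * \<phi> x)"
    using sobolev_norm_nonneg_le_obtain[OF assms(1,2) s] by metis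
  have "u = regular_distr \<Omega> (f [])"
    using f(2) assms(4) by (auto simp: fun_eq_iff regular_distr_def)
  moreover have "locally_integrable_on \<Omega> (f [])"
    using f(1) by (simp add: sobolev_bounded_def weak_derivs_def)
  ultimately show ?thesis using regular_distr_distribution by simp
qed

lemma test_function_locally_integrable: "\<phi> \<in> test_functions \<Omega> \<Longrightarrow> locally_integrable_on \<Omega>' \<phi>"
  using integrable_imp_locally_integrable test_functions_integrable by blast

lemma sobolev_norm_nonneg_zero: "sobolev_norm_nonneg \<Omega> t p 0 = 0"
proof -
  have d: "distr_deriv \<Omega> \<nu> 0 = 0" for \<nu> by (auto simp: distr_deriv_def fun_eq_iff)
  have z: "on_density \<Omega> N (distr_deriv \<Omega> \<nu> 0) = 0" if "N (\<lambda>x. 0) = 0" for N \<nu>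
  proof -
    have "locally_integrable_on \<Omega> (\<lambda>x. 0)" by (simp add: locally_integrable_on_def
        set_integrable_def)
    moreover have "regular_distr \<Omega> (\<lambda>x. 0) = distr_deriv \<Omega> \<nu> 0"
      unfolding d by (auto simp: regular_distr_def fun_eq_iff set_lebesgue_integral_def)
    ultimately show ?thesis using on_density_le[of \<Omega> "\<lambda>x. 0" _ N] that by (metis le_zero_eq)
  qed
  have "Lp_norm \<Omega> p (\<lambda>x. 0) = 0" "slobodeckij_seminorm \<Omega> \<theta> p (\<lambda>x. 0) = 0" for \<theta>
    by (auto simp: Lp_norm_def slobodeckij_seminorm_def ennroot_def)
  then show ?thesis unfolding sobolev_norm_nonneg_def by (simp add: z)
qed

lemma regular_test_in_sobolev0:
  assumes "open \<Omega>" "1 < p" "\<phi> \<in> test_functions \<Omega>"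
  shows "regular_distr \<Omega> \<phi> \<in> sobolev0 \<Omega> t p"
proof -
  let ?K = "closure {x. \<phi> x \<noteq> 0}"
  have K: "compact ?K" using assms(3) by (simp add: test_functions_def)
  obtain C where C: "sobolev_norm_nonneg \<Omega> t p (regular_distr \<Omega> \<phi>)
      \<le> ennreal C * test_norm ?K (Suc (nat \<lfloor>t\<rfloor>)) \<phi>"
    using sobolev_norm_nonneg_test_le[OF assms(1,2) K, of t] assms(3) by (metis order_refl)
  obtain \<beta> where "test_norm ?K (Suc (nat \<lfloor>t\<rfloor>)) \<phi> = ennreal \<beta>" using test_norm_finite[OF assms(3)]
      by metis
  then have "sobolev_norm_nonneg \<Omega> t p (regular_distr \<Omega> \<phi>) < \<infinity>"
    using order_le_less_trans[OF C, of \<infinity>] by (simp add: ennreal_mult_less_top)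
  moreover have "\<exists>\<psi>\<in>test_functions \<Omega>. sobolev_norm_nonneg \<Omega> t p (regular_distr \<Omega> \<phi> -
      regular_distr \<Omega> \<psi>) < ennreal \<epsilon>" if "0 < \<epsilon>" for \<epsilon>
    using that by (intro bexI[OF _ assms(3)]) (simp add: sobolev_norm_nonneg_zero)
  ultimately show ?thesis
    unfolding sobolev0_def using regular_distr_distribution[OF
        test_function_locally_integrable[OF assms(3)]] by blast
qed

section \<open>Multiplication by a cutoff function, arbitrary smoothness\<close>

lemma le_ennreal_mult_Inf:
  assumes "0 < C" "\<And>c. c \<in> A \<Longrightarrow> x \<le> ennreal C * c"
  shows "x \<le> ennreal C * Inf A"
proof -
  have i: "ennreal (1 / C) * ennreal C = 1" using assms(1) by (simp flip: ennreal_mult'')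
  have "ennreal (1 / C) * x \<le> c" if "c \<in> A" for c
  proof -
    have "ennreal (1 / C) * x \<le> ennreal (1 / C) * (ennreal C * c)"
        by (intro mult_left_mono assms(2) that) simp
    also have "\<dots> = c" by (simp add: mult.assoc[symmetric] i)
    finally show ?thesis .
  qed
  then have "ennreal (1 / C) * x \<le> Inf A" by (intro Inf_greatest)
  then have "ennreal C * (ennreal (1 / C) * x) \<le> ennreal C * Inf A" by (intro mult_left_mono) auto
  moreover have "ennreal C * (ennreal (1 / C) * x) = x"
    using i by (simp add: mult.assoc[symmetric] mult.commute[of "ennreal C"])
  ultimately show ?thesis by simp
qed

lemma test_functions_mult_inter:
  assumes "h \<in> test_functions (\<Omega>1 \<inter> \<Omega>2)" "smooth_on UNIV g"
  shows "(\<lambda>x. h x * g x) \<in> test_functions \<Omega>1" "(\<lambda>x. h x * g x) \<in> test_functions \<Omega>2"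
  using test_functions_mult[OF assms] test_functions_mono[of "\<Omega>1 \<inter> \<Omega>2"] by blast+

lemma cutoff_distr_regular:
  assumes "h \<in> test_functions (\<Omega>1 \<inter> \<Omega>2)" "smooth_on UNIV \<phi>"
  shows "cutoff_distr \<Omega>2 h (regular_distr \<Omega>1 \<phi>) = regular_distr \<Omega>2 (\<lambda>x. h x * \<phi> x)"
proof
  fix \<psi>
  show "cutoff_distr \<Omega>2 h (regular_distr \<Omega>1 \<phi>) \<psi> = regular_distr \<Omega>2 (\<lambda>x. h x * \<phi> x) \<psi>"
  proof (cases "\<psi> \<in> test_functions \<Omega>2")
    case True
    have "(\<lambda>x. indicator \<Omega>1 x *\<^sub>R (\<phi> x * (h x * \<psi> x))) = (\<lambda>x. indicator \<Omega>2 x *\<^sub>R (h x * \<phi> x * \<psi> x))"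
      using test_functions_outside[OF assms(1)] by (auto simp: fun_eq_iff indicator_def)
    then show ?thesis
      using True test_functions_mult_inter[OF assms(1) test_functions_smooth[OF True]]
      by (simp add: cutoff_distr_def regular_distr_test set_lebesgue_integral_def)
  qed (simp add: cutoff_distr_def regular_distr_def)
qed

lemma cutoff_distr_diff: "cutoff_distr \<Omega> h (u - v) = cutoff_distr \<Omega> h u - cutoff_distr \<Omega> h v"
  and cutoff_distr_add: "cutoff_distr \<Omega> h (u + v) = cutoff_distr \<Omega> h u + cutoff_distr \<Omega> h v"
  and cutoff_distr_scale: "cutoff_distr \<Omega> h (c *\<^sub>R u) = c *\<^sub>R cutoff_distr \<Omega> h u"
  by (auto simp: cutoff_distr_def fun_eq_iff scaleR_fun_def)

text \<open>The approximating test functions are multiplied by \<open>h\<close> as well.\<close>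

lemma cutoff_distr_sobolev0:
  assumes \<Omega>: "open \<Omega>1" "open \<Omega>2" and h: "h \<in> test_functions (\<Omega>1 \<inter> \<Omega>2)" and p: "1 < p"
    and w: "w \<in> sobolev0 \<Omega>1 t p"
  shows "cutoff_distr \<Omega>2 h w \<in> sobolev0 \<Omega>2 t p"
proof -
  obtain C where C: "0 < C" "\<And>u. sobolev_norm_nonneg \<Omega>2 t p (cutoff_distr \<Omega>2 h u)
      \<le> ennreal C * sobolev_norm_nonneg \<Omega>1 t p u"
    using cutoff_distr_norm_nonneg[OF \<Omega> h p, of t] by metis
  have fin: "sobolev_norm_nonneg \<Omega>2 t p (cutoff_distr \<Omega>2 h w) < \<infinity>"
    using w order_le_less_trans[OF C(2)[of w], of \<infinity>]
        by (simp add: sobolev0_def ennreal_mult_less_top)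
  have "\<exists>\<psi>\<in>test_functions \<Omega>2. sobolev_norm_nonneg \<Omega>2 t p (cutoff_distr \<Omega>2 h w - regular_distr \<Omega>2
      \<psi>) < ennreal \<epsilon>"
    if \<epsilon>: "0 < \<epsilon>" for \<epsilon>
  proof -
    obtain \<phi> where \<phi>: "\<phi> \<in> test_functions \<Omega>1" "sobolev_norm_nonneg \<Omega>1 t p (w - regular_distr \<Omega>1
        \<phi>) < ennreal (\<epsilon> / C)"
    proof -
      have "0 < \<epsilon> / C" using \<epsilon> C(1) by simp
      then show ?thesis using w that unfolding sobolev0_def by blast
    qed
    have sm: "smooth_on UNIV \<phi>" by (rule test_functions_smooth[OF \<phi>(1)])
    have "sobolev_norm_nonneg \<Omega>2 t p (cutoff_distr \<Omega>2 h w - regular_distr \<Omega>2 (\<lambda>x. h x * \<phi> x))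
        \<le> ennreal C * sobolev_norm_nonneg \<Omega>1 t p (w - regular_distr \<Omega>1 \<phi>)"
      using C(2)[of "w - regular_distr \<Omega>1 \<phi>"] by (simp add: cutoff_distr_diff
          cutoff_distr_regular[OF h sm])
    also have "\<dots> < ennreal C * ennreal (\<epsilon> / C)"
      using \<phi>(2) C(1) by (intro ennreal_mult_strict_left_mono) auto
    also have "\<dots> = ennreal \<epsilon>" using C(1) \<epsilon> by (simp flip: ennreal_mult'')
    finally show ?thesis using test_functions_mult_inter(2)[OF h sm] by blast
  qed
  moreover have "cutoff_distr \<Omega>2 h w \<in> distributions \<Omega>2"
    by (rule finite_sobolev_norm_nonneg_distribution[OF \<Omega>(2) p fin]) (simp add: cutoff_distr_def)
  ultimately show ?thesis using fin unfolding sobolev0_def by blast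
qed

text \<open>For negative smoothness this is the transpose of the multiplication by \<open>h\<close> from \<open>\<Omega>2\<close> to \<open>\<Omega>1\<close>
  on the predual.\<close>

lemma cutoff_distr_norm:
  fixes \<Omega>1 \<Omega>2 :: "(real^'n::finite) set"
  assumes \<Omega>: "open \<Omega>1" "open \<Omega>2" and h: "h \<in> test_functions (\<Omega>1 \<inter> \<Omega>2)" and p: "1 < p"
  obtains C where "0 < C" "\<And>u. sobolev_norm \<Omega>2 s p (cutoff_distr \<Omega>2 h u)
      \<le> ennreal C * sobolev_norm \<Omega>1 s p u"
proof (cases "0 \<le> s")
  case True
  obtain C where "0 < C" "\<And>u. sobolev_norm_nonneg \<Omega>2 s p (cutoff_distr \<Omega>2 h u)
      \<le> ennreal C * sobolev_norm_nonneg \<Omega>1 s p u"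
    using cutoff_distr_norm_nonneg[OF \<Omega> h p, of s] by metis
  then show ?thesis using that True by (simp add: sobolev_norm_def)
next
  case False
  define t where "t = - s"
  define q where "q = p / (p - 1)"
  have q: "1 < q" using p by (simp add: q_def field_simps)
  have h': "h \<in> test_functions (\<Omega>2 \<inter> \<Omega>1)" using h by (simp add: Int_commute)
  obtain C where C: "0 < C" "\<And>w. sobolev_norm_nonneg \<Omega>1 t q (cutoff_distr \<Omega>1 h w)
      \<le> ennreal C * sobolev_norm_nonneg \<Omega>2 t q w"
    using cutoff_distr_norm_nonneg[OF \<Omega>(2,1) h' q, of t] by metis
  note s0 = cutoff_distr_sobolev0[OF \<Omega>(2,1) h' q]
  have main: "sobolev_norm \<Omega>2 s p (cutoff_distr \<Omega>2 h u) \<le> ennreal C * sobolev_norm \<Omega>1 s p u" for u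
  proof -
    define ext where "ext \<Omega> v = {L. linear_functional_on (sobolev0 \<Omega> t q) L \<and>
             (\<forall>\<phi>\<in>test_functions \<Omega>. L (regular_distr \<Omega> \<phi>) = v \<phi>)}"
      for \<Omega> :: "(real^'n) set" and v
    have N: "sobolev_norm \<Omega> s p v = (INF L\<in>ext \<Omega> v. sobolev0_dual_norm \<Omega> t q L)" for \<Omega> v
      using False by (simp add: sobolev_norm_def ext_def t_def q_def)
    show ?thesis
      unfolding N
    proof (rule le_ennreal_mult_Inf[OF C(1)])
      fix c assume "c \<in> sobolev0_dual_norm \<Omega>1 t q ` ext \<Omega>1 u"
      then obtain L where L: "L \<in> ext \<Omega>1 u" "c = sobolev0_dual_norm \<Omega>1 t q L" by blast
      have Llin: "L (x + y) = L x + L y" "L (a *\<^sub>R x) = a * L x" if "x \<in> sobolev0 \<Omega>1 t q" "y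
          \<in> sobolev0 \<Omega>1 t q" for x y a
        using L(1) that by (auto simp: ext_def linear_functional_on_def)
      \<comment> \<open>The transpose: \<open>L'\<close> extends the product of \<open>h\<close> and \<open>u\<close> to the predual on \<open>\<Omega>2\<close>.\<close>
      define L' where "L' w = L (cutoff_distr \<Omega>1 h w)" for w
      have "linear_functional_on (sobolev0 \<Omega>2 t q) L'"
        unfolding linear_functional_on_def L'_def cutoff_distr_add cutoff_distr_scale
            using Llin s0 by blast
      moreover have "L' (regular_distr \<Omega>2 \<phi>) = cutoff_distr \<Omega>2 h u \<phi>" if "\<phi> \<in> test_functions \<Omega>2"
          for \<phi>
        using that L(1) test_functions_mult_inter(1)[OF h test_functions_smooth[OF that]]
        by (simp add: L'_def cutoff_distr_regular[OF h' test_functions_smooth[OF that]] ext_def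
            cutoff_distr_def)
      ultimately have L': "L' \<in> ext \<Omega>2 (cutoff_distr \<Omega>2 h u)" by (simp add: ext_def)
      have "sobolev0_dual_norm \<Omega>2 t q L' \<le> ennreal C * c"
        unfolding L(2) sobolev0_dual_norm_def[of \<Omega>1]
      proof (rule le_ennreal_mult_Inf[OF C(1)])
        fix d assume "d \<in> {C. \<forall>w\<in>sobolev0 \<Omega>1 t q. ennreal \<bar>L w\<bar> \<le> C * sobolev_norm_nonneg \<Omega>1 t q w}"
        then have d: "ennreal \<bar>L w\<bar> \<le> d * sobolev_norm_nonneg \<Omega>1 t q w" if "w \<in> sobolev0 \<Omega>1 t q"
            for w
          using that by blast
        have "ennreal \<bar>L' w\<bar> \<le> ennreal C * d * sobolev_norm_nonneg \<Omega>2 t q w" if w: "w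
            \<in> sobolev0 \<Omega>2 t q" for w
        proof -
          have "ennreal \<bar>L' w\<bar> \<le> d * sobolev_norm_nonneg \<Omega>1 t q (cutoff_distr \<Omega>1 h w)"
            unfolding L'_def by (rule d[OF s0[OF w]])
          also have "\<dots> \<le> d * (ennreal C * sobolev_norm_nonneg \<Omega>2 t q w)"
              by (intro mult_left_mono C(2)) simp
          finally show ?thesis by (simp add: mult_ac)
        qed
        then show "sobolev0_dual_norm \<Omega>2 t q L' \<le> ennreal C * d"
          unfolding sobolev0_dual_norm_def by (intro Inf_lower) simp
      qed
      then show "(INF L\<in>ext \<Omega>2 (cutoff_distr \<Omega>2 h u). sobolev0_dual_norm \<Omega>2 t q L) \<le> ennreal C * c"
        by (rule order_trans[OF INF_lower[OF L']])
    qed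
  qed
  then show ?thesis using that C(1) by blast
qed

text \<open>For \<open>s < 0\<close> the bounded extension to the predual is evaluated at regular distributions of
  test functions, which depend linearly and continuously on the test function.\<close>

lemma finite_sobolev_norm_distribution:
  fixes \<Omega> :: "(real^'n::finite) set"
  assumes \<Omega>: "open \<Omega>" and p: "1 < p" and fin: "sobolev_norm \<Omega> s p u < \<infinity>"
    and off: "\<And>\<phi>. \<phi> \<notin> test_functions \<Omega> \<Longrightarrow> u \<phi> = 0"
  shows "u \<in> distributions \<Omega>"
proof (cases "0 \<le> s")
  case True
  then show ?thesis using finite_sobolev_norm_nonneg_distribution[OF \<Omega> p _ off] fin
      by (simp add: sobolev_norm_def)
next
  case False
  define t where "t = - s"
  define q where "q = p / (p - 1)"
  have q: "1 < q" using p by (simp add: q_def field_simps)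
  obtain L where L: "linear_functional_on (sobolev0 \<Omega> t q) L" "\<And>\<phi>. \<phi> \<in> test_functions \<Omega>
      \<Longrightarrow> L (regular_distr \<Omega> \<phi>) = u \<phi>"
    "sobolev0_dual_norm \<Omega> t q L < \<infinity>"
  proof -
    have "(INF L\<in>{L. linear_functional_on (sobolev0 \<Omega> t q) L \<and>
        (\<forall>\<phi>\<in>test_functions \<Omega>. L (regular_distr \<Omega> \<phi>) = u \<phi>)}. sobolev0_dual_norm \<Omega> t q L) < \<infinity>"
      using fin False unfolding sobolev_norm_def t_def q_def by simp
    then show ?thesis using that unfolding INF_less_iff by blast
  qed
  obtain d where d: "d < \<infinity>" "\<And>w. w \<in> sobolev0 \<Omega> t q \<Longrightarrow> ennreal \<bar>L w\<bar>
      \<le> d * sobolev_norm_nonneg \<Omega> t q w"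
    using L(3) unfolding sobolev0_dual_norm_def Inf_less_iff by blast
  note s0 = regular_test_in_sobolev0[OF \<Omega> q]
  show ?thesis
  proof (rule distributionsI[OF off])
    show "linear_functional_on (test_functions \<Omega>) u"
      unfolding linear_functional_on_def
    proof (intro conjI ballI allI)
      fix \<phi> \<psi> assume *: "\<phi> \<in> test_functions \<Omega>" "\<psi> \<in> test_functions \<Omega>"
      have **: "\<phi> + \<psi> \<in> test_functions \<Omega>" using test_functions_add[OF *] by (simp add: plus_fun_def)
      have "regular_distr \<Omega> (\<phi> + \<psi>) = regular_distr \<Omega> \<phi> + regular_distr \<Omega> \<psi>"
      proof
        fix \<eta>
        show "regular_distr \<Omega> (\<phi> + \<psi>) \<eta> = (regular_distr \<Omega> \<phi> + regular_distr \<Omega> \<psi>) \<eta>"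
          using set_integral_add(2)[OF integrable_mult_test[OF
              test_function_locally_integrable[OF *(1)]]
              integrable_mult_test[OF test_function_locally_integrable[OF *(2)]], of \<eta> \<Omega> \<eta>]
          by (simp add: regular_distr_def distrib_right)
      qed
      then show "u (\<phi> + \<psi>) = u \<phi> + u \<psi>"
        using L(1) L(2)[OF *(1)] L(2)[OF *(2)] L(2)[OF **] s0[OF *(1)] s0[OF *(2)]
        by (simp add: linear_functional_on_def)
    next
      fix c \<phi> assume \<phi>: "\<phi> \<in> test_functions \<Omega>"
      have c: "c *\<^sub>R \<phi> \<in> test_functions \<Omega>" using test_functions_scale[OF \<phi>]
          by (simp add: scaleR_fun_def)
      have "regular_distr \<Omega> (c *\<^sub>R \<phi>) = c *\<^sub>R regular_distr \<Omega> \<phi>"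
        by (auto simp: fun_eq_iff regular_distr_def scaleR_fun_def mult.assoc)
      then show "u (c *\<^sub>R \<phi>) = c * u \<phi>"
        using L(1) L(2)[OF \<phi>] L(2)[OF c] s0[OF \<phi>] by (simp add: linear_functional_on_def)
    qed
    fix K assume K: "compact K" "K \<subseteq> \<Omega>"
    obtain C where C: "0 \<le> C" "\<And>\<phi>. \<phi> \<in> test_functions \<Omega> \<Longrightarrow> closure {x. \<phi> x \<noteq> 0} \<subseteq> K \<Longrightarrow>
      sobolev_norm_nonneg \<Omega> t q (regular_distr \<Omega> \<phi>) \<le> ennreal C * test_norm K (Suc (nat \<lfloor>t\<rfloor>)) \<phi>"
      using sobolev_norm_nonneg_test_le[OF \<Omega> q K(1), of t] by metis
    have d': "d = ennreal (enn2real d)" using d(1) by (simp add: less_top)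
    show "\<exists>C m. \<forall>\<phi>\<in>test_functions \<Omega>. closure {x. \<phi> x \<noteq> 0} \<subseteq> K \<longrightarrow> ennreal \<bar>u \<phi>\<bar>
        \<le> ennreal C * test_norm K m \<phi>"
    proof (intro exI ballI impI)
      fix \<phi> assume \<phi>: "\<phi> \<in> test_functions \<Omega>" "closure {x. \<phi> x \<noteq> 0} \<subseteq> K"
      have "ennreal \<bar>u \<phi>\<bar> \<le> d * sobolev_norm_nonneg \<Omega> t q (regular_distr \<Omega> \<phi>)"
        using d(2)[OF s0[OF \<phi>(1)]] L(2)[OF \<phi>(1)] by simp
      also have "\<dots> \<le> d * (ennreal C * test_norm K (Suc (nat \<lfloor>t\<rfloor>)) \<phi>)"
        by (intro mult_left_mono C(2) \<phi>) simp
      also have "\<dots> = ennreal (enn2real d * C) * test_norm K (Suc (nat \<lfloor>t\<rfloor>)) \<phi>"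
        using C(1) d' by (simp add: ennreal_mult mult.assoc)
      finally show "ennreal \<bar>u \<phi>\<bar> \<le> ennreal (enn2real d * C) * test_norm K (Suc (nat \<lfloor>t\<rfloor>)) \<phi>" .
    qed
  qed
qed

text \<open>The two multiplications \<open>\<Omega>1 \<rightarrow> \<Omega>2 \<rightarrow> \<Omega>1\<close> reproduce a distribution that does not see the
  difference between \<open>\<phi>\<close> and \<open>h \<phi>\<close>, and transfer the embedding on \<open>\<Omega>2\<close> to such distributions.\<close>

lemma sobolev_embeds_transfer:
  fixes \<Omega>1 \<Omega>2 :: "(real^'n::finite) set"
  assumes \<Omega>: "open \<Omega>1" "open \<Omega>2" and h: "h \<in> test_functions (\<Omega>1 \<inter> \<Omega>2)"
    and q: "1 < q1" "1 < q2" and emb: "sobolev_embeds \<Omega>2 e1 q1 e2 q2"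
    and u: "\<And>\<phi>. \<phi> \<in> test_functions \<Omega>1 \<Longrightarrow> u \<phi> = u (\<lambda>x. h x * \<phi> x)" "\<And>\<phi>. \<phi> \<notin> test_functions \<Omega>1 \<Longrightarrow> u \<phi>
        = 0"
    and fin: "sobolev_norm \<Omega>1 e1 q1 u < \<infinity>"
  shows "sobolev_norm \<Omega>1 e2 q2 u < \<infinity>"
    and "0 < \<epsilon> \<Longrightarrow> \<exists>\<delta>>0. \<forall>v. (\<forall>\<phi>\<in>test_functions \<Omega>1. v \<phi> = v (\<lambda>x. h x * \<phi> x))
        \<longrightarrow> (\<forall>\<phi>. \<phi> \<notin> test_functions \<Omega>1 \<longrightarrow> v \<phi> = 0) \<longrightarrow>
      sobolev_norm \<Omega>1 e1 q1 v < \<infinity> \<longrightarrow> sobolev_norm \<Omega>1 e1 q1 (v - u) < ennreal \<delta> \<longrightarrow>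
      sobolev_norm \<Omega>1 e2 q2 (v - u) < ennreal \<epsilon>"
proof -
  let ?T = "cutoff_distr \<Omega>2 h"
  have h': "h \<in> test_functions (\<Omega>2 \<inter> \<Omega>1)" using h by (simp add: Int_commute)
  obtain C1 where C1: "0 < C1" "\<And>v. sobolev_norm \<Omega>2 e1 q1 (?T v)
      \<le> ennreal C1 * sobolev_norm \<Omega>1 e1 q1 v"
    using cutoff_distr_norm[OF \<Omega> h q(1), of e1] by metis
  obtain C2 where C2: "0 < C2" "\<And>v. sobolev_norm \<Omega>1 e2 q2 (cutoff_distr \<Omega>1 h v)
      \<le> ennreal C2 * sobolev_norm \<Omega>2 e2 q2 v"
    using cutoff_distr_norm[OF \<Omega>(2,1) h' q(2), of e2] by metis
  have TT: "cutoff_distr \<Omega>1 h (?T v) = v"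
    if v: "\<And>\<phi>. \<phi> \<in> test_functions \<Omega>1 \<Longrightarrow> v \<phi> = v (\<lambda>x. h x * \<phi> x)" "\<And>\<phi>. \<phi> \<notin> test_functions \<Omega>1 \<Longrightarrow> v \<phi>
        = 0" for v
  proof
    fix \<phi>
    show "cutoff_distr \<Omega>1 h (?T v) \<phi> = v \<phi>"
    proof (cases "\<phi> \<in> test_functions \<Omega>1")
      case True
      note t = test_functions_mult_inter[OF h test_functions_smooth[OF True]]
      show ?thesis using True t v(1)[OF True] v(1)[OF t(1)] by (simp add: cutoff_distr_def)
    qed (simp add: cutoff_distr_def v(2))
  qed
  have TTu: "cutoff_distr \<Omega>1 h (?T u) = u"
    by (rule TT[of u]) (erule u)+
  have T: "?T v \<in> sobolev \<Omega>2 e1 q1" if v: "sobolev_norm \<Omega>1 e1 q1 v < \<infinity>" for v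
  proof -
    have "sobolev_norm \<Omega>2 e1 q1 (?T v) < \<infinity>"
      using v order_le_less_trans[OF C1(2)[of v], of \<infinity>] by (simp add: ennreal_mult_less_top)
    moreover from this have "?T v \<in> distributions \<Omega>2"
      by (rule finite_sobolev_norm_distribution[OF \<Omega>(2) q(1)]) (simp add: cutoff_distr_def)
    ultimately show ?thesis by (simp add: sobolev_def)
  qed
  have Tu: "?T u \<in> sobolev \<Omega>2 e2 q2"
    using emb T[OF fin] unfolding sobolev_embeds_def continuously_included_def by blast
  show "sobolev_norm \<Omega>1 e2 q2 u < \<infinity>"
    using C2(2)[of "?T u"] Tu unfolding TTu sobolev_def
    by (auto simp: ennreal_mult_less_top intro: order_le_less_trans)
  show "\<exists>\<delta>>0. \<forall>v. (\<forall>\<phi>\<in>test_functions \<Omega>1. v \<phi> = v (\<lambda>x. h x * \<phi> x)) \<longrightarrow> (\<forall>\<phi>. \<phi> \<notin> test_functions \<Omega>1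
      \<longrightarrow> v \<phi> = 0) \<longrightarrow>
      sobolev_norm \<Omega>1 e1 q1 v < \<infinity> \<longrightarrow> sobolev_norm \<Omega>1 e1 q1 (v - u) < ennreal \<delta> \<longrightarrow>
      sobolev_norm \<Omega>1 e2 q2 (v - u) < ennreal \<epsilon>" if "0 < \<epsilon>"
  proof -
    have "0 < \<epsilon> / C2" using that C2(1) by simp
    then obtain \<delta> where \<delta>: "0 < \<delta>" "\<And>w. w \<in> sobolev \<Omega>2 e1 q1 \<Longrightarrow> sobolev_norm \<Omega>2 e1 q1 (w - ?T u)
        < ennreal \<delta> \<Longrightarrow>
        sobolev_norm \<Omega>2 e2 q2 (w - ?T u) < ennreal (\<epsilon> / C2)"
      using emb T[OF fin] unfolding sobolev_embeds_def continuously_included_def by meson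
    show ?thesis
    proof (intro exI[of _ "\<delta> / C1"] conjI allI impI)
      show "0 < \<delta> / C1" using \<delta>(1) C1(1) by simp
      fix v assume v: "\<forall>\<phi>\<in>test_functions \<Omega>1. v \<phi> = v (\<lambda>x. h x * \<phi> x)" "\<forall>\<phi>. \<phi> \<notin> test_functions \<Omega>1
          \<longrightarrow> v \<phi> = 0"
        and fv: "sobolev_norm \<Omega>1 e1 q1 v < \<infinity>" and close: "sobolev_norm \<Omega>1 e1 q1 (v - u)
            < ennreal (\<delta> / C1)"
      have "sobolev_norm \<Omega>2 e1 q1 (?T v - ?T u) \<le> ennreal C1 * sobolev_norm \<Omega>1 e1 q1 (v - u)"
        using C1(2)[of "v - u"] by (simp add: cutoff_distr_diff)
      also have "\<dots> < ennreal C1 * ennreal (\<delta> / C1)"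
        using close C1(1) by (intro ennreal_mult_strict_left_mono) auto
      also have "\<dots> = ennreal \<delta>" using C1(1) \<delta>(1) by (simp flip: ennreal_mult'')
      finally have s: "sobolev_norm \<Omega>2 e2 q2 (?T v - ?T u) < ennreal (\<epsilon> / C2)"
          by (rule \<delta>(2)[OF T[OF fv]])
      have "v - u = cutoff_distr \<Omega>1 h (?T v - ?T u)"
        using TT[of v] TTu v by (simp add: cutoff_distr_diff)
      then have "sobolev_norm \<Omega>1 e2 q2 (v - u) \<le> ennreal C2 * sobolev_norm \<Omega>2 e2 q2 (?T v - ?T u)"
        using C2(2)[of "?T v - ?T u"] by simp
      also have "\<dots> < ennreal C2 * ennreal (\<epsilon> / C2)"
        using s C2(1) by (intro ennreal_mult_strict_left_mono) auto
      also have "\<dots> = ennreal \<epsilon>" using C2(1) that by (simp flip: ennreal_mult'')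
      finally show "sobolev_norm \<Omega>1 e2 q2 (v - u) < ennreal \<epsilon>" .
    qed
  qed
qed

section \<open>Charts and transition maps\<close>

lemma is_chartE:
  assumes "is_chart X c"
  shows "openin X (fst c)" "open (snd c ` fst c)" "inj_on (snd c) (fst c)"
    "continuous_map (top_of_set (snd c ` fst c)) X (chart_inv c)"
    "continuous_map (subtopology X (fst c)) euclidean (snd c)"
    "\<And>V. openin X V \<Longrightarrow> open (snd c ` (fst c \<inter> V))"
proof -
  have U: "openin X (fst c)" and O: "open (snd c ` fst c)"
    and h: "homeomorphic_map (subtopology X (fst c)) (top_of_set (snd c ` fst c)) (snd c)"
    using assms by (auto simp: is_chart_def)
  have ts: "topspace (subtopology X (fst c)) = fst c" using openin_subset[OF U] by auto
  show "openin X (fst c)" "open (snd c ` fst c)" by (fact U O)+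
  show inj: "inj_on (snd c) (fst c)" using homeomorphic_imp_injective_map[OF h] ts by simp
  obtain g where g: "homeomorphic_maps (subtopology X (fst c)) (top_of_set (snd c ` fst c)) (snd
      c) g"
    using h homeomorphic_map_maps by blast
  have "chart_inv c y = g y" if "y \<in> snd c ` fst c" for y
    using that g ts inj unfolding homeomorphic_maps_def by (auto simp: inv_into_f_f)
  then have "continuous_map (top_of_set (snd c ` fst c)) (subtopology X (fst c)) (chart_inv c)"
    using g unfolding homeomorphic_maps_def by (auto intro: continuous_map_eq)
  then show "continuous_map (top_of_set (snd c ` fst c)) X (chart_inv c)"
    by (rule continuous_map_into_fulltopology)
  show "continuous_map (subtopology X (fst c)) euclidean (snd c)"
    using homeomorphic_imp_continuous_map[OF h] by (rule continuous_map_into_fulltopology)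
  show "open (snd c ` (fst c \<inter> V))" if "openin X V" for V
  proof -
    have "openin (subtopology X (fst c)) (fst c \<inter> V)" using that
        by (simp add: openin_subtopology_Int2)
    then have "openin (top_of_set (snd c ` fst c)) (snd c ` (fst c \<inter> V))"
      using homeomorphic_imp_open_map[OF h] by (simp add: open_map_def)
    then show ?thesis using O by (simp add: openin_open_eq)
  qed
qed

lemma chart_inv_simps:
  assumes "is_chart X c"
  shows "x \<in> fst c \<Longrightarrow> chart_inv c (snd c x) = x"
    "y \<in> snd c ` fst c \<Longrightarrow> snd c (chart_inv c y) = y"
    "y \<in> snd c ` fst c \<Longrightarrow> chart_inv c y \<in> fst c"
  using is_chartE(3)[OF assms] by (auto simp: inv_into_f_f)

lemma smooth_chart_is_chart: "smooth_chart M c \<Longrightarrow> is_chart (mtop M) c"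
  by (simp add: smooth_chart_def)

lemma atlas_chart:
  assumes "smooth_manifold M" "x \<in> mspace M"
  obtains b where "b \<in> matlas M" "x \<in> fst b" "is_chart (mtop M) b"
  using assms unfolding smooth_manifold_def by blast

text \<open>A smooth chart is compatible with the charts of the atlas by definition; two smooth charts
  are compatible because near each point the transition map factors through a chart of the atlas.\<close>

lemma transition_smooth:
  fixes M :: "('a, 'v::euclidean_space) mfd"
  assumes M: "smooth_manifold M" and c: "smooth_chart M c" and d: "smooth_chart M d"
  shows "smooth_on (snd c ` (fst c \<inter> fst d)) (snd d \<circ> chart_inv c)"
proof (rule smooth_on_local)
  note cc = smooth_chart_is_chart[OF c] and dd = smooth_chart_is_chart[OF d]
  fix y assume "y \<in> snd c ` (fst c \<inter> fst d)"
  then obtain x where x: "x \<in> fst c" "x \<in> fst d" "y = snd c x" by blast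
  have "x \<in> mspace M" using x(1) is_chartE(1)[OF cc] openin_subset by blast
  then obtain b where b: "b \<in> matlas M" "x \<in> fst b" "is_chart (mtop M) b" using atlas_chart[OF M]
      by metis
  let ?T = "snd c ` (fst c \<inter> (fst d \<inter> fst b))"
  let ?S = "snd b ` (fst b \<inter> fst d)"
  have oT: "open ?T" using is_chartE(6)[OF cc] is_chartE(1)[OF dd] is_chartE(1)[OF b(3)] by blast
  have oS: "open ?S" using is_chartE(6)[OF b(3)] is_chartE(1)[OF dd] by blast
  have "smooth_on (snd c ` (fst c \<inter> fst b)) (snd b \<circ> chart_inv c)"
    using c b(1) unfolding smooth_chart_def smooth_compatible_def by blast
  then have s1: "smooth_on ?T (snd b \<circ> chart_inv c)" by (rule smooth_on_subset) blast
  have s2: "smooth_on ?S (snd d \<circ> chart_inv b)"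
    using d b(1) unfolding smooth_chart_def smooth_compatible_def by (simp add: Int_commute)
  have "(snd b \<circ> chart_inv c) ` ?T \<subseteq> ?S" using chart_inv_simps(1)[OF cc] by auto
  from smooth_on_compose[OF oT oS this s1 s2]
  have "smooth_on ?T (\<lambda>y. (snd d \<circ> chart_inv b) ((snd b \<circ> chart_inv c) y))" .
  then have "smooth_on ?T (snd d \<circ> chart_inv c)"
    by (rule smooth_on_cong[OF oT, rotated]) (use chart_inv_simps(1)[OF cc] chart_inv_simps(1)[OF
        b(3)] in auto)
  then show "\<exists>T. open T \<and> y \<in> T \<and> smooth_on T (snd d \<circ> chart_inv c)"
    using oT x b(2) by blast
qed

lemma transition_has_derivative:
  fixes M :: "('a, 'v::euclidean_space) mfd"
  assumes M: "smooth_manifold M" and c: "smooth_chart M c" and d: "smooth_chart M d"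
    and x: "x \<in> fst c" "x \<in> fst d"
  shows "(snd d \<circ> chart_inv c has_derivative frechet_derivative (snd d \<circ> chart_inv c) (at (snd c
      x))) (at (snd c x))"
  using smooth_on_has_derivative[OF transition_smooth[OF M c d]] x by blast

lemma transition_chain_rule:
  fixes M :: "('a, 'v::euclidean_space) mfd"
  assumes M: "smooth_manifold M" and c: "smooth_chart M c" and d: "smooth_chart M d" and e:
      "smooth_chart M e"
    and x: "x \<in> fst c" "x \<in> fst d" "x \<in> fst e"
  shows "frechet_derivative (snd e \<circ> chart_inv c) (at (snd c x)) v =
    frechet_derivative (snd e \<circ> chart_inv d) (at (snd d x)) (frechet_derivative (snd d \<circ>
        chart_inv c) (at (snd c x)) v)"
proof -
  note cc = smooth_chart_is_chart[OF c] and dd = smooth_chart_is_chart[OF d]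
  have p: "(snd d \<circ> chart_inv c) (snd c x) = snd d x" using chart_inv_simps(1)[OF cc x(1)] by simp
  have "((snd e \<circ> chart_inv d) \<circ> (snd d \<circ> chart_inv c) has_derivative
      frechet_derivative (snd e \<circ> chart_inv d) (at (snd d x)) \<circ> frechet_derivative (snd d \<circ>
          chart_inv c) (at (snd c x))) (at (snd c x))"
    by (rule diff_chain_at[OF transition_has_derivative[OF M c d x(1,2)]])
      (simp only: p transition_has_derivative[OF M d e x(2,3)])
  then have "(snd e \<circ> chart_inv c has_derivative
      frechet_derivative (snd e \<circ> chart_inv d) (at (snd d x)) \<circ> frechet_derivative (snd d \<circ>
          chart_inv c) (at (snd c x))) (at (snd c x))"
  proof (rule has_derivative_transform_within_open)
    show "open (snd c ` (fst c \<inter> fst d))" by (rule is_chartE(6)[OF cc is_chartE(1)[OF dd]])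
    show "((snd e \<circ> chart_inv d) \<circ> (snd d \<circ> chart_inv c)) y = (snd e \<circ> chart_inv c) y" if "y
        \<in> snd c ` (fst c \<inter> fst d)" for y
      using that chart_inv_simps(1)[OF cc] chart_inv_simps(1)[OF dd] by auto
  qed (use x in blast)
  from frechet_derivative_at[OF this] show ?thesis by (metis comp_apply)
qed

lemma transition_self:
  fixes M :: "('a, 'v::euclidean_space) mfd"
  assumes "smooth_chart M c" "x \<in> fst c"
  shows "frechet_derivative (snd c \<circ> chart_inv c) (at (snd c x)) v = v"
proof -
  note cc = smooth_chart_is_chart[OF assms(1)]
  have "((\<lambda>y. y) has_derivative (\<lambda>y. y)) (at (snd c x))" by simp
  then have "(snd c \<circ> chart_inv c has_derivative (\<lambda>y. y)) (at (snd c x))"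
    by (rule has_derivative_transform_within_open[OF _ is_chartE(2)[OF cc]])
      (use assms chart_inv_simps(1)[OF cc] in auto)
  from frechet_derivative_at[OF this] show ?thesis by metis
qed

definition transition_jacobian :: "('a, real^'n::finite) chart \<Rightarrow> ('a, real^'n) chart \<Rightarrow> real^'n \<Rightarrow>
    real^'n^'n"
  where "transition_jacobian c d y = matrix (frechet_derivative (snd d \<circ> chart_inv c) (at y))"

lemma transition_jacobian_mult:
  assumes "smooth_manifold M" "smooth_chart M c" "smooth_chart M d" "x \<in> fst c" "x \<in> fst d"
  shows "transition_jacobian c d (snd c x) *v v = frechet_derivative (snd d \<circ> chart_inv c) (at
      (snd c x)) v"
proof -
  have "linear (frechet_derivative (snd d \<circ> chart_inv c) (at (snd c x)))"
    using transition_has_derivative[OF assms] has_derivative_linear by blast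
  then show ?thesis by (simp add: transition_jacobian_def matrix_works)
qed

lemma transition_jacobian_det_nonzero:
  fixes M :: "('a, real^'n::finite) mfd"
  assumes M: "smooth_manifold M" and c: "smooth_chart M c" and d: "smooth_chart M d" and x: "x
      \<in> fst c" "x \<in> fst d"
  shows "det (transition_jacobian c d (snd c x)) \<noteq> 0"
proof -
  have "transition_jacobian d c (snd d x) ** transition_jacobian c d (snd c x) = mat 1"
  proof (rule matrix_eq[THEN iffD2], rule allI)
    fix v
    show "(transition_jacobian d c (snd d x) ** transition_jacobian c d (snd c x)) *v v
        = mat 1 *v v"
      using transition_chain_rule[OF M c d c x x(1), of v] transition_self[OF c x(1), of v]
      by (simp add: matrix_vector_mul_assoc[symmetric] transition_jacobian_mult[OF M c d x]
          transition_jacobian_mult[OF M d c x(2,1)])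
  qed
  then have "det (transition_jacobian d c (snd d x)) * det (transition_jacobian c d (snd c x)) = 1"
    by (metis det_I det_mul)
  then show ?thesis by auto
qed

lemma coord_vec_tangent:
  assumes M: "smooth_manifold M" and c: "smooth_chart M c" and x: "x \<in> fst c"
  shows "coord_vec M c x i \<in> tangent_space M x"
  unfolding tangent_space_def mem_Collect_eq
proof (intro conjI allI impI)
  show "coord_vec M c x i d = 0" if "\<not> chart_at M x d" for d using that by (simp add: coord_vec_def)
  fix d e assume de: "chart_at M x d \<and> chart_at M x e"
  then have "smooth_chart M d" "smooth_chart M e" "x \<in> fst d" "x \<in> fst e"
      by (auto simp: chart_at_def)
  from transition_chain_rule[OF M c this(1,2) x this(3,4)] de
  show "coord_vec M c x i e = frechet_derivative (snd e \<circ> chart_inv d) (at (snd d x)) (coord_vec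
      M c x i d)"
    by (simp only: coord_vec_def if_True)
qed

text \<open>The matrix of coordinate vectors in one chart is the Jacobian times the one in another
  chart, so the determinant picks up \<open>det A\<close> independently of the chart in which \<open>A\<close> is given.\<close>

lemma coord_density_densities:
  fixes M :: "('a, real^'n::finite) mfd"
  assumes M: "smooth_manifold M" and c: "smooth_chart M c" and x: "x \<in> fst c"
  shows "r *\<^sub>R coord_density M c x \<in> densities M x"
proof -
  have "coord_density M c x w = \<bar>det A\<bar> * coord_density M c x v"
    if v: "range v \<subseteq> tangent_space M x" and w: "range w \<subseteq> tangent_space M x" and d: "chart_at M x d"
      and A: "\<And>i. w i d = A *v v i d" for v w d and A :: "real^'n^'n"
  proof -
    have d': "smooth_chart M d" "x \<in> fst d" using d by (auto simp: chart_at_def)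
    define J where "J = transition_jacobian d c (snd d x)"
    have J: "u c = J *v u d" if "u \<in> tangent_space M x" for u
    proof -
      have "chart_at M x c" using c x by (simp add: chart_at_def)
      then have "u c = frechet_derivative (snd c \<circ> chart_inv d) (at (snd d x)) (u d)"
        using that d unfolding tangent_space_def by blast
      then show ?thesis unfolding J_def transition_jacobian_mult[OF M d'(1) c d'(2) x] .
    qed
    define V where "V u d = (\<chi> i j. u j d $ i)" for u :: "'n \<Rightarrow> ('a, 'n) tangent_vec" and d
    have mat: "V u c = J ** V u d" if "range u \<subseteq> tangent_space M x" for u
    proof -
      have "u j c = J *v u j d" for j using J that by blast
      then show ?thesis by (simp add: V_def vec_eq_iff matrix_matrix_mult_def
          matrix_vector_mult_def)
    qed
    have "V w d = A ** V v d"
      using A by (simp add: V_def vec_eq_iff matrix_matrix_mult_def matrix_vector_mult_def)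
    then have "det (V w c) = det A * det (V v c)" using mat[OF v] mat[OF w] by (simp add: det_mul)
    then show ?thesis using v w by (simp add: coord_density_def V_def abs_mult)
  qed
  then show ?thesis
    unfolding densities_def by (auto simp: scaleR_fun_def coord_density_def) 
qed

lemma coord_density_coord_vec:
  fixes M :: "('a, real^'n::finite) mfd"
  assumes M: "smooth_manifold M" and c: "smooth_chart M c" and d: "smooth_chart M d" and x: "x
      \<in> fst c" "x \<in> fst d"
  shows "coord_density M d x (coord_vec M c x) = \<bar>det (transition_jacobian c d (snd c x))\<bar>"
proof -
  have "(\<chi> i j. coord_vec M c x j d $ i) = transition_jacobian c d (snd c x)"
    using d x(2) by (simp add: coord_vec_def chart_at_def transition_jacobian_def matrix_def)
  then show ?thesis using coord_vec_tangent[OF M c x(1)] by (auto simp: coord_density_def)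
qed

lemma smooth_on_det:
  fixes A :: "'a::euclidean_space \<Rightarrow> real^'n::finite^'n"
  assumes "open S" "\<And>i j. smooth_on S (\<lambda>y. A y $ i $ j)"
  shows "smooth_on S (\<lambda>y. det (A y))"
  unfolding det_def
  by (intro smooth_on_sum smooth_on_mult smooth_on_prod smooth_on_const assms)

lemma smooth_on_abs:
  fixes f :: "'a::euclidean_space \<Rightarrow> real"
  assumes "open S" "smooth_on S f" "\<And>x. x \<in> S \<Longrightarrow> f x \<noteq> 0"
  shows "smooth_on S (\<lambda>x. \<bar>f x\<bar>)"
proof (rule smooth_on_local)
  fix x assume x: "x \<in> S"
  have cont: "continuous_on S f" by (rule smooth_on_continuous[OF assms(2)])
  have "{y \<in> S. 0 < f y} = S \<inter> f -` {0<..}" "{y \<in> S. f y < 0} = S \<inter> f -` {..<0}" by auto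
  then have P: "open {y \<in> S. 0 < f y}" and N: "open {y \<in> S. f y < 0}"
    using continuous_open_preimage[OF cont assms(1) open_greaterThan[of 0]]
      continuous_open_preimage[OF cont assms(1) open_lessThan[of 0]] by simp_all
  show "\<exists>T. open T \<and> x \<in> T \<and> smooth_on T (\<lambda>x. \<bar>f x\<bar>)"
  proof (cases "0 < f x")
    case True
    have "smooth_on {y \<in> S. 0 < f y} f" by (rule smooth_on_subset[OF assms(2)]) auto
    then have "smooth_on {y \<in> S. 0 < f y} (\<lambda>x. \<bar>f x\<bar>)" by (rule smooth_on_cong[OF P, rotated]) auto
    then show ?thesis using P True x by blast
  next
    case False
    then have n: "f x < 0" using assms(3)[OF x] by simp
    have "smooth_on {y \<in> S. f y < 0} (\<lambda>x. - f x)"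
      by (intro smooth_on_linear_compose[OF N bounded_linear_minus[OF bounded_linear_ident]]
          smooth_on_subset[OF assms(2)]) auto
    then have "smooth_on {y \<in> S. f y < 0} (\<lambda>x. \<bar>f x\<bar>)" by (rule smooth_on_cong[OF N, rotated]) auto
    then show ?thesis using N n x by blast
  qed
qed

lemma smooth_on_transition_det:
  fixes M :: "('a, real^'n::finite) mfd"
  assumes M: "smooth_manifold M" and c: "smooth_chart M c" and d: "smooth_chart M d"
  shows "smooth_on (snd c ` (fst c \<inter> fst d)) (\<lambda>y. \<bar>det (transition_jacobian c d y)\<bar>)"
proof -
  let ?S = "snd c ` (fst c \<inter> fst d)"
  have S: "open ?S" using is_chartE(6)[OF smooth_chart_is_chart[OF c]] is_chartE(1)[OF
      smooth_chart_is_chart[OF d]] by blast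
  have "smooth_on ?S (\<lambda>y. transition_jacobian c d y $ i $ j)" for i j
    unfolding transition_jacobian_def matrix_def
    using smooth_on_linear_compose[OF S bounded_linear_vec_nth smooth_on_derivative[OF S
        transition_smooth[OF M c d]]]
    by simp
  then have "smooth_on ?S (\<lambda>y. det (transition_jacobian c d y))" by (rule smooth_on_det[OF S])
  then show ?thesis
    by (rule smooth_on_abs[OF S]) (use transition_jacobian_det_nonzero[OF M c d] in blast)
qed


section \<open>The sections of the dual bundle that are given by test functions\<close>

lemma fibre_frame:
  assumes "local_trivialization B U \<rho>" "x \<in> U"
  shows "inv_into (fibre B x) \<rho> e \<in> fibre B x" "\<rho> (inv_into (fibre B x) \<rho> e) = e"
proof -
  have "bij_betw \<rho> (fibre B x) UNIV" using assms by (simp add: local_trivialization_def)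
  then have "\<rho> ` fibre B x = UNIV" by (simp add: bij_betw_def)
  then have "e \<in> \<rho> ` fibre B x" by simp
  then show "inv_into (fibre B x) \<rho> e \<in> fibre B x" "\<rho> (inv_into (fibre B x) \<rho> e) = e"
    by (rule inv_into_into, rule f_inv_into_f)
qed

text \<open>The components of the frame of one trivialization in another one are smooth: locally, the
  frame is the inverse of the first trivialization, read in a chart of the total space.\<close>

lemma frame_change_smooth:
  fixes B :: "('m, 'e, 'n::finite, 'r::finite) vbundle"
  assumes B: "smooth_vector_bundle B"
    and c: "smooth_chart (base B) c" and t': "local_trivialization B (fst c) \<rho>'"
    and U: "openin (mtop (base B)) U" and t: "local_trivialization B U \<rho>"
  shows "smooth_on (snd c ` (fst c \<inter> U)) (\<lambda>y. \<rho> (inv_into (fibre B (chart_inv c y)) \<rho>' e))"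
proof (rule smooth_on_local)
  let ?M = "base B" and ?E = "total B"
  let ?f = "\<lambda>a. (proj B a, \<rho>' a)"
  define g where "g = inv_into (over B (fst c)) ?f"
  have M: "smooth_manifold ?M" and E: "smooth_manifold ?E" using B
      by (auto simp: smooth_vector_bundle_def)
  note cc = smooth_chart_is_chart[OF c]
  have cU: "openin (mtop ?M) (fst c)" by (rule is_chartE(1)[OF cc])
  have bij: "bij_betw ?f (over B (fst c)) (fst c \<times> UNIV)"
    and gsm: "smooth_map_on (times_euclidean ?M) (fst c \<times> UNIV) ?E (over B (fst c)) g"
    using t' unfolding g_def local_trivialization_def diffeo_on_def by blast+
  have frame: "inv_into (fibre B x) \<rho>' e = g (x, e)" if "x \<in> fst c" for x
  proof -
    let ?a = "inv_into (fibre B x) \<rho>' e"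
    have a: "?a \<in> fibre B x" "\<rho>' ?a = e" using fibre_frame[OF t' that] by auto
    have "fibre B x \<subseteq> over B (fst c)" "\<And>a. a \<in> fibre B x \<Longrightarrow> proj B a = x" using that
        by (auto simp: over_def)
    then have o: "?a \<in> over B (fst c)" and "proj B ?a = x" using a(1) by blast+
    then have f: "?f ?a = (x, e)" by (simp only: a(2))
    show ?thesis using bij_betw_inv_into_left[OF bij o] unfolding f g_def by (rule sym)
  qed
  have gin: "g (x, w) \<in> over B (fst c)" "proj B (g (x, w)) = x" if "x \<in> fst c" for x w
  proof -
    have "(x, w) \<in> ?f ` over B (fst c)" using bij that by (simp add: bij_betw_def)
    then have "g (x, w) \<in> over B (fst c)" and f: "?f (g (x, w)) = (x, w)"
      unfolding g_def by (rule inv_into_into, rule f_inv_into_f)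
    then show "g (x, w) \<in> over B (fst c)" by blast
    from f show "proj B (g (x, w)) = x" by (rule Pair_inject)
  qed
  fix y0 assume "y0 \<in> snd c ` (fst c \<inter> U)"
  then obtain x0 where x0: "x0 \<in> fst c" "x0 \<in> U" "y0 = snd c x0" by blast
  have "x0 \<in> mspace ?M" using x0 cU openin_subset by blast
  then obtain b where b: "b \<in> matlas ?M" "x0 \<in> fst b" "is_chart (mtop ?M) b"
      using atlas_chart[OF M] by metis
  have "g (x0, e) \<in> mspace ?E" using gin(1)[OF x0(1)] by (auto simp: over_def)
  then obtain d where d: "d \<in> matlas ?E" "g (x0, e) \<in> fst d" "is_chart (mtop ?E) d"
      using atlas_chart[OF E] by metis
  define C where "C = (fst b \<times> (UNIV :: (real^'r) set), \<lambda>(x, w :: real^'r). (snd b x, w))"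
  have C: "C \<in> matlas (times_euclidean ?M)" unfolding C_def times_euclidean_def using b(1) by auto
  have Cinv: "chart_inv C (z, w) = (chart_inv b z, w)" if z: "z \<in> snd b ` fst b" for z w
  proof -
    obtain x where x: "x \<in> fst b" "z = snd b x" using z by blast
    have "inj_on (snd C) (fst C)" using is_chartE(3)[OF b(3)] by (auto simp: C_def inj_on_def)
    from inv_into_f_f[OF this, of "(x, w)"] show ?thesis
      using x chart_inv_simps(1)[OF b(3) x(1)] by (simp add: C_def)
  qed
  define P where "P = snd C ` {q \<in> (fst c \<times> UNIV) \<inter> fst C. g q \<in> fst d}"
  have gsmP: "smooth_on P (snd d \<circ> g \<circ> chart_inv C)"
    using gsm C d(1) unfolding smooth_map_on_def P_def by blast
  \<comment> \<open>\<open>P\<close> is open because \<open>g\<close> is continuous.\<close>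
  have oP: "open P"
  proof -
    let ?O = "snd b ` (fst b \<inter> fst c)"
    have O: "open ?O" using is_chartE(6)[OF b(3) cU] .
    have bi: "chart_inv b z \<in> fst c" if "z \<in> ?O" for z using that chart_inv_simps(1)[OF b(3)]
        by auto
    have "continuous_map (top_of_set (?O \<times> UNIV)) (top_of_set (snd b ` fst b)) fst"
      by (auto simp: continuous_map_in_subtopology intro!: continuous_intros)
    from continuous_map_compose[OF this is_chartE(4)[OF b(3)]]
    have "continuous_map (top_of_set (?O \<times> UNIV)) (mtop ?M) (chart_inv b \<circ> fst)" .
    moreover have "continuous_map (top_of_set (?O \<times> (UNIV :: (real^'r) set))) euclidean snd"
      by (auto intro!: continuous_intros)
    ultimately have "continuous_map (top_of_set (?O \<times> (UNIV :: (real^'r) set))) (prod_topology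
        (mtop ?M) euclidean)
        (\<lambda>(z, w). (chart_inv b z, w))"
      by (subst continuous_map_pairwise) (auto simp: o_def case_prod_unfold)
    then have k: "continuous_map (top_of_set (?O \<times> (UNIV :: (real^'r) set))) (subtopology (mtop
        (times_euclidean ?M)) (fst c \<times> UNIV))
        (\<lambda>(z, w). (chart_inv b z, w))"
      unfolding continuous_map_in_subtopology using bi by (auto simp: times_euclidean_def)
    have "continuous_map (subtopology (mtop (times_euclidean ?M)) (fst c \<times> UNIV)) (mtop ?E) g"
      using gsm unfolding smooth_map_on_def by (blast intro: continuous_map_into_fulltopology)
    from continuous_map_compose[OF k this]
    have "openin (top_of_set (?O \<times> (UNIV :: (real^'r) set))) {q
        \<in> ?O \<times> UNIV. g (chart_inv b (fst q), snd q) \<in> fst d}"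
      using openin_continuous_map_preimage[of _ _ _ "fst d"] is_chartE(1)[OF d(3)]
          by (fastforce simp: o_def case_prod_unfold)
    then have "open {q \<in> ?O \<times> (UNIV :: (real^'r) set). g (chart_inv b (fst q), snd q) \<in> fst d}"
      using O by (simp add: openin_open_eq open_Times)
    moreover have "P = {q \<in> ?O \<times> UNIV. g (chart_inv b (fst q), snd q) \<in> fst d}"
      unfolding P_def C_def using chart_inv_simps(1)[OF b(3)] by (force simp: image_iff)
    ultimately show ?thesis by simp
  qed
  \<comment> \<open>\<open>\<kappa>\<close> maps coordinates in \<open>c\<close> to coordinates of the point \<open>(x, e)\<close> in the product chart \<open>C\<close>.\<close>
  define \<kappa> where "\<kappa> y = (snd b (chart_inv c y), e)" for y
  let ?W = "snd c ` (fst c \<inter> (U \<inter> fst b))"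
  have W: "open ?W" using is_chartE(6)[OF cc] U is_chartE(1)[OF b(3)] by blast
  have ksm: "smooth_on ?W \<kappa>"
  proof -
    have "smooth_on (snd c ` (fst c \<inter> fst b)) (snd b \<circ> chart_inv c)"
      using c b(1) unfolding smooth_chart_def smooth_compatible_def by blast
    then have "smooth_on ?W (snd b \<circ> chart_inv c)" by (rule smooth_on_subset) blast
    from smooth_on_add[OF W smooth_on_linear_compose[OF W _ this] smooth_on_const[of _
        "(0, e)"], of "\<lambda>z. (z, 0)"]
    show ?thesis unfolding \<kappa>_def[abs_def] by (simp add: bounded_linear_Pair bounded_linear_ident
        bounded_linear_zero)
  qed
  define Y where "Y = ?W \<inter> \<kappa> -` P"
  have Y: "open Y" unfolding Y_def by (rule continuous_open_preimage[OF smooth_on_continuous[OF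
      ksm] W oP])
  have ksY: "smooth_on Y \<kappa>" by (rule smooth_on_subset[OF ksm]) (simp add: Y_def)
  have val: "(snd d \<circ> g \<circ> chart_inv C) (\<kappa> y) = snd d (g (chart_inv c y, e))" "chart_inv c y
      \<in> fst c \<inter> U \<inter> fst b"
    "g (chart_inv c y, e) \<in> fst d" if yY: "y \<in> Y" for y
  proof -
    obtain x where x: "x \<in> fst c" "x \<in> U" "x \<in> fst b" "y = snd c x" using yY by (auto simp: Y_def)
    have ci: "chart_inv c y = x" using x chart_inv_simps(1)[OF cc] by simp
    have "chart_inv C (\<kappa> y) = (chart_inv c y, e)"
      unfolding \<kappa>_def ci using x chart_inv_simps(1)[OF b(3)] by (subst Cinv) auto
    then show "(snd d \<circ> g \<circ> chart_inv C) (\<kappa> y) = snd d (g (chart_inv c y, e))" by simp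
    show "chart_inv c y \<in> fst c \<inter> U \<inter> fst b" using x ci by simp
    have "\<kappa> y \<in> P" using yY by (simp add: Y_def)
    then obtain x' w where q: "x' \<in> fst b" "g (x', w) \<in> fst d" "\<kappa> y = (snd b x', w)"
        by (auto simp: P_def C_def)
    then have "x' = x" "w = e" using x is_chartE(3)[OF b(3)] unfolding \<kappa>_def ci
        by (auto dest: inj_onD)
    then show "g (chart_inv c y, e) \<in> fst d" using q ci by simp
  qed
  have y0: "y0 \<in> Y"
  proof -
    have "\<kappa> y0 = snd C (x0, e)" using x0 chart_inv_simps(1)[OF cc] by (simp add: \<kappa>_def C_def)
    moreover have "(x0, e) \<in> {q \<in> (fst c \<times> UNIV) \<inter> fst C. g q \<in> fst d}" using x0 b(2) d(2)
        by (auto simp: C_def)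
    ultimately have "\<kappa> y0 \<in> P" unfolding P_def by blast
    then show ?thesis using x0 b(2) by (auto simp: Y_def)
  qed
  have s1: "smooth_on Y (\<lambda>y. (snd d \<circ> g \<circ> chart_inv C) (\<kappa> y))"
    by (rule smooth_on_compose[OF Y oP _ ksY gsmP]) (auto simp: Y_def)
  \<comment> \<open>On \<open>?T\<close> the second trivialization is a smooth function of the coordinates \<open>d\<close>.\<close>
  let ?T = "snd d ` (over B U \<inter> fst d)"
  have oU: "openin (mtop ?E) (over B U)"
  proof -
    have "continuous_map (mtop ?E) (mtop ?M) (proj B)"
      using B unfolding smooth_vector_bundle_def smooth_map_on_def by simp
    then show ?thesis unfolding over_def using U by (rule openin_continuous_map_preimage)
  qed
  have oT: "open ?T" using is_chartE(6)[OF d(3) oU] by (simp add: Int_commute)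
  have rT: "smooth_on ?T (\<rho> \<circ> chart_inv d)"
    using t d(1) by (simp add: local_trivialization_def smooth_fun_on_def)
  have "(\<lambda>y. (snd d \<circ> g \<circ> chart_inv C) (\<kappa> y)) ` Y \<subseteq> ?T"
  proof (rule image_subsetI)
    fix y assume y: "y \<in> Y"
    have "g (chart_inv c y, e) \<in> over B U"
      using val(2)[OF y] gin[of "chart_inv c y" e] by (auto simp: over_def)
    then show "(snd d \<circ> g \<circ> chart_inv C) (\<kappa> y) \<in> ?T" unfolding val(1)[OF y] using val(3)[OF y]
        by blast
  qed
  from smooth_on_compose[OF Y oT this s1 rT]
  have s2: "smooth_on Y (\<lambda>y. (\<rho> \<circ> chart_inv d) ((snd d \<circ> g \<circ> chart_inv C) (\<kappa> y)))" .
  have "smooth_on Y (\<lambda>y. \<rho> (inv_into (fibre B (chart_inv c y)) \<rho>' e))"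
  proof (rule smooth_on_cong[OF Y _ s2])
    fix y assume y: "y \<in> Y"
    show "(\<rho> \<circ> chart_inv d) ((snd d \<circ> g \<circ> chart_inv C) (\<kappa> y))
        = \<rho> (inv_into (fibre B (chart_inv c y)) \<rho>' e)"
      unfolding val(1)[OF y] using val(2,3)[OF y] frame[of
          "chart_inv c y"] chart_inv_simps(1)[OF d(3)] by simp
  qed
  then show "\<exists>T. open T \<and> y0 \<in> T \<and> smooth_on T (\<lambda>y. \<rho> (inv_into (fibre B (chart_inv c y)) \<rho>' e))"
    using Y y0 by blast
qed

text \<open>The frame of \<open>\<sigma>\<close> differs from that of \<open>\<tau>\<close> by a fibrewise linear map, and the two coordinate
  densities differ by the Jacobian determinant of the transition map.\<close>

lemma local_coeff_local_section:
  fixes B :: "('m, 'e, 'n::finite, 'r::finite) vbundle"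
  assumes B: "smooth_vector_bundle B" and \<tau>: "total_triv_triple B \<tau>" and \<sigma>: "total_triv_triple B \<sigma>"
    and x: "x \<in> fst (fst \<tau>)" "x \<in> fst (fst \<sigma>)"
  shows "local_coeff B \<sigma> k (local_section B \<tau> l \<xi>) (snd (fst \<sigma>) x) =
    \<xi> (snd (fst \<tau>) x) * (snd \<tau> (inv_into (fibre B x) (snd \<sigma>) (axis k 1)) $ l)
      * \<bar>det (transition_jacobian (fst \<sigma>) (fst \<tau>) (snd (fst \<sigma>) x))\<bar>"
proof -
  have M: "smooth_manifold (base B)" using B by (simp add: smooth_vector_bundle_def)
  have c: "smooth_chart (base B) (fst \<sigma>)" "smooth_chart (base B) (fst \<tau>)"
    and t: "local_trivialization B (fst (fst \<sigma>)) (snd \<sigma>)"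
    using \<tau> \<sigma> by (auto simp: total_triv_triple_def)
  show ?thesis
    using coord_density_coord_vec[OF M c x(2,1)] fibre_frame(1)[OF t x(2), of "axis k 1"] x(1)
      chart_inv_simps(1)[OF smooth_chart_is_chart[OF c(1)] x(2)]
    by (simp add: local_coeff_def Let_def local_section_def scaleR_fun_def)
qed

text \<open>On the overlap of two charts the components are products of smooth functions. Off the domain of
  the first chart smoothness is a matter of supports: the set \<open>S\<close> of points with coordinates in the
  support of \<open>\<xi>\<close> is compact, hence closed, and the section vanishes on its complement.\<close>

lemma local_section_test_section:
  fixes B :: "('m, 'e, 'n::finite, 'r::finite) vbundle"
  assumes B: "smooth_vector_bundle B" and \<tau>: "total_triv_triple B \<tau>" and \<xi>: "\<xi>
      \<in> test_functions (chart_image \<tau>)"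
  shows "local_section B \<tau> l \<xi> \<in> test_sections B"
proof -
  let ?\<eta> = "local_section B \<tau> l \<xi>"
  let ?M = "base B"
  define U where "U = fst (fst \<tau>)"
  define \<phi> where "\<phi> = snd (fst \<tau>)"
  have M: "smooth_manifold ?M" using B by (simp add: smooth_vector_bundle_def)
  have c: "smooth_chart ?M (fst \<tau>)" and t: "local_trivialization B U (snd \<tau>)"
    using \<tau> by (auto simp: total_triv_triple_def U_def)
  note cc = smooth_chart_is_chart[OF c]
  have oU: "openin (mtop ?M) U" unfolding U_def by (rule is_chartE(1)[OF cc])
  have Usub: "U \<subseteq> mspace ?M" using oU by (rule openin_subset)
  have fl: "fibre_linear B x (snd \<tau>)" if "x \<in> U" for x using t that
      by (simp add: local_trivialization_def)
  obtain K where K: "smooth_on UNIV \<xi>" "compact K" "K \<subseteq> chart_image \<tau>" "\<And>y. y \<notin> K \<Longrightarrow> \<xi> y = 0"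
    using test_functionsE[OF \<xi>] by metis
  define S where "S = chart_inv (fst \<tau>) ` K"
  have S: "compactin (mtop ?M) S"
    unfolding S_def
  proof (rule image_compactin)
    show "continuous_map (top_of_set (snd (fst \<tau>) ` fst (fst \<tau>))) (mtop ?M) (chart_inv (fst \<tau>))"
        by (rule is_chartE(4)[OF cc])
    show "compactin (top_of_set (snd (fst \<tau>) ` fst (fst \<tau>))) K"
      using K by (simp add: compactin_subtopology chart_image_def)
  qed
  have clS: "closedin (mtop ?M) S"
    using M S by (simp add: smooth_manifold_def compactin_imp_closedin)
  have zero: "\<xi> (\<phi> x) = 0" if "x \<in> U" "x \<notin> S" for x
  proof -
    have "\<phi> x \<notin> K"
      using that chart_inv_simps(1)[OF cc, of x] unfolding S_def U_def \<phi>_def by (metis image_eqI)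
    then show ?thesis by (rule K(4))
  qed
  have \<eta>0: "?\<eta> x a = 0" if "x \<notin> U \<or> x \<notin> S \<or> a \<notin> fibre B x" for x a
    using that zero[of x] by (auto simp: local_section_def U_def \<phi>_def)
  have \<eta>U: "?\<eta> x a = (\<xi> (\<phi> x) * (snd \<tau> a $ l)) *\<^sub>R coord_density ?M (fst \<tau>) x" if "x \<in> U" "a
      \<in> fibre B x" for x a
    using that unfolding local_section_def U_def \<phi>_def by simp
  have 1: "?\<eta> x a = 0" if "x \<notin> mspace ?M \<or> a \<notin> fibre B x" for x a
    using that Usub \<eta>0 by blast
  have 2: "fibre_linear B x (?\<eta> x) \<and> ?\<eta> x ` fibre B x \<subseteq> densities ?M x" if x: "x \<in> mspace ?M" for x
  proof (cases "x \<in> U")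
    case True
    have vs: "real_vector_space_on (fibre B x) (fib_add B) (fib_scale B) (fib_zero B x)"
      using B x by (simp add: smooth_vector_bundle_def)
    have cl: "fib_add B a b \<in> fibre B x" "fib_scale B r a \<in> fibre B x" if "a \<in> fibre B x" "b
        \<in> fibre B x" for a b r
    proof -
      note vs' = vs[unfolded real_vector_space_on_def, THEN conjunct2]
      show "fib_add B a b \<in> fibre B x" using vs'[THEN conjunct1] that by blast
      show "fib_scale B r a \<in> fibre B x" using vs'[THEN conjunct2, THEN conjunct1, THEN spec]
          that(1) by (rule bspec)
    qed
    have "fibre_linear B x (?\<eta> x)"
      using fl[OF True] cl unfolding fibre_linear_def
      by (simp add: \<eta>U[OF True] scaleR_add_left[symmetric] distrib_left mult.left_commute)
    moreover have "?\<eta> x a \<in> densities ?M x" if "a \<in> fibre B x" for a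
      unfolding \<eta>U[OF True that] using coord_density_densities[OF M c] True by (simp add: U_def)
    ultimately show ?thesis by blast
  next
    case False
    have z: "?\<eta> x = (\<lambda>a. 0)" using \<eta>0 False by blast
    have "(0 :: ('m, 'n) dens) \<in> densities ?M x" by (simp add: densities_def)
    then show ?thesis unfolding z by (auto simp: fibre_linear_def)
  qed
  have 3: "smooth_on (chart_image \<sigma>) (local_coeff B \<sigma> k ?\<eta>)" if \<sigma>: "total_triv_triple B \<sigma>" for \<sigma> k
  proof (rule smooth_on_local)
    have d: "smooth_chart ?M (fst \<sigma>)" and t': "local_trivialization B (fst (fst \<sigma>)) (snd \<sigma>)"
      using \<sigma> by (auto simp: total_triv_triple_def)
    note dd = smooth_chart_is_chart[OF d]
    let ?\<psi> = "snd (fst \<sigma>)" and ?V = "fst (fst \<sigma>)"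
    fix y assume "y \<in> chart_image \<sigma>"
    then obtain x where x: "x \<in> ?V" "y = ?\<psi> x" by (auto simp: chart_image_def)
    show "\<exists>T. open T \<and> y \<in> T \<and> smooth_on T (local_coeff B \<sigma> k ?\<eta>)"
    proof (cases "x \<in> U")
      case True
      let ?T = "?\<psi> ` (?V \<inter> U)"
      have T: "open ?T" by (rule is_chartE(6)[OF dd oU])
      let ?f = "\<lambda>y. \<xi> ((\<phi> \<circ> chart_inv (fst \<sigma>)) y) * (snd \<tau> (inv_into (fibre B (chart_inv (fst \<sigma>)
          y)) (snd \<sigma>) (axis k 1)) $ l)
        * \<bar>det (transition_jacobian (fst \<sigma>) (fst \<tau>) y)\<bar>"
      have "smooth_on ?T (\<phi> \<circ> chart_inv (fst \<sigma>))" unfolding U_def \<phi>_def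
          by (rule transition_smooth[OF M d c])
      from smooth_on_compose[OF T open_UNIV subset_UNIV this K(1)]
      have "smooth_on ?T (\<lambda>y. \<xi> ((\<phi> \<circ> chart_inv (fst \<sigma>)) y))" .
      moreover have "smooth_on ?T (\<lambda>y. snd \<tau> (inv_into (fibre B (chart_inv (fst \<sigma>) y)) (snd \<sigma>)
          (axis k 1)) $ l)"
        by (rule smooth_on_linear_compose[OF T bounded_linear_vec_nth frame_change_smooth[OF B d
            t' oU t]])
      moreover have "smooth_on ?T (\<lambda>y. \<bar>det (transition_jacobian (fst \<sigma>) (fst \<tau>) y)\<bar>)"
        unfolding U_def by (rule smooth_on_transition_det[OF M d c])
      ultimately have "smooth_on ?T ?f" by (intro smooth_on_mult T)
      then have "smooth_on ?T (local_coeff B \<sigma> k ?\<eta>)"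
      proof (rule smooth_on_cong[OF T, rotated])
        fix y assume "y \<in> ?T"
        then obtain x where "x \<in> ?V" "x \<in> U" "y = ?\<psi> x" by blast
        then show "?f y = local_coeff B \<sigma> k ?\<eta> y"
          using local_coeff_local_section[OF B \<tau> \<sigma>, of x k l \<xi>] chart_inv_simps(1)[OF dd, of x]
          by (simp add: U_def \<phi>_def)
      qed
      then show ?thesis using T True x by blast
    next
      case False
      let ?T = "?\<psi> ` (?V \<inter> (mspace ?M - S))"
      have T: "open ?T" by (rule is_chartE(6)[OF dd]) (rule openin_diff[OF openin_topspace clS])
      have "smooth_on ?T (\<lambda>y. 0 :: real)" by (rule smooth_on_const)
      then have "smooth_on ?T (local_coeff B \<sigma> k ?\<eta>)"
      proof (rule smooth_on_cong[OF T, rotated])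
        fix y assume "y \<in> ?T"
        then obtain x where x: "x \<in> ?V" "x \<notin> S" "y = ?\<psi> x" by blast
        have "?\<eta> x = (\<lambda>a. 0)" using \<eta>0 x(2) by blast
        then show "0 = local_coeff B \<sigma> k ?\<eta> y"
          using chart_inv_simps(1)[OF dd x(1)] x(3) by (simp add: local_coeff_def Let_def)
      qed
      moreover have "S \<subseteq> U"
        using K(3) chart_inv_simps(3)[OF cc] unfolding S_def U_def chart_image_def by blast
      then have "y \<in> ?T" using x False is_chartE(1)[OF dd] openin_subset by fastforce
      ultimately show ?thesis using T by blast
    qed
  qed
  have 4: "compactin (mtop ?M) (section_supp B ?\<eta>)"
  proof -
    have "{x \<in> mspace ?M. ?\<eta> x \<noteq> 0} \<subseteq> S" using \<eta>0 by (fastforce simp: fun_eq_iff)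
    then have "section_supp B ?\<eta> \<subseteq> S" unfolding section_supp_def
        by (rule closure_of_minimal[OF _ clS])
    then show ?thesis using closed_compactin[OF S] by (simp add: section_supp_def)
  qed
  show ?thesis
    unfolding test_sections_def using 1 2 3 4 by blast
qed


section \<open>Embeddings of Sobolev spaces of sections\<close>

lemma local_repr_diff:
  "local_repr B \<tau> (mult_distr B \<psi> (v - u)) l = local_repr B \<tau> (mult_distr B \<psi> v) l - local_repr B
      \<tau> (mult_distr B \<psi> u) l"
  by (auto simp: local_repr_def mult_distr_def fun_eq_iff)

lemma local_repr_outside: "\<xi> \<notin> test_functions (chart_image \<tau>) \<Longrightarrow> local_repr B \<tau> u l \<xi> = 0"
  by (simp add: local_repr_def)

text \<open>Where \<open>h\<close> differs from \<open>1\<close> the function \<open>\<psi>\<close> vanishes.\<close>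

lemma local_repr_cutoff:
  fixes B :: "('m, 'e, 'n::finite, 'r::finite) vbundle"
  assumes B: "smooth_vector_bundle B" and \<tau>: "total_triv_triple B \<tau>" and h: "smooth_on UNIV h"
    and one: "\<And>x. x \<in> fst (fst \<tau>) \<Longrightarrow> \<psi> x \<noteq> 0 \<Longrightarrow> h (snd (fst \<tau>) x) = 1"
    and \<xi>: "\<xi> \<in> test_functions (chart_image \<tau>)"
  shows "local_repr B \<tau> (mult_distr B \<psi> u) l \<xi> = local_repr B \<tau> (mult_distr B \<psi> u) l (\<lambda>y. h y * \<xi>
      y)"
proof -
  have h\<xi>: "(\<lambda>y. h y * \<xi> y) \<in> test_functions (chart_image \<tau>)"
    using test_functions_mult[OF \<xi> h] by (simp add: mult.commute)
  have "\<psi> x *\<^sub>R local_section B \<tau> l \<xi> x a = \<psi> x *\<^sub>R local_section B \<tau> l (\<lambda>y. h y * \<xi> y) x a" for x a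
    using one[of x] by (cases "\<psi> x = 0") (auto simp: local_section_def)
  then have "(\<lambda>x. \<psi> x *\<^sub>R local_section B \<tau> l \<xi> x)
      = (\<lambda>x. \<psi> x *\<^sub>R local_section B \<tau> l (\<lambda>y. h y * \<xi> y) x)"
    by (simp add: fun_eq_iff scaleR_fun_def)
  then show ?thesis
    using \<xi> h\<xi> local_section_test_section[OF B \<tau>] by (simp add: local_repr_def mult_distr_def)
qed

lemma sum_list_less_top: "(\<And>x. x \<in> set xs \<Longrightarrow> f x < (\<infinity> :: ennreal)) \<Longrightarrow> (\<Sum>x\<leftarrow>xs. f x) < \<infinity>"
  by (induction xs) auto

lemma member_le_sum_list_ennreal: "x \<in> set xs \<Longrightarrow> f x \<le> (\<Sum>x\<leftarrow>xs. f x :: ennreal)"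
  by (induction xs) (auto intro: add_increasing add_increasing2)

lemma sum_list_small:
  fixes N M :: "'i \<Rightarrow> 'w \<Rightarrow> ennreal"
  assumes "\<And>x \<epsilon>. x \<in> set xs \<Longrightarrow> 0 < \<epsilon> \<Longrightarrow> \<exists>\<delta>>0. \<forall>w. P w \<longrightarrow> N x w < ennreal \<delta> \<longrightarrow> M x w < ennreal \<epsilon>" and
      "0 < \<epsilon>"
  shows "\<exists>\<delta>>0. \<forall>w. P w \<longrightarrow> (\<Sum>x\<leftarrow>xs. N x w) < ennreal \<delta> \<longrightarrow> (\<Sum>x\<leftarrow>xs. M x w) < ennreal \<epsilon>"
  using assms
proof (induction xs arbitrary: \<epsilon>)
  case (Cons x xs)
  have e: "0 < \<epsilon> / 2" using Cons.prems(2) by simp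
  obtain \<delta>1 where 1: "0 < \<delta>1" "\<And>w. P w \<Longrightarrow> N x w < ennreal \<delta>1 \<Longrightarrow> M x w < ennreal (\<epsilon> / 2)"
    using Cons.prems(1)[of x, OF _ e] by auto
  obtain \<delta>2 where 2: "0 < \<delta>2" "\<And>w. P w \<Longrightarrow> (\<Sum>x\<leftarrow>xs. N x w) < ennreal \<delta>2 \<Longrightarrow> (\<Sum>x\<leftarrow>xs. M x w)
      < ennreal (\<epsilon> / 2)"
    using Cons.IH[OF _ e] Cons.prems(1) by auto
  show ?case
  proof (intro exI[of _ "min \<delta>1 \<delta>2"] conjI allI impI)
    fix w assume w: "P w" and s: "(\<Sum>x\<leftarrow>x # xs. N x w) < ennreal (min \<delta>1 \<delta>2)"
    have "N x w \<le> (\<Sum>x\<leftarrow>x # xs. N x w)" "(\<Sum>x\<leftarrow>xs. N x w) \<le> (\<Sum>x\<leftarrow>x # xs. N x w)" by simp_all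
    moreover have "ennreal (min \<delta>1 \<delta>2) \<le> ennreal \<delta>1" "ennreal (min \<delta>1 \<delta>2) \<le> ennreal \<delta>2"
        by (simp_all add: ennreal_leI)
    ultimately have "N x w < ennreal \<delta>1" "(\<Sum>x\<leftarrow>xs. N x w) < ennreal \<delta>2" using s
        by (meson le_less_trans less_le_trans)+
    then have "M x w + (\<Sum>x\<leftarrow>xs. M x w) < ennreal (\<epsilon> / 2) + ennreal (\<epsilon> / 2)"
      by (intro add_strict_mono 1 2 w)
    also have "\<dots> = ennreal \<epsilon>" using e by (simp flip: ennreal_plus)
    finally show "(\<Sum>x\<leftarrow>x # xs. M x w) < ennreal \<epsilon>" by simp
  qed (use 1 2 in simp)
qed (auto intro: exI[of _ 1])

text \<open>The embedding may be taken on any open set that contains a given compact set; the supports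
  of the functions of the partition of unity, read in the charts, are compact.\<close>

lemma sobolev_sections_embedsI:
  fixes B :: "('m, 'e, 'n::finite, 'r::finite) vbundle" and \<Lambda> :: "('m, 'e, 'n, 'r) aug_atlas"
  assumes B: "smooth_vector_bundle B" and cpt: "compact_space (mtop (base B))"
    and \<Lambda>: "augmented_triv_atlas B \<Lambda>" and q: "1 < q1" "1 < q2"
    and emb: "\<And>K :: (real^'n) set. compact K \<Longrightarrow> \<exists>\<Omega>. open \<Omega> \<and> K \<subseteq> \<Omega> \<and> sobolev_embeds \<Omega> e1 q1 e2 q2"
  shows "sobolev_sections_embeds B \<Lambda> e1 q1 e2 q2"
proof -
  define R where "R \<alpha> l u = local_repr B (fst \<alpha>) (mult_distr B (snd \<alpha>) u) l"
    for \<alpha> :: "('m, 'e, 'n, 'r) triv_triple \<times> ('m \<Rightarrow> real)" and l and u ::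
        "('m, 'e, 'n) dual_section \<Rightarrow> real"
  define N where "N e p \<alpha> l u = sobolev_norm (chart_image (fst \<alpha>)) e p (R \<alpha> l u)"
    for e p \<alpha> l and u
  have norm_eq: "sobolev_section_norm B \<Lambda> e p u = (\<Sum>\<alpha>\<leftarrow>\<Lambda>. \<Sum>l\<in>UNIV. N e p \<alpha> l u)" for e p u
    by (simp add: sobolev_section_norm_def N_def R_def case_prod_unfold)
  have fin_iff: "sobolev_section_norm B \<Lambda> e p u < \<infinity> \<longleftrightarrow> (\<forall>\<alpha>\<in>set \<Lambda>. \<forall>l. N e p \<alpha> l u < \<infinity>)" for e p u
  proof
    assume *: "sobolev_section_norm B \<Lambda> e p u < \<infinity>"
    show "\<forall>\<alpha>\<in>set \<Lambda>. \<forall>l. N e p \<alpha> l u < \<infinity>"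
    proof (intro ballI allI)
      fix \<alpha> l assume "\<alpha> \<in> set \<Lambda>"
      have "N e p \<alpha> l u \<le> (\<Sum>l\<in>UNIV. N e p \<alpha> l u)" by (intro member_le_sum) auto
      also have "\<dots> \<le> sobolev_section_norm B \<Lambda> e p u"
        unfolding norm_eq by (rule member_le_sum_list_ennreal[OF \<open>\<alpha> \<in> set \<Lambda>\<close>])
      finally show "N e p \<alpha> l u < \<infinity>" using * by (rule order_le_less_trans)
    qed
  next
    assume "\<forall>\<alpha>\<in>set \<Lambda>. \<forall>l. N e p \<alpha> l u < \<infinity>"
    then show "sobolev_section_norm B \<Lambda> e p u < \<infinity>"
      unfolding norm_eq by (intro sum_list_less_top) simp
  qed
  have R_diff: "R \<alpha> l (v - u) = R \<alpha> l v - R \<alpha> l u" for \<alpha> l u v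
    unfolding R_def by (rule local_repr_diff)
  have comp: "(N e1 q1 \<alpha> l u < \<infinity> \<longrightarrow> N e2 q2 \<alpha> l u < \<infinity>) \<and>
    (N e1 q1 \<alpha> l u < \<infinity> \<longrightarrow> (\<forall>\<epsilon>>0. \<exists>\<delta>>0. \<forall>v. N e1 q1 \<alpha> l v < \<infinity> \<longrightarrow>
      N e1 q1 \<alpha> l (v - u) < ennreal \<delta> \<longrightarrow> N e2 q2 \<alpha> l (v - u) < ennreal \<epsilon>))"
    if \<alpha>: "\<alpha> \<in> set \<Lambda>" for \<alpha> l u
  proof -
    obtain \<tau> \<psi> where a: "\<alpha> = (\<tau>, \<psi>)" by (cases \<alpha>)
    let ?V = "chart_image \<tau>"
    define S where "S = mtop (base B) closure_of {x \<in> mspace (base B). \<psi> x \<noteq> 0}"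
    have \<tau>: "total_triv_triple B \<tau>" and SU: "S \<subseteq> fst (fst \<tau>)"
      using \<Lambda> \<alpha> unfolding augmented_triv_atlas_def a S_def by auto
    have ch: "is_chart (mtop (base B)) (fst \<tau>)"
      using \<tau> by (simp add: total_triv_triple_def smooth_chart_def)
    have oV: "open ?V" unfolding chart_image_def by (rule is_chartE(2)[OF ch])
    define K where "K = snd (fst \<tau>) ` S"
    have "compactin (mtop (base B)) S"
      unfolding S_def by (rule closedin_compact_space[OF cpt closedin_closure_of])
    then have "compactin (subtopology (mtop (base B)) (fst (fst \<tau>))) S"
      using SU by (simp add: compactin_subtopology)
    from image_compactin[OF this is_chartE(5)[OF ch]] have K: "compact K" unfolding K_def by simp
    have KV: "K \<subseteq> ?V" using SU by (auto simp: K_def chart_image_def)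
    obtain \<Omega> where \<Omega>: "open \<Omega>" "K \<subseteq> \<Omega>" "sobolev_embeds \<Omega> e1 q1 e2 q2" using emb[OF K] by blast
    obtain h L where h: "smooth_on UNIV h" "compact L" "L \<subseteq> ?V \<inter> \<Omega>" "\<And>x. x \<notin> L \<Longrightarrow> h x = 0" "\<And>x. x
        \<in> K \<Longrightarrow> h x = (1 :: real)"
      using compact_subset_open_smooth_cutoff[OF K open_Int[OF oV \<Omega>(1)]] KV \<Omega>(2) by blast
    have ht: "h \<in> test_functions (?V \<inter> \<Omega>)" by (rule test_functionsI[OF h(1-4)])
    have one: "h (snd (fst \<tau>) x) = 1" if "x \<in> fst (fst \<tau>)" "\<psi> x \<noteq> 0" for x
    proof -
      have "x \<in> mspace (base B)" using that(1) is_chartE(1)[OF ch] openin_subset by blast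
      then have "x \<in> S" unfolding S_def using that(2)
          by (auto intro: closure_of_subset[THEN subsetD])
      then show ?thesis using h(5) by (simp add: K_def)
    qed
    have R1: "R \<alpha> l u \<xi> = R \<alpha> l u (\<lambda>y. h y * \<xi> y)" if "\<xi> \<in> test_functions ?V" for u \<xi>
      unfolding R_def a fst_conv snd_conv by (rule local_repr_cutoff[OF B \<tau> h(1) one that])
    have R2: "R \<alpha> l u \<xi> = 0" if "\<xi> \<notin> test_functions ?V" for u \<xi>
      unfolding R_def a fst_conv snd_conv by (rule local_repr_outside[OF that])
    show ?thesis
    proof (intro conjI impI allI)
      assume fin: "N e1 q1 \<alpha> l u < \<infinity>"
      then have fin': "sobolev_norm ?V e1 q1 (R \<alpha> l u) < \<infinity>" by (simp add: N_def a)
      have "sobolev_norm ?V e2 q2 (R \<alpha> l u) < \<infinity>"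
        by (rule sobolev_embeds_transfer(1)[OF oV \<Omega>(1) ht q \<Omega>(3) _ _ fin']) (erule R1, erule R2)
      then show "N e2 q2 \<alpha> l u < \<infinity>" by (simp add: N_def a)
      fix \<epsilon> :: real assume "0 < \<epsilon>"
      have "\<exists>\<delta>>0. \<forall>v. (\<forall>\<phi>\<in>test_functions ?V. v \<phi> = v (\<lambda>x. h x * \<phi> x)) \<longrightarrow>
          (\<forall>\<phi>. \<phi> \<notin> test_functions ?V \<longrightarrow> v \<phi> = 0) \<longrightarrow> sobolev_norm ?V e1 q1 v < \<infinity> \<longrightarrow>
          sobolev_norm ?V e1 q1 (v - R \<alpha> l u) < ennreal \<delta> \<longrightarrow> sobolev_norm ?V e2 q2 (v - R \<alpha> l u)
              < ennreal \<epsilon>"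
        by (rule sobolev_embeds_transfer(2)[OF oV \<Omega>(1) ht q \<Omega>(3) _ _ fin' \<open>0
            < \<epsilon>\<close>]) (erule R1, erule R2)
      then obtain \<delta> where \<delta>: "0 < \<delta>" "\<forall>v. (\<forall>\<phi>\<in>test_functions ?V. v \<phi> = v (\<lambda>x. h x * \<phi> x)) \<longrightarrow>
          (\<forall>\<phi>. \<phi> \<notin> test_functions ?V \<longrightarrow> v \<phi> = 0) \<longrightarrow> sobolev_norm ?V e1 q1 v < \<infinity> \<longrightarrow>
          sobolev_norm ?V e1 q1 (v - R \<alpha> l u) < ennreal \<delta> \<longrightarrow> sobolev_norm ?V e2 q2 (v - R \<alpha> l u)
              < ennreal \<epsilon>"
        by blast
      show "\<exists>\<delta>>0. \<forall>v. N e1 q1 \<alpha> l v < \<infinity> \<longrightarrow> N e1 q1 \<alpha> l (v - u) < ennreal \<delta> \<longrightarrow> N e2 q2 \<alpha> l (v - u)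
          < ennreal \<epsilon>"
      proof (intro exI[of _ \<delta>] conjI allI impI)
        fix v assume "N e1 q1 \<alpha> l v < \<infinity>" "N e1 q1 \<alpha> l (v - u) < ennreal \<delta>"
        then show "N e2 q2 \<alpha> l (v - u) < ennreal \<epsilon>"
          using \<delta>(2)[rule_format, of "R \<alpha> l v"] R1 R2 by (simp add: N_def a R_diff)
      qed (rule \<delta>(1))
    qed
  qed
  obtain ls :: "'r list" where ls: "set ls = UNIV" "distinct ls"
      using finite_distinct_list[OF finite_class.finite_UNIV] by metis
  have sum_ls: "(\<Sum>l\<in>UNIV. f l) = (\<Sum>l\<leftarrow>ls. f l)" for f :: "'r \<Rightarrow> ennreal"
    using sum_list_distinct_conv_sum_set[OF ls(2), of f] ls(1) by simp
  show ?thesis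
    unfolding sobolev_sections_embeds_def continuously_included_def
  proof (intro conjI ballI allI impI)
    show "sobolev_sections B \<Lambda> e1 q1 \<subseteq> sobolev_sections B \<Lambda> e2 q2"
      unfolding sobolev_sections_def fin_iff using comp by blast
    fix u \<epsilon> assume u: "u \<in> sobolev_sections B \<Lambda> e1 q1" and \<epsilon>: "0 < (\<epsilon> :: real)"
    define P where "P v \<longleftrightarrow> v \<in> sobolev_sections B \<Lambda> e1 q1" for v
    have P: "N e1 q1 \<alpha> l v < \<infinity>" if "P v" "\<alpha> \<in> set \<Lambda>" for v \<alpha> l
      using that fin_iff by (simp add: P_def sobolev_sections_def)
    have "\<exists>\<delta>>0. \<forall>v. P v \<longrightarrow> (\<Sum>\<alpha>\<leftarrow>\<Lambda>. \<Sum>l\<leftarrow>ls. N e1 q1 \<alpha> l (v - u)) < ennreal \<delta> \<longrightarrow>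
        (\<Sum>\<alpha>\<leftarrow>\<Lambda>. \<Sum>l\<leftarrow>ls. N e2 q2 \<alpha> l (v - u)) < ennreal \<epsilon>"
    proof (rule sum_list_small[where N = "\<lambda>\<alpha> v. \<Sum>l\<leftarrow>ls. N e1 q1 \<alpha> l (v - u)" and M =
        "\<lambda>\<alpha> v. \<Sum>l\<leftarrow>ls. N e2 q2 \<alpha> l (v - u)", OF _ \<epsilon>])
      fix \<alpha> \<epsilon> assume \<alpha>: "\<alpha> \<in> set \<Lambda>" and e: "0 < (\<epsilon> :: real)"
      show "\<exists>\<delta>>0. \<forall>v. P v \<longrightarrow> (\<Sum>l\<leftarrow>ls. N e1 q1 \<alpha> l (v - u)) < ennreal \<delta>
          \<longrightarrow> (\<Sum>l\<leftarrow>ls. N e2 q2 \<alpha> l (v - u)) < ennreal \<epsilon>"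
      proof (rule sum_list_small[where N = "\<lambda>l v. N e1 q1 \<alpha> l (v - u)" and M =
          "\<lambda>l v. N e2 q2 \<alpha> l (v - u)", OF _ e])
        fix l \<epsilon> assume e: "0 < (\<epsilon> :: real)"
        have "N e1 q1 \<alpha> l u < \<infinity>" using P[of u] u \<alpha> by (simp add: P_def)
        then obtain \<delta> where "0 < \<delta>" "\<forall>v. N e1 q1 \<alpha> l v < \<infinity> \<longrightarrow> N e1 q1 \<alpha> l (v - u) < ennreal \<delta>
            \<longrightarrow> N e2 q2 \<alpha> l (v - u) < ennreal \<epsilon>"
          using comp[OF \<alpha>, of l u] e by blast
        then show "\<exists>\<delta>>0. \<forall>v. P v \<longrightarrow> N e1 q1 \<alpha> l (v - u) < ennreal \<delta> \<longrightarrow> N e2 q2 \<alpha> l (v - u)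
            < ennreal \<epsilon>"
          using P[OF _ \<alpha>] by blast
      qed
    qed
    then show "\<exists>\<delta>>0. \<forall>v\<in>sobolev_sections B \<Lambda> e1 q1. sobolev_section_norm B \<Lambda> e1 q1 (v - u)
        < ennreal \<delta> \<longrightarrow>
        sobolev_section_norm B \<Lambda> e2 q2 (v - u) < ennreal \<epsilon>"
      unfolding norm_eq sum_ls P_def by blast
  qed
qed

theorem theorem9p12:
  fixes B :: "('m, 'e, 'n::finite, 'r::finite) vbundle"
    and \<Lambda> :: "('m, 'e, 'n, 'r) aug_atlas"
    and e1 e2 q1 q2 :: real
  assumes "smooth_vector_bundle B"
    and "compact_space (mtop (base B))"
    and "augmented_triv_atlas B \<Lambda>"
    and "1 < q1" and "1 < q2"
    and "nonint_below e1 \<or> nonint_below e2 \<Longrightarrow> GGL \<Lambda>"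
  shows "(\<not> nonint_below e1 \<and> \<not> nonint_below e2 \<and>
        sobolev_embeds (UNIV :: (real^'n) set) e1 q1 e2 q2 \<longrightarrow>
        sobolev_sections_embeds B \<Lambda> e1 q1 e2 q2) \<and>
    (\<not> nonint_below e1 \<and> \<not> nonint_below e2 \<and>
        (\<forall>(x::real^'n) r. 0 < r \<longrightarrow> sobolev_embeds (ball x r) e1 q1 e2 q2) \<longrightarrow>
        sobolev_sections_embeds B \<Lambda> e1 q1 e2 q2) \<and>
    ((nonint_below e1 \<or> nonint_below e2) \<and>
        sobolev_embeds (UNIV :: (real^'n) set) e1 q1 e2 q2 \<and>
        (\<forall>\<Omega> :: (real^'n) set. open \<Omega> \<and> connected \<Omega> \<and> \<Omega> \<noteq> {} \<and> bounded \<Omega> \<and>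
            lipschitz_boundary \<Omega> \<longrightarrow> sobolev_embeds \<Omega> e1 q1 e2 q2) \<longrightarrow>
        sobolev_sections_embeds B \<Lambda> e1 q1 e2 q2)"
proof -
  note I = sobolev_sections_embedsI[OF assms(1-5)]
  have whole: "sobolev_sections_embeds B \<Lambda> e1 q1 e2 q2"
    if "sobolev_embeds (UNIV :: (real^'n) set) e1 q1 e2 q2"
    by (rule I) (use that in blast)
  have "sobolev_sections_embeds B \<Lambda> e1 q1 e2 q2"
    if balls: "\<forall>(x::real^'n) r. 0 < r \<longrightarrow> sobolev_embeds (ball x r) e1 q1 e2 q2"
  proof (rule I)
    fix K :: "(real^'n) set" assume "compact K"
    then obtain r where "0 < r" "K \<subseteq> ball 0 r"
      using bounded_subset_ballD[OF compact_imp_bounded, of K 0] by blast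
    then show "\<exists>\<Omega>. open \<Omega> \<and> K \<subseteq> \<Omega> \<and> sobolev_embeds \<Omega> e1 q1 e2 q2"
      using balls by blast
  qed
  with whole show ?thesis by blast
qed

end
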